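(* Let $\mu\ne\delta_0$ be a Borel probability measure on $[0,+\infty)$, and let $t>1$. (1) A point $x\in(0,+\infty)$ satisfies $\eta_{\mu^{\boxtimes t}}(x)=1$ if and only if $x^{-1/t}$ is an atom of $\mu$ with mass $\mu(\{x^{-1/t}\})\ge(t-1)/t$. If $\mu(\{x^{-1/t}\})>(t-1)/t$, then $1/x$ is an atom of $\mu^{\boxtimes t}$, and $$\mu^{\boxtimes t}(\{1/x\})=t\,\mu(\{x^{-1/t}\})-(t-1).$$ (2) The nonatomic part of $\mu^{\boxtimes t}$ is absolutely continuous (with respect to Lebesgue measure), and its density is continuous except at the (finitely many) points $1/x$ such that $\eta_{\mu^{\boxtimes t}}(x)=1$. (3) The density of $\mu^{\boxtimes t}$ is analytic at all points where it is different from zero.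
   Context: For a Borel probability measure $\mu$ on $[0,+\infty)$ set $\psi_\mu(z)=\int_{[0,+\infty)}\frac{zs}{1-zs}\,d\mu(s)$ and $\eta_\mu=\psi_\mu/(1+\psi_\mu)$ on $\mathbb C\setminus[0,+\infty)$. If $\mu\neq\delta_0$, $\eta_\mu$ is injective on $(-\infty,0)$, maps it into $(-\infty,0)$, and $\lim_{x\uparrow0}\eta_\mu(x)=0$; with $\eta_\mu^{-1}$ the inverse of $\eta_\mu|_{(-\infty,0)}$ put $\Sigma_\mu(z)=\eta_\mu^{-1}(z)/z$. For $\mu\ne\delta_0$ and $t\ge1$, $\mu^{\boxtimes t}$ denotes the (unique) probability measure on $[0,+\infty)$, different from $\delta_0$, with $\Sigma_{\mu^{\boxtimes t}}(z)=\Sigma_\mu(z)^t$ for $z<0$ sufficiently close to $0$; it exists for every $t\ge1$. There is an analytic self-map $\omega_t$ of $\mathbb C\setminus[0,+\infty)$ with $\eta_{\mu^{\boxtimes t}}=\eta_\mu\circ\omega_t$ and $\omega_t(z)=\eta_{\mu^{\boxtimes t}}(z)[z/\eta_{\mu^{\boxtimes t}}(z)]^{1/t}$ (powers positive for $z<0$). For $t>1$ the restriction of $\eta_{\mu^{\boxtimes t}}$ to the upper half-plane $\mathbb C^+$ extends continuously to $\mathbb C^+\cup(0,+\infty)$, and $\eta_{\mu^{\boxtimes t}}(x)$ for $x>0$ denotes the value of this extension.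
   Formalization: Continuity of the density in (2) is asserted on (0,+∞) minus the points 1/x, not at 0, where it can fail: for the Marchenko–Pastur law the density of the power is unbounded at 0. *)

theory Defs
  imports "HOL-Probability.Probability"
begin

text \<open>
  A Borel probability measure on \<open>[0, \<infinity>)\<close> is encoded as a Borel probability measure
  on the real line that gives full mass to \<open>[0, \<infinity>)\<close>.
\<close>

definition prob_on_nonneg :: "real measure \<Rightarrow> bool" where
  "prob_on_nonneg \<mu> \<longleftrightarrow> real_distribution \<mu> \<and> measure \<mu> {0..} = 1"

text \<open>The transforms \<open>\<psi>\<close> and \<open>\<eta>\<close>; they are meaningful for \<open>z\<close> outside \<open>[0, \<infinity>)\<close>.\<close>

definition psi_transform :: "real measure \<Rightarrow> complex \<Rightarrow> complex" where
  "psi_transform \<mu> z =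
     (LINT s:{0..}|\<mu>. z * complex_of_real s / (1 - z * complex_of_real s))"

definition eta_transform :: "real measure \<Rightarrow> complex \<Rightarrow> complex" where
  "eta_transform \<mu> z = psi_transform \<mu> z / (1 + psi_transform \<mu> z)"

text \<open>
  On \<open>(-\<infinity>, 0)\<close> the values of \<open>\<eta>\<close> are real, so that taking the real part only changes
  the type; \<open>\<eta>\<close> is inverted there as a real function. Its range is an interval with right
  endpoint \<open>0\<close>, so \<open>\<Sigma>\<close> is meaningful for negative arguments sufficiently close to \<open>0\<close>.
\<close>

definition Sigma_transform :: "real measure \<Rightarrow> real \<Rightarrow> real" where
  "Sigma_transform \<mu> z =
     the_inv_into {..<0} (\<lambda>x. Re (eta_transform \<mu> (complex_of_real x))) z / z"

text \<open>
  \<open>\<nu>\<close> is the free multiplicative convolution power \<open>\<mu>\<^sup>\<boxtimes>\<^sup>t\<close>. This is a predicate because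
  the power is determined by its \<open>\<Sigma>\<close>-transform: for \<open>\<mu> \<noteq> \<delta>\<^sub>0\<close> and \<open>t \<ge> 1\<close> there is
  exactly one such \<open>\<nu>\<close>.
\<close>

definition is_free_mult_power :: "real measure \<Rightarrow> real \<Rightarrow> real measure \<Rightarrow> bool" where
  "is_free_mult_power \<mu> t \<nu> \<longleftrightarrow>
     prob_on_nonneg \<nu> \<and> \<nu> \<noteq> return borel 0 \<and>
     (\<forall>\<^sub>F z in at_left 0. Sigma_transform \<nu> z = Sigma_transform \<mu> z powr t)"

text \<open>
  The value at a point \<open>x > 0\<close> of the continuous extension of \<open>\<eta>\<close> from the upper
  half-plane (not the value of \<^const>\<open>eta_transform\<close> at \<open>x\<close> itself).
\<close>

definition eta_boundary :: "real measure \<Rightarrow> real \<Rightarrow> complex" where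
  "eta_boundary \<nu> x = Lim (at (complex_of_real x) within {z. Im z > 0}) (eta_transform \<nu>)"

definition atoms :: "real measure \<Rightarrow> real set" where
  "atoms \<nu> = {a. measure \<nu> {a} > 0}"

definition nonatomic_part :: "real measure \<Rightarrow> real measure" where
  "nonatomic_part \<nu> = density \<nu> (indicator (- atoms \<nu>))"

definition real_analytic_at :: "(real \<Rightarrow> real) \<Rightarrow> real \<Rightarrow> bool" where
  "real_analytic_at f y \<longleftrightarrow>
     (\<exists>c r. r > 0 \<and> (\<forall>x. \<bar>x - y\<bar> < r \<longrightarrow> (\<lambda>n. c n * (x - y) ^ n) sums f x))"

end

theory Submission
  imports Defs "HOL-Complex_Analysis.Complex_Analysis"
begin

text \<open>
  Put \<open>\<omega>(z) = z\<^sup>1\<^sup>/\<^sup>t \<eta>\<^sub>\<nu>(z)\<^sup>1\<^sup>-\<^sup>1\<^sup>/\<^sup>t\<close>. By the identity theorem \<open>\<eta>\<^sub>\<nu> = \<eta>\<^sub>\<mu> \<circ> \<omega>\<close>, so \<open>\<omega>(z)\<close> is a fixed point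
  of the self-map \<open>T\<^sub>z(w) = z\<^sup>1\<^sup>/\<^sup>t \<eta>\<^sub>\<mu>(w)\<^sup>1\<^sup>-\<^sup>1\<^sup>/\<^sup>t\<close> of the upper half-plane. Let \<open>z\<close> tend to \<open>x > 0\<close> in the
  Schwarz-Pick inequality for \<open>T\<^sub>z\<close> at \<open>\<omega>(z)\<close>: every cluster value \<open>q\<close> of \<open>\<omega>\<close> at \<open>x\<close> satisfies
  \<open>|T\<^sub>x(w) - q|\<^sup>2 / Im T\<^sub>x(w) \<le> |w - q|\<^sup>2 / Im w\<close> for all \<open>w\<close>, i.e. \<open>q\<close> is the Denjoy-Wolff point of \<open>T\<^sub>x\<close>.
  Such a point is unique, because the image of \<open>T\<^sub>x\<close> lies in a proper sector; the growth of \<open>\<eta>\<^sub>\<mu>\<close> along the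
  imaginary axis excludes \<open>q = 0\<close> and \<open>q = \<infinity>\<close>. Hence \<open>\<omega>\<close> and \<open>\<eta>\<^sub>\<nu>\<close> extend continuously to \<open>x\<close>.

  The value \<open>\<eta>\<^sub>\<nu>(x) = 1\<close> means \<open>\<omega>(x) = p := x\<^sup>1\<^sup>/\<^sup>t\<close>. The angular derivative of \<open>T\<^sub>x\<close> at \<open>p\<close> is
  \<open>(1 - 1/t) / \<mu>({1/p})\<close>, and \<open>p\<close> is the Denjoy-Wolff point exactly if this is at most \<open>1\<close>. The mass of \<open>\<nu>\<close> at
  \<open>1/x\<close> is read off along the curve that \<open>\<omega>\<close> maps to the vertical line through \<open>p\<close>. Away from the points with
  \<open>\<eta>\<^sub>\<nu>(x) = 1\<close> the Stieltjes inversion formula yields a continuous density; where it does not vanish, \<open>\<omega>(x)\<close>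
  is an interior fixed point of \<open>T\<^sub>x\<close>, so \<open>T\<^sub>x'(\<omega>(x)) \<noteq> 1\<close> and \<open>\<omega>\<close> continues analytically past \<open>x\<close>.
\<close>

section \<open>The Schwarz-Pick inequality and Denjoy-Wolff points\<close>

text \<open>Comparing the distances to \<open>u\<close> and to its mirror image serves twice: it
  puts Cayley transforms into the unit disc, and it turns the pseudo-hyperbolic distance into an
  expression in \<open>cmod (v - u)\<close> and the imaginary parts.\<close>

lemma upper_half_plane_pick_identity:
  "(cmod (v - cnj u))\<^sup>2 = (cmod (v - u))\<^sup>2 + 4 * Im u * Im v"
  unfolding cmod_power2 by (simp add: power2_eq_square algebra_simps)

text \<open>Conjugation by Cayley transforms that send the base point \<open>p\<close> and its image to \<open>0\<close>.\<close>

lemma half_plane_to_disc: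
  assumes hol: "f holomorphic_on {z. Im z > 0}"
    and pos: "\<And>z. Im z > 0 \<Longrightarrow> Im (f z) > 0" and p: "Im p > 0"
  obtains g where "g holomorphic_on ball 0 1" "g 0 = 0" "\<forall>z. norm z < 1 \<longrightarrow> norm (g z) < 1"
    "\<forall>w. Im w > 0 \<longrightarrow> norm ((w - p) / (w - cnj p)) < 1 \<and>
       g ((w - p) / (w - cnj p)) = (f w - f p) / (f w - cnj (f p))"
    "f p = p \<longrightarrow> deriv g 0 = deriv f p"
proof -
  \<comment> \<open>This is the inverse of the Cayley transform with base point
    \<open>p\<close>.\<close>
  define \<phi> where "\<phi> = (\<lambda>\<zeta>::complex. (p - cnj p * \<zeta>) / (1 - \<zeta>))"
  define g where "g = (\<lambda>\<zeta>. (f (\<phi> \<zeta>) - f p) / (f (\<phi> \<zeta>) - cnj (f p)))"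
  have disc: "norm ((v - u) / (v - cnj u)) < 1" if "Im u > 0" "Im v > 0" for u v :: complex
  proof -
    have "(cmod (v - u))\<^sup>2 < (cmod (v - cnj u))\<^sup>2"
      using that by (simp add: upper_half_plane_pick_identity)
    then have "cmod (v - u) < cmod (v - cnj u)"
      by (rule power_less_imp_less_base) simp
    then show ?thesis by (simp add: norm_divide divide_simps)
  qed
  have phi_im: "Im (\<phi> \<zeta>) > 0" if "norm \<zeta> < 1" for \<zeta>
  proof -
    have ne: "\<zeta> \<noteq> 1" using that by auto
    have "Im (\<phi> \<zeta>) = Im ((p - cnj p * \<zeta>) * cnj (1 - \<zeta>)) / (cmod (1 - \<zeta>))\<^sup>2"
      unfolding \<phi>_def by (subst complex_div_cnj) (simp flip: of_real_power)
    also have "Im ((p - cnj p * \<zeta>) * cnj (1 - \<zeta>)) = Im p * (1 - (cmod \<zeta>)\<^sup>2)"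
      unfolding cmod_power2 by (simp add: power2_eq_square algebra_simps)
    finally show ?thesis
      using that p ne by (simp add: power_less_one_iff abs_square_less_1)
  qed
  have ne1: "v - cnj u \<noteq> 0" if "Im u > 0" "Im v > 0" for u v :: complex
    using that by (auto simp: complex_eq_iff)
  have phi0: "\<phi> 0 = p" by (simp add: \<phi>_def)
  have holphi: "\<phi> holomorphic_on ball 0 1"
    unfolding \<phi>_def by (intro holomorphic_intros) auto
  have holf: "(\<lambda>\<zeta>. f (\<phi> \<zeta>)) holomorphic_on ball 0 1"
    using holomorphic_on_compose_gen[OF holphi hol] phi_im by (auto simp: o_def image_subset_iff)
  have holg: "g holomorphic_on ball 0 1"
    unfolding g_def using ne1 pos phi_im p by (intro holomorphic_intros holf) auto
  have g1: "norm (g z) < 1" if "norm z < 1" for z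
    unfolding g_def using disc pos phi_im p that by auto
  have g0: "g 0 = 0" by (simp add: g_def phi0)
  have gw: "norm ((w - p) / (w - cnj p)) < 1 \<and>
       g ((w - p) / (w - cnj p)) = (f w - f p) / (f w - cnj (f p))" if w: "Im w > 0" for w
  proof -
    let ?\<zeta> = "(w - p) / (w - cnj p)"
    have nz: "w - cnj p \<noteq> 0" using ne1 p w by blast
    have "1 - ?\<zeta> = (p - cnj p) / (w - cnj p)" using nz by (simp add: field_simps)
    moreover have "p - cnj p * ?\<zeta> = (p - cnj p) * w / (w - cnj p)"
      using nz by (simp add: field_simps)
    moreover have "p - cnj p \<noteq> 0" using p by (auto simp: complex_eq_iff)
    ultimately have "\<phi> ?\<zeta> = w" unfolding \<phi>_def using nz by simp
    then show ?thesis using disc[OF p w] by (simp add: g_def)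
  qed
  \<comment> \<open>When \<open>p\<close> is fixed, the Cayley transforms on both sides agree, so
    \<open>g\<close> is conjugate to \<open>f\<close> and has the same multiplier at the fixed
    point.\<close>
  have "deriv g 0 = deriv f p" if fp: "f p = p"
  proof -
    have nz: "p - cnj p \<noteq> 0" using p by (auto simp: complex_eq_iff)
    have d1: "(\<phi> has_field_derivative (p - cnj p)) (at 0)"
      unfolding \<phi>_def by (auto intro!: derivative_eq_intros)
    have "open {z. Im z > 0}" by (simp add: open_halfspace_Im_gt)
    then have d2: "(f has_field_derivative deriv f p) (at (\<phi> 0))"
      using hol p by (auto simp: phi0 intro: holomorphic_derivI)
    have d3: "((\<lambda>\<zeta>. f (\<phi> \<zeta>)) has_field_derivative deriv f p * (p - cnj p)) (at 0)"
      using DERIV_chain2[OF d2 d1] .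
    have "(g has_field_derivative
        ((deriv f p * (p - cnj p) - 0) * (f (\<phi> 0) - cnj (f p)) - (f (\<phi> 0) - f p) * (deriv f p * (p - cnj p) - 0))
        / ((f (\<phi> 0) - cnj (f p)) * (f (\<phi> 0) - cnj (f p)))) (at 0)"
      unfolding g_def using nz by (intro DERIV_divide DERIV_diff d3 DERIV_const) (simp add: phi0 fp)
    then have "(g has_field_derivative deriv f p) (at 0)"
      using nz by (simp add: phi0 fp)
    then show ?thesis by (rule DERIV_imp_deriv)
  qed
  with holg g0 g1 gw show thesis using that by blast
qed

text \<open>Schwarz's lemma for the conjugated map. Clearing the denominators leaves an inequality
  of products that stays meaningful when one of the points tends to the real axis.\<close>

lemma Schwarz_Pick_upper_half_plane:
  assumes "f holomorphic_on {z. Im z > 0}" "\<And>z. Im z > 0 \<Longrightarrow> Im (f z) > 0"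
    and "Im p > 0" "Im w > 0"
  shows "(cmod (f w - f p))\<^sup>2 * Im w * Im p \<le> (cmod (w - p))\<^sup>2 * Im (f w) * Im (f p)"
proof -
  obtain g where g: "g holomorphic_on ball 0 1" "g 0 = 0" "\<forall>z. norm z < 1 \<longrightarrow> norm (g z) < 1"
    "\<forall>w. Im w > 0 \<longrightarrow> norm ((w - p) / (w - cnj p)) < 1 \<and>
       g ((w - p) / (w - cnj p)) = (f w - f p) / (f w - cnj (f p))"
    "f p = p \<longrightarrow> deriv g 0 = deriv f p"
    using half_plane_to_disc[OF assms(1-3)] by metis
  have "norm (g ((w - p) / (w - cnj p))) \<le> norm ((w - p) / (w - cnj p))"
    using Schwarz_Lemma(1)[OF g(1,2) g(3)[rule_format]] g(4)[rule_format, OF assms(4)] by blast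
  then have "cmod (f w - f p) / cmod (f w - cnj (f p)) \<le> cmod (w - p) / cmod (w - cnj p)"
    using g(4)[rule_format, OF assms(4)] by (simp add: norm_divide)
  then have "(cmod (f w - f p))\<^sup>2 / (cmod (f w - cnj (f p)))\<^sup>2 \<le> (cmod (w - p))\<^sup>2 / (cmod (w - cnj p))\<^sup>2"
    by (metis power_divide power_mono divide_nonneg_nonneg norm_ge_zero)
  then have main: "(cmod (f w - f p))\<^sup>2 / ((cmod (f w - f p))\<^sup>2 + 4 * Im (f p) * Im (f w))
      \<le> (cmod (w - p))\<^sup>2 / ((cmod (w - p))\<^sup>2 + 4 * Im p * Im w)"
    by (simp only: upper_half_plane_pick_identity)
  have aux: "x * v \<le> y * u" if "x / u \<le> y / v" "u > 0" "v > 0" for x y u v :: real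
    using mult_right_mono[OF that(1), of "u * v"] that by (simp add: field_simps)
  \<comment> \<open>After cross-multiplication the term \<open>a * b\<close> cancels.\<close>
  have "a / (a + 4 * d * c) \<le> b / (b + 4 * e * g) \<Longrightarrow> a * g * e \<le> b * c * d"
    if "a \<ge> 0" "b \<ge> 0" "c > 0" "d > 0" "e > 0" "g > 0" for a b c d e g :: real
  proof -
    assume le: "a / (a + 4 * d * c) \<le> b / (b + 4 * e * g)"
    have "a + 4 * d * c > 0" "b + 4 * e * g > 0" using that by (auto intro: add_nonneg_pos)
    then have "a * (b + 4 * e * g) \<le> b * (a + 4 * d * c)"
      using aux[OF le] by blast
    then show ?thesis by (simp add: algebra_simps)
  qed
  from this[OF _ _ _ _ _ _ main] show ?thesis using assms by simp
qed

text \<open>Equality in Schwarz's lemma: multiplier \<open>1\<close> at \<open>p\<close> or a second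
  fixed point makes the conjugate \<open>g\<close> a rotation, and either condition forces the
  rotation factor to be \<open>1\<close>.\<close>

lemma half_plane_map_eq_id:
  assumes hol: "f holomorphic_on {z. Im z > 0}"
    and pos: "\<And>z. Im z > 0 \<Longrightarrow> Im (f z) > 0"
    and p: "Im p > 0" "f p = p"
    and "deriv f p = 1 \<or> (\<exists>q. Im q > 0 \<and> q \<noteq> p \<and> f q = q)"
    and w: "Im w > 0"
  shows "f w = w"
proof -
  obtain g where g: "g holomorphic_on ball 0 1" "g 0 = 0" "\<forall>z. norm z < 1 \<longrightarrow> norm (g z) < 1"
    "\<forall>w. Im w > 0 \<longrightarrow> norm ((w - p) / (w - cnj p)) < 1 \<and>
       g ((w - p) / (w - cnj p)) = (f w - f p) / (f w - cnj (f p))"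
    "f p = p \<longrightarrow> deriv g 0 = deriv f p"
    using half_plane_to_disc[OF hol pos p(1)] by metis
  have nz: "v - cnj p \<noteq> 0" if "Im v > 0" for v
    using that p by (auto simp: complex_eq_iff)
  \<comment> \<open>The value \<open>z = 0\<close> encodes the case of the derivative; any other
    \<open>z\<close> is the image of a second fixed point.\<close>
  have "\<exists>z. norm z < 1 \<and> (z = 0 \<or> g z = z) \<and> (z = 0 \<longrightarrow> deriv g 0 = 1)"
  proof (cases "deriv f p = 1")
    case True
    then show ?thesis using g(5) p by (intro exI[of _ 0]) auto
  next
    case False
    then obtain q where q: "Im q > 0" "q \<noteq> p" "f q = q" using assms(5) by blast
    then show ?thesis using g(4)[rule_format, OF q(1)] nz[OF q(1)] p
      by (intro exI[of _ "(q - p) / (q - cnj p)"]) auto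
  qed
  then obtain z where z: "norm z < 1" "z = 0 \<or> g z = z" "z = 0 \<longrightarrow> deriv g 0 = 1" by blast
  then have "(\<exists>z. norm z < 1 \<and> z \<noteq> 0 \<and> norm (g z) = norm z) \<or> norm (deriv g 0) = 1"
    by (metis norm_one)
  then obtain \<alpha> where \<alpha>: "\<And>z. norm z < 1 \<Longrightarrow> g z = \<alpha> * z"
    using Schwarz_Lemma(3)[OF g(1,2) g(3)[rule_format], of 0] by auto
  have "\<alpha> = 1"
  proof (cases "z = 0")
    case True
    have "(g has_field_derivative \<alpha>) (at 0)"
    proof (rule has_field_derivative_transform_within[where d = 1])
      show "((\<lambda>z. \<alpha> * z) has_field_derivative \<alpha>) (at 0)" by (auto intro!: derivative_eq_intros)
    qed (use \<alpha> in auto)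
    then show ?thesis using z(3) True DERIV_imp_deriv by force
  next
    case False
    then show ?thesis using z \<alpha>[of z] by auto
  qed
  then have "(f w - p) / (f w - cnj p) = (w - p) / (w - cnj p)"
    using g(4)[rule_format, OF w] \<alpha> p by auto
  then have "(f w - p) * (w - cnj p) = (w - p) * (f w - cnj p)"
    using nz[OF w] nz[OF pos[OF w]] by (simp add: frac_eq_eq)
  then have "(f w - w) * (p - cnj p) = 0" by (simp add: algebra_simps)
  moreover have "p - cnj p \<noteq> 0" using p by (auto simp: complex_eq_iff)
  ultimately show ?thesis by simp
qed


text \<open>
  For real \<open>q\<close> the condition on \<open>q\<close> says that \<open>f\<close> maps every horoball at \<open>q\<close> into itself; for
  \<open>q\<close> in the half-plane it says that \<open>f q = q\<close>, by the Schwarz-Pick inequality. So this is the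
  uniqueness of the Denjoy-Wolff point.
\<close>

lemma Denjoy_Wolff_unique:
  assumes hol: "f holomorphic_on {z. Im z > 0}"
    and pos: "\<And>z. Im z > 0 \<Longrightarrow> Im (f z) > 0"
    and nid: "\<exists>z. Im z > 0 \<and> f z \<noteq> z"
    and a: "Im a \<ge> 0" "\<And>w. Im w > 0 \<Longrightarrow> (cmod (f w - a))\<^sup>2 * Im w \<le> (cmod (w - a))\<^sup>2 * Im (f w)"
    and b: "Im b \<ge> 0" "\<And>w. Im w > 0 \<Longrightarrow> (cmod (f w - b))\<^sup>2 * Im w \<le> (cmod (w - b))\<^sup>2 * Im (f w)"
  shows "a = b"
proof (rule ccontr)
  assume "a \<noteq> b"
  \<comment> \<open>At \<open>w = u\<close> the right-hand side vanishes.\<close>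
  have fix1: "f u = u" if "Im u > 0" "\<And>w. Im w > 0 \<Longrightarrow> (cmod (f w - u))\<^sup>2 * Im w \<le> (cmod (w - u))\<^sup>2 * Im (f w)" for u
    using that(2)[OF that(1)] that(1) by (simp add: mult_le_0_iff)
  have no_int_int: False if "Im u > 0" "Im v > 0" "u \<noteq> v" "f u = u" "f v = v" for u v
    using half_plane_map_eq_id[OF hol pos that(1,4)] that nid by metis
  have op: "open {z. Im z > 0}" and conn: "connected {z. Im z > 0}"
    by (auto simp: open_halfspace_Im_gt convex_halfspace_Im_gt intro: convex_connected)
  have no_int_real: False
    if u: "Im u > 0" "f u = u" and v: "Im v = 0"
      and ineq: "\<And>w. Im w > 0 \<Longrightarrow> (cmod (f w - v))\<^sup>2 * Im w \<le> (cmod (w - v))\<^sup>2 * Im (f w)" for u v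
  proof -
    \<comment> \<open>The map \<open>- 1 / (w - v)\<close> sends \<open>v\<close> to infinity and
      horoballs at \<open>v\<close> to half-planes, so the hypothesis says that \<open>f\<close>
      does not decrease the imaginary part in this coordinate. If \<open>g\<close> were not
      constant, its open image would contain points below \<open>0 = g u\<close>.\<close>
    define g where "g = (\<lambda>w. 1 / (w - v) - 1 / (f w - v))"
    have ne: "w - v \<noteq> 0" if "Im w > 0" for w using that v by auto
    have ImI: "Im (1 / (w - v)) = - (Im w / (cmod (w - v))\<^sup>2)" for w
      using v by (simp add: Im_divide cmod_power2)
    have g0: "Im (g w) \<ge> 0" if w: "Im w > 0" for w
    proof -
      have "cmod (w - v) > 0" "cmod (f w - v) > 0"
        using ne[OF w] ne[OF pos[OF w]] by simp_all
      then have "Im w / (cmod (w - v))\<^sup>2 \<le> Im (f w) / (cmod (f w - v))\<^sup>2"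
        using ineq[OF w] by (simp add: divide_simps mult_ac)
      then show ?thesis unfolding g_def minus_complex.sel ImI by simp
    qed
    have holg: "g holomorphic_on {z. Im z > 0}"
      unfolding g_def using ne pos by (intro holomorphic_intros hol) auto
    have gu: "g u = 0" by (simp add: g_def u)
    have "g constant_on {z. Im z > 0}"
    proof (rule ccontr)
      assume "\<not> g constant_on {z. Im z > 0}"
      then have "open (g ` {z. Im z > 0})"
        using open_mapping_thm[OF holg op conn op] by auto
      moreover have "0 \<in> g ` {z. Im z > 0}" using u gu by force
      ultimately obtain e where e: "e > 0" "ball 0 e \<subseteq> g ` {z. Im z > 0}"
        by (auto simp: open_contains_ball)
      have "- \<i> * of_real (e/2) \<in> ball 0 e" using e by (simp add: norm_mult)
      then obtain z where "Im z > 0" "- \<i> * of_real (e/2) = g z" using e(2) by blast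
      then show False using g0[of z] e(1) by (metis (no_types, lifting) Im_complex_of_real Im_i_times Re_complex_of_real half_gt_zero_iff leD mult_minus_left neg_0_le_iff_le uminus_complex.sel(2))
    qed
    then have g_0: "g w = 0" if "Im w > 0" for w
      using that u gu unfolding constant_on_def by (metis mem_Collect_eq)
    have "f w = w" if w: "Im w > 0" for w
      using g_0[OF w] ne[OF w] ne[OF pos[OF w]] by (simp add: g_def)
    then show False using nid by blast
  qed
  consider "Im a > 0" | "Im b > 0" | "Im a = 0" "Im b = 0" using a b by fastforce
  then show False
  proof cases
    case 1
    then show ?thesis
      using fix1[OF 1 a(2)] fix1[OF _ b(2)] no_int_int no_int_real[OF 1 _ _ b(2)] b(1) \<open>a \<noteq> b\<close>
      by (metis less_eq_real_def)
  next
    case 2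
    then show ?thesis
      using fix1[OF 2 b(2)] fix1[OF _ a(2)] no_int_int no_int_real[OF 2 _ _ a(2)] a(1) \<open>a \<noteq> b\<close>
      by (metis less_eq_real_def)
  next
    case 3
    define r where "r = Re b - Re a"
    have r: "r \<noteq> 0" using 3 \<open>a \<noteq> b\<close> by (auto simp: r_def complex_eq_iff)
    text \<open>The horoballs at \<open>a\<close> and at \<open>b\<close> through \<open>w\<close> touch only in \<open>w\<close>.\<close>
    define w where "w = Complex (Re a + r / 2) (\<bar>r\<bar> / 2)"
    have w: "Im w > 0" using r by (simp add: w_def)
    have wab: "(cmod (w - a))\<^sup>2 = r\<^sup>2 / 2" "(cmod (w - b))\<^sup>2 = r\<^sup>2 / 2"
      unfolding cmod_power2 using 3 by (auto simp: w_def r_def power2_eq_square field_simps)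
    have Imw: "Im w = \<bar>r\<bar> / 2" by (simp add: w_def)
    have "(cmod (f w - a))\<^sup>2 * \<bar>r\<bar> \<le> r\<^sup>2 * Im (f w)" "(cmod (f w - b))\<^sup>2 * \<bar>r\<bar> \<le> r\<^sup>2 * Im (f w)"
      using a(2)[OF w] b(2)[OF w] unfolding wab Imw by simp_all
    moreover have "r\<^sup>2 * Im (f w) = (\<bar>r\<bar> * Im (f w)) * \<bar>r\<bar>"
      by (simp add: power2_eq_square)
    ultimately have le: "(cmod (f w - a))\<^sup>2 \<le> \<bar>r\<bar> * Im (f w)" "(cmod (f w - b))\<^sup>2 \<le> \<bar>r\<bar> * Im (f w)"
      using r by (simp_all only: mult_le_cancel_right)
    have "(Re (f w) - (Re a + r / 2))\<^sup>2 + (Im (f w) - \<bar>r\<bar> / 2)\<^sup>2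
        = ((cmod (f w - a))\<^sup>2 + (cmod (f w - b))\<^sup>2) / 2 - \<bar>r\<bar> * Im (f w)"
      unfolding cmod_power2 using 3 by (simp add: r_def power2_eq_square field_simps)
    also have "\<dots> \<le> 0" using add_mono[OF le] by simp
    finally have "f w = w" by (simp add: sum_power2_le_zero_iff w_def complex_eq_iff)
    then show ?thesis using no_int_real[OF w _ 3(1) a(2)] by blast
  qed
qed

section \<open>The transforms on the slit plane\<close>

definition slit_plane :: "complex set" where
  "slit_plane = - \<real>\<^sub>\<ge>\<^sub>0"

lemma slit_plane_iff: "z \<in> slit_plane \<longleftrightarrow> Im z \<noteq> 0 \<or> Re z < 0"
  by (auto simp: slit_plane_def complex_nonneg_Reals_iff)

lemma open_slit_plane: "open slit_plane"
  by (simp add: slit_plane_def open_Compl)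

lemma connected_slit_plane: "connected slit_plane"
proof -
  have "\<real>\<^sub>\<ge>\<^sub>0 = complex_of_real ` {0..}"
    by (auto simp: nonneg_Reals_def)
  then show ?thesis
    using starlike_slotted_complex_plane_right[of 0] starlike_imp_connected unfolding slit_plane_def by metis
qed

text \<open>Having \<open>1 + s\<close> on the left bounds both \<open>1 / (1 - z * s)\<close> and
  \<open>s / (1 - z * s)\<close>, uniformly in \<open>s\<close> and locally uniformly in
  \<open>z\<close>. For small \<open>s\<close> the product \<open>z * s\<close> is at most
  \<open>1 / 2\<close> in modulus; for large \<open>s\<close> one uses that \<open>z\<close> keeps
  its distance from the real point \<open>1 / s\<close>.\<close>

lemma slit_kernel_bound:
  assumes "z0 \<in> slit_plane"
  obtains r C where "r > 0" "C > 0" "ball z0 r \<subseteq> slit_plane"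
    "\<forall>z\<in>ball z0 r. \<forall>s\<ge>0. 1 + s \<le> C * cmod (1 - z * of_real s)"
proof -
  obtain e where e: "e > 0" "ball z0 e \<subseteq> slit_plane"
    using assms open_slit_plane open_contains_ball_eq by blast
  define r where "r = e / 2"
  define R where "R = cmod z0 + r"
  \<comment> \<open>The part \<open>2 + 1 / R\<close> serves the case
    \<open>s \<le> 1 / (2 * R)\<close>, the last summand the other one.\<close>
  define C where "C = 2 + 1 / R + (1 + 2 * R) / r"
  have r: "r > 0" and R: "R > 0" using e by (auto simp: r_def R_def add_nonneg_pos)
  have C: "C > 0" unfolding C_def using r R by (intro add_pos_pos) auto
  have "1 + s \<le> C * cmod (1 - z * of_real s)" if z: "z \<in> ball z0 r" and s: "s \<ge> 0" for z s
  proof (cases "s \<le> 1 / (2 * R)")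
    case True
    have "cmod z \<le> R" using z norm_triangle_ineq2[of z z0] by (auto simp: R_def dist_norm norm_minus_commute)
    then have "cmod (z * of_real s) \<le> R * s" using s by (simp add: norm_mult mult_right_mono)
    also have "\<dots> \<le> 1 / 2" using True R by (simp add: field_simps)
    finally have "1 / 2 \<le> cmod (1 - z * of_real s)"
      using norm_triangle_ineq2[of 1 "z * of_real s"] by simp
    then have "(2 + 1 / R) * (1 / 2) \<le> C * cmod (1 - z * of_real s)"
      using r R by (intro mult_mono) (auto simp: C_def)
    moreover have "1 + s \<le> (2 + 1 / R) * (1 / 2)" using True by (simp add: field_simps)
    ultimately show ?thesis by linarith
  next
    case False
    then have s0: "s > 0" using R by (smt (verit) divide_pos_pos)
    have "r \<le> dist z (of_real (1 / s))"
    proof (rule ccontr)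
      assume "\<not> r \<le> dist z (of_real (1 / s))"
      then have "of_real (1 / s) \<in> ball z0 e"
        using z dist_triangle[of z0 "of_real (1 / s)" z] by (auto simp: r_def)
      then show False using e s0 by (auto simp: slit_plane_iff)
    qed
    moreover have "1 - z * of_real s = of_real s * (of_real (1 / s) - z)"
      using s0 by (simp add: algebra_simps)
    ultimately have *: "s * r \<le> cmod (1 - z * of_real s)"
      using s0 by (simp add: norm_mult dist_norm norm_minus_commute)
    have "1 + s \<le> (1 + 2 * R) * s" using False R by (simp add: field_simps)
    also have "\<dots> = (1 + 2 * R) / r * (s * r)" using r by simp
    also have "\<dots> \<le> C * cmod (1 - z * of_real s)"
      using * r R s0 by (intro mult_mono) (auto simp: C_def)
    finally show ?thesis .
  qed
  moreover have "ball z0 r \<subseteq> slit_plane" using e by (fastforce simp: r_def)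
  ultimately show thesis using that r C by blast
qed

lemma one_minus_mult_nonzero:
  assumes "z \<in> slit_plane" "s \<ge> 0"
  shows "1 - z * of_real s \<noteq> 0"
proof -
  obtain r C :: real where "r > 0" "C > 0" "ball z r \<subseteq> slit_plane"
    "\<forall>z\<in>ball z r. \<forall>s\<ge>0. 1 + s \<le> C * cmod (1 - z * of_real s)"
    by (rule slit_kernel_bound[OF assms(1)])
  then have "1 + s \<le> C * cmod (1 - z * of_real s)" using assms(2) by auto
  then show ?thesis using assms(2) by auto
qed

text \<open>For a law on the half-line and \<open>z\<close> in the slit plane this is
  \<open>1 + psi_transform M z\<close>, so that eta is \<open>1 - 1 / resolvent_mean M z\<close>;
  times \<open>z\<close> it is the Cauchy transform at \<open>1 / z\<close>.\<close>

definition resolvent_mean :: "real measure \<Rightarrow> complex \<Rightarrow> complex" where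
  "resolvent_mean M z = (\<integral>s. 1 / (1 - z * of_real s) \<partial>M)"

locale nonneg_law = real_distribution M for M +
  assumes full: "measure M {0..} = 1" and not_delta: "M \<noteq> return borel 0"
begin

lemma prob_UNIV: "prob UNIV = 1"
  using prob_space by simp

lemma AE_nonneg: "AE s in M. s \<ge> 0"
  using AE_prob_1[OF full] by simp

lemma not_AE_0: "\<not> (AE s in M. s = 0)"
proof
  assume *: "AE s in M. s = 0"
  have "M = return borel 0"
  proof (rule measure_eqI)
    fix A assume A: "A \<in> sets M"
    show "emeasure M A = emeasure (return borel 0) A"
    proof (cases "0 \<in> A")
      case True
      then have "AE s in M. s \<in> A" using * by auto
      then have "emeasure M A = 1" using emeasure_eq_1_AE A by simp
      then show ?thesis using True A by (simp add: emeasure_return)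
    next
      case False
      then have "AE s in M. s \<notin> A" using * by auto
      then have "emeasure M A = 0" using AE_iff_measurable[of A M "\<lambda>s. s \<notin> A"] A by auto
      then show ?thesis using False A by (simp add: emeasure_return)
    qed
  qed simp
  then show False using not_delta by simp
qed

text \<open>This is where \<open>M\<close> not being the point mass at \<open>0\<close> enters: a
  nonnegative function with vanishing integral is almost everywhere zero, which would confine
  \<open>M\<close> to \<open>0\<close>. The strict inequalities for the transforms rest on
  it.\<close>

lemma integral_pos:
  fixes g :: "real \<Rightarrow> real"
  assumes "integrable M g" "\<And>s. s \<ge> 0 \<Longrightarrow> g s \<ge> 0" "\<And>s. s > 0 \<Longrightarrow> g s > 0"
  shows "(\<integral>s. g s \<partial>M) > 0"
proof -
  have nn: "AE s in M. g s \<ge> 0" using AE_nonneg assms(2) by auto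
  have "(\<integral>s. g s \<partial>M) \<noteq> 0"
  proof
    assume "(\<integral>s. g s \<partial>M) = 0"
    then have "AE s in M. g s = 0" using integral_nonneg_eq_0_iff_AE[OF assms(1) nn] by simp
    with AE_nonneg have "AE s in M. s = 0" 
    proof eventually_elim
      case (elim s)
      then show ?case using assms(3)[of s] by force
    qed
    then show False using not_AE_0 by simp
  qed
  then show ?thesis using integral_nonneg_AE[OF nn] by simp
qed

lemma integrable_bounded:
  fixes f :: "real \<Rightarrow> 'b::{banach, second_countable_topology}"
  assumes "f \<in> borel_measurable borel" "\<And>s. s \<ge> 0 \<Longrightarrow> norm (f s) \<le> C"
  shows "integrable M f"
proof (rule integrable_const_bound)
  show "AE s in M. norm (f s) \<le> C" using AE_nonneg assms(2) by auto
qed (use assms(1) in simp)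

lemma norm_integral_le:
  fixes f :: "real \<Rightarrow> 'b::{banach, second_countable_topology}"
  assumes "f \<in> borel_measurable borel" "\<And>s. s \<ge> 0 \<Longrightarrow> norm (f s) \<le> C"
  shows "norm (\<integral>s. f s \<partial>M) \<le> C"
proof -
  have "norm (\<integral>s. f s \<partial>M) \<le> (\<integral>s. norm (f s) \<partial>M)" by simp
  also have "\<dots> \<le> C"
  proof (rule integral_le_const)
    show "AE s in M. norm (f s) \<le> C" using AE_nonneg assms(2) by auto
  qed (use integrable_bounded[OF assms] in simp)
  finally show ?thesis .
qed

lemma kernel_le:
  assumes "1 + s \<le> C * cmod (1 - z * of_real s)" "s \<ge> 0"
  shows "cmod (1 / (1 - z * of_real s)) \<le> C" "cmod (of_real s / (1 - z * of_real s)) \<le> C"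
proof -
  have "cmod (1 - z * of_real s) > 0" using assms by (cases "1 - z * of_real s = 0") auto
  moreover from this have "1 \<le> C * cmod (1 - z * of_real s)" "s \<le> C * cmod (1 - z * of_real s)"
    using assms by linarith+
  ultimately show "cmod (1 / (1 - z * of_real s)) \<le> C" "cmod (of_real s / (1 - z * of_real s)) \<le> C"
    using assms(2) by (auto simp: norm_divide divide_simps mult_ac)
qed

lemma kernel_integrable:
  assumes "z \<in> slit_plane"
  shows "integrable M (\<lambda>s. 1 / (1 - z * of_real s))"
proof -
  obtain r C :: real where r: "r > 0" "C > 0" "ball z r \<subseteq> slit_plane"
    and C: "\<forall>z\<in>ball z r. \<forall>s\<ge>0. 1 + s \<le> C * cmod (1 - z * of_real s)"
    by (rule slit_kernel_bound[OF assms])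
  show ?thesis
    by (rule integrable_bounded[of _ C], measurable) (use r C kernel_le(1) in auto)
qed

text \<open>The difference quotient minus its limit factors into three bounded kernels times
  \<open>z - z0\<close>, so an explicit bound replaces a dominated convergence argument.\<close>

lemma resolvent_mean_has_derivative:
  assumes "z0 \<in> slit_plane"
  shows "(resolvent_mean M has_field_derivative
           (\<integral>s. of_real s / (1 - z0 * of_real s)\<^sup>2 \<partial>M)) (at z0)"
proof -
  obtain r C :: real where r: "r > 0" and C0: "C > 0" and sub: "ball z0 r \<subseteq> slit_plane"
    and C: "\<forall>z\<in>ball z0 r. \<forall>s\<ge>0. 1 + s \<le> C * cmod (1 - z * of_real s)"
    by (rule slit_kernel_bound[OF assms])
  define D where "D = (\<integral>s. of_real s / (1 - z0 * of_real s)\<^sup>2 \<partial>M)"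
  have kl: "cmod (1 / (1 - z * of_real s)) \<le> C" "cmod (of_real s / (1 - z * of_real s)) \<le> C"
    if "z \<in> ball z0 r" "s \<ge> 0" for z s
    using kernel_le[of s C z] C that by blast+
  have z0: "z0 \<in> ball z0 r" using r by simp
  have intD: "integrable M (\<lambda>s. of_real s / (1 - z0 * of_real s)\<^sup>2)"
  proof (rule integrable_bounded[of _ "C * C"], measurable)
    fix s :: real assume s: "s \<ge> 0"
    have "of_real s / (1 - z0 * of_real s)\<^sup>2 = of_real s / (1 - z0 * of_real s) * (1 / (1 - z0 * of_real s))"
      by (simp add: power2_eq_square)
    then show "cmod (of_real s / (1 - z0 * of_real s)\<^sup>2) \<le> C * C"
      using kl[OF z0 s] C0 by (simp only: norm_mult) (intro mult_mono, auto)
  qed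
  have "norm ((resolvent_mean M z - resolvent_mean M z0) / (z - z0) - D) \<le> C * C * C * norm (z - z0)"
    if z: "z \<in> ball z0 r" "z \<noteq> z0" for z
  proof -
    let ?k = "\<lambda>z s. 1 / (1 - z * complex_of_real s)"
    have zs: "z \<in> slit_plane" using z sub by auto
    have "(resolvent_mean M z - resolvent_mean M z0) / (z - z0) - D
        = (\<integral>s. (?k z s - ?k z0 s) / (z - z0) - of_real s / (1 - z0 * of_real s)\<^sup>2 \<partial>M)"
      unfolding resolvent_mean_def D_def
      using kernel_integrable[OF zs] kernel_integrable[OF assms] intD z
      by (subst Bochner_Integration.integral_diff) auto
    also have "norm \<dots> \<le> C * C * C * norm (z - z0)"
    proof (rule norm_integral_le, measurable)
      fix s :: real assume s: "s \<ge> 0"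
      have nz: "1 - z * of_real s \<noteq> 0" "1 - z0 * of_real s \<noteq> 0"
        using one_minus_mult_nonzero s zs assms by auto
      have "?k z s - ?k z0 s = (z - z0) * (of_real s * ?k z s * ?k z0 s)"
        using nz by (simp add: divide_simps) (simp add: algebra_simps)
      then have "(?k z s - ?k z0 s) / (z - z0) = of_real s * ?k z s * ?k z0 s"
        using z by simp
      then have "(?k z s - ?k z0 s) / (z - z0) - of_real s / (1 - z0 * of_real s)\<^sup>2
          = of_real s * ?k z0 s * (?k z s - ?k z0 s)"
        by (simp add: power2_eq_square algebra_simps)
      also have "\<dots> = (of_real s / (1 - z0 * of_real s)) * (of_real s / (1 - z * of_real s)) * ?k z0 s * (z - z0)"
        using \<open>?k z s - ?k z0 s = _\<close> by (simp add: ac_simps)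
      finally show "norm ((?k z s - ?k z0 s) / (z - z0) - of_real s / (1 - z0 * of_real s)\<^sup>2)
          \<le> C * C * C * norm (z - z0)"
        using kl[OF z0 s] kl[OF z(1) s] C0
        by (simp only: norm_mult) (intro mult_mono mult_nonneg_nonneg, auto)
    qed
    finally show ?thesis .
  qed
  then have "\<forall>\<^sub>F z in at z0. norm ((resolvent_mean M z - resolvent_mean M z0) / (z - z0) - D)
      \<le> C * C * C * norm (z - z0)"
    unfolding eventually_at using r by (intro exI[of _ r]) (auto simp: dist_commute)
  moreover have "((\<lambda>z. C * C * C * norm (z - z0)) \<longlongrightarrow> 0) (at z0)"
    by (auto intro!: tendsto_eq_intros)
  ultimately have "((\<lambda>z. (resolvent_mean M z - resolvent_mean M z0) / (z - z0) - D) \<longlongrightarrow> 0) (at z0)"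
    by (rule Lim_null_comparison)
  then show ?thesis
    unfolding has_field_derivative_iff D_def[symmetric] by (rule LIM_zero_cancel)
qed

lemma resolvent_mean_holomorphic: "resolvent_mean M holomorphic_on slit_plane"
  using resolvent_mean_has_derivative
  by (meson field_differentiable_at_within field_differentiable_def holomorphic_on_def)

lemma Im_kernel: "Im (1 / (1 - z * of_real s)) = Im z * (s / (cmod (1 - z * of_real s))\<^sup>2)"
  by (simp add: Im_divide cmod_power2)

lemma weighted_mean_pos:
  assumes "Im z \<noteq> 0"
  shows "Im (resolvent_mean M z) = Im z * (\<integral>s. s / (cmod (1 - z * of_real s))\<^sup>2 \<partial>M)"
    "(\<integral>s. s / (cmod (1 - z * of_real s))\<^sup>2 \<partial>M) > 0"
proof -
  have z: "z \<in> slit_plane" using assms by (simp add: slit_plane_iff)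
  have int: "integrable M (\<lambda>s. Im z * (s / (cmod (1 - z * of_real s))\<^sup>2))"
    using integrable_Im[OF kernel_integrable[OF z]] unfolding Im_kernel .
  show "Im (resolvent_mean M z) = Im z * (\<integral>s. s / (cmod (1 - z * of_real s))\<^sup>2 \<partial>M)"
    unfolding resolvent_mean_def integral_Im[OF kernel_integrable[OF z], symmetric] Im_kernel
    by (rule integral_mult_right_zero)
  have "integrable M (\<lambda>s. s / (cmod (1 - z * of_real s))\<^sup>2)"
    using integrable_mult_right[OF int, of "1 / Im z"] assms by simp
  then show "(\<integral>s. s / (cmod (1 - z * of_real s))\<^sup>2 \<partial>M) > 0"
    by (rule integral_pos) (use one_minus_mult_nonzero[OF z] in auto)
qed

lemma neg_axis_mean:
  assumes "x < 0"
  shows "resolvent_mean M (of_real x) = of_real (\<integral>s. 1 / (1 - x * s) \<partial>M)"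
    "integrable M (\<lambda>s. 1 / (1 - x * s))"
    "(\<integral>s. 1 / (1 - x * s) \<partial>M) > 0" "(\<integral>s. 1 / (1 - x * s) \<partial>M) < 1"
proof -
  have eq: "(1 / (1 - complex_of_real x * of_real s)) = of_real (1 / (1 - x * s))" for s by simp
  show "resolvent_mean M (of_real x) = of_real (\<integral>s. 1 / (1 - x * s) \<partial>M)"
    unfolding resolvent_mean_def eq by (rule integral_complex_of_real)
  have pos: "1 - x * s \<ge> 1" if "s \<ge> 0" for s
    using that assms by (simp add: mult_le_0_iff)
  have pos': "1 - x * s > 1" if "s > 0" for s
    using that assms by (simp add: mult_neg_pos)
  show int: "integrable M (\<lambda>s. 1 / (1 - x * s))"
    by (rule integrable_bounded[of _ 1], measurable) (use pos in fastforce)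
  show "(\<integral>s. 1 / (1 - x * s) \<partial>M) > 0"
    by (rule integral_pos[OF int]) (use pos pos' in \<open>fastforce+\<close>)
  have "(\<integral>s. 1 - 1 / (1 - x * s) \<partial>M) > 0"
    by (rule integral_pos) (use int pos pos' in \<open>force+\<close>)
  then show "(\<integral>s. 1 / (1 - x * s) \<partial>M) < 1"
    using int by (simp add: prob_UNIV)
qed

lemma resolvent_mean_nonzero:
  assumes "z \<in> slit_plane"
  shows "resolvent_mean M z \<noteq> 0"
proof (cases "Im z = 0")
  case False
  then show ?thesis using weighted_mean_pos[OF False] by auto
next
  case True
  then have "z = of_real (Re z)" "Re z < 0" using assms by (auto simp: slit_plane_iff complex_eq_iff)
  then show ?thesis using neg_axis_mean[of "Re z"] by (metis of_real_eq_0_iff order_less_irrefl)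
qed

section \<open>The transform eta on the slit plane and on the negative axis\<close>

lemma psi_transform_eq:
  assumes "z \<in> slit_plane"
  shows "psi_transform M z = resolvent_mean M z - 1"
proof -
  have "psi_transform M z = (\<integral>s. 1 / (1 - z * of_real s) - 1 \<partial>M)"
    unfolding psi_transform_def set_lebesgue_integral_def
  proof (rule integral_cong_AE)
    show "AE s in M. indicat_real {0..} s *\<^sub>R (z * of_real s / (1 - z * of_real s)) = 1 / (1 - z * of_real s) - 1"
      using AE_nonneg
    proof eventually_elim
      case (elim s)
      then show ?case using one_minus_mult_nonzero[OF assms, of s] by (simp add: field_simps)
    qed
  qed simp_all
  also have "\<dots> = resolvent_mean M z - 1"
    using kernel_integrable[OF assms] by (simp add: resolvent_mean_def prob_UNIV)
  finally show ?thesis .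
qed

lemma eta_transform_eq:
  assumes "z \<in> slit_plane"
  shows "eta_transform M z = 1 - 1 / resolvent_mean M z"
  using resolvent_mean_nonzero[OF assms] by (simp add: eta_transform_def psi_transform_eq[OF assms] diff_divide_distrib)

lemma eta_holomorphic: "eta_transform M holomorphic_on slit_plane"
proof -
  have "(\<lambda>z. 1 - 1 / resolvent_mean M z) holomorphic_on slit_plane"
    using resolvent_mean_nonzero by (intro holomorphic_intros resolvent_mean_holomorphic) auto
  then show ?thesis by (rule holomorphic_transform) (simp add: eta_transform_eq)
qed

lemma eta_Im_pos: "Im (eta_transform M z) > 0" if "Im z > 0"
proof -
  have z: "z \<in> slit_plane" using that by (simp add: slit_plane_iff)
  have "Im (resolvent_mean M z) > 0" using weighted_mean_pos[of z] that by simp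
  then show ?thesis
    unfolding eta_transform_eq[OF z] by (simp add: Im_divide sum_power2_gt_zero_iff)
qed

lemma eta_neg:
  assumes "x < 0"
  shows "eta_transform M (of_real x) = of_real (1 - 1 / (\<integral>s. 1 / (1 - x * s) \<partial>M))"
    "Re (eta_transform M (of_real x)) < 0"
proof -
  have z: "complex_of_real x \<in> slit_plane" using assms by (simp add: slit_plane_iff)
  show eq: "eta_transform M (of_real x) = of_real (1 - 1 / (\<integral>s. 1 / (1 - x * s) \<partial>M))"
    unfolding eta_transform_eq[OF z] neg_axis_mean(1)[OF assms] by simp
  show "Re (eta_transform M (of_real x)) < 0"
    unfolding eq using neg_axis_mean(3,4)[OF assms] by simp
qed

lemma eta_slit: "eta_transform M z \<in> slit_plane" if z: "z \<in> slit_plane"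
proof (cases "Im z = 0")
  case True
  then have "z = of_real (Re z)" "Re z < 0" using that by (auto simp: slit_plane_iff complex_eq_iff)
  then show ?thesis using eta_neg[of "Re z"] by (metis slit_plane_iff)
next
  case False
  have "Im (resolvent_mean M z) \<noteq> 0" using weighted_mean_pos[OF False] False by simp
  then have "Im (eta_transform M z) \<noteq> 0"
    unfolding eta_transform_eq[OF z] by (simp add: Im_divide)
  then show ?thesis by (simp add: slit_plane_iff)
qed

lemma eta_strict_mono:
  assumes "x < y" "y < 0"
  shows "Re (eta_transform M (of_real x)) < Re (eta_transform M (of_real y))"
proof -
  have x: "x < 0" using assms by simp
  have "(\<integral>s. 1 / (1 - y * s) - 1 / (1 - x * s) \<partial>M) > 0"
  proof (rule integral_pos)
    show "integrable M (\<lambda>s. 1 / (1 - y * s) - 1 / (1 - x * s))"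
      using neg_axis_mean(2) x assms(2) by simp
    fix s :: real
    have eq: "1 / (1 - y * s) - 1 / (1 - x * s) = (y - x) * s / ((1 - y * s) * (1 - x * s))" if "s \<ge> 0"
    proof -
      have "x * s \<le> 0" "y * s \<le> 0" using that x assms(2) by (auto simp: mult_le_0_iff)
      then have "1 - y * s > 0" "1 - x * s > 0" by linarith+
      then show ?thesis by (simp add: divide_simps) (simp add: algebra_simps)
    qed
    have pos: "(1 - y * s) * (1 - x * s) > 0" if "s \<ge> 0"
      using that x assms(2) by (intro mult_pos_pos) (smt (verit) mult_le_0_iff)+
    show "s \<ge> 0 \<Longrightarrow> 1 / (1 - y * s) - 1 / (1 - x * s) \<ge> 0"
      using eq pos assms by (simp add: zero_le_divide_iff)
    show "s > 0 \<Longrightarrow> 1 / (1 - y * s) - 1 / (1 - x * s) > 0"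
      using eq pos assms by (simp add: zero_less_divide_iff)
  qed
  then have "(\<integral>s. 1 / (1 - x * s) \<partial>M) < (\<integral>s. 1 / (1 - y * s) \<partial>M)"
    using neg_axis_mean(2) x assms(2) by simp
  then show ?thesis
    unfolding eta_neg(1)[OF x] eta_neg(1)[OF assms(2)]
    using neg_axis_mean(3)[OF x] by (simp add: frac_less2)
qed

lemma eta_inj: "inj_on (\<lambda>x. Re (eta_transform M (of_real x))) {..<0}"
  by (rule linorder_inj_onI) (use eta_strict_mono in force)+

text \<open>One sequence suffices, since the intermediate value argument below only asks for some
  points with values close to \<open>0\<close>.\<close>

lemma eta_tendsto_0: "(\<lambda>n. Re (eta_transform M (of_real (- 1 / real (Suc n))))) \<longlonglongrightarrow> 0"
proof -
  have "(\<lambda>n. \<integral>s. 1 / (1 - (- 1 / real (Suc n)) * s) \<partial>M) \<longlonglongrightarrow> (\<integral>s. 1 \<partial>M)"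
  proof (rule integral_dominated_convergence[where w = "\<lambda>_. 1"])
    show "AE s in M. (\<lambda>n. 1 / (1 - (- 1 / real (Suc n)) * s)) \<longlonglongrightarrow> 1"
    proof (rule AE_I2)
      fix s :: real
      have "(\<lambda>n. 1 / real (Suc n)) \<longlonglongrightarrow> 0" by (rule LIMSEQ_inverse_real_of_nat[unfolded inverse_eq_divide])
      then have "(\<lambda>n. 1 / (1 - (- (1 / real (Suc n))) * s)) \<longlonglongrightarrow> 1 / (1 - (- 0) * s)"
        by (intro tendsto_intros) auto
      then show "(\<lambda>n. 1 / (1 - (- 1 / real (Suc n)) * s)) \<longlonglongrightarrow> 1" by simp
    qed
    show "AE s in M. norm (1 / (1 - (- 1 / real (Suc n)) * s)) \<le> 1" for n
      using AE_nonneg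
    proof eventually_elim
      case (elim s)
      then have "1 - (- 1 / real (Suc n)) * s \<ge> 1" by simp
      then show ?case by (smt (verit) divide_le_eq_1_pos norm_divide norm_one real_norm_def)
    qed
  qed (simp_all)
  moreover have "(\<integral>s. 1 \<partial>M) = (1 :: real)" by (simp add: prob_UNIV)
  ultimately have "(\<lambda>n. \<integral>s. 1 / (1 - (- 1 / real (Suc n)) * s) \<partial>M) \<longlonglongrightarrow> 1" by (simp only:)
  then have "(\<lambda>n. 1 - 1 / (\<integral>s. 1 / (1 - (- 1 / real (Suc n)) * s) \<partial>M)) \<longlonglongrightarrow> 1 - 1 / 1"
    by (rule tendsto_diff[OF tendsto_const tendsto_divide[OF tendsto_const]]) simp
  moreover have "- 1 / real (Suc n) < 0" for n by simp
  ultimately show ?thesis by (simp only: eta_neg(1) Re_complex_of_real) simp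
qed

lemma eta_range:
  assumes "x0 < 0" "Re (eta_transform M (of_real x0)) < y" "y < 0"
  obtains x where "x0 < x" "x < 0" "Re (eta_transform M (of_real x)) = y"
proof -
  have "\<forall>\<^sub>F n in sequentially. y < Re (eta_transform M (of_real (- 1 / real (Suc n))))"
    using order_tendstoD(1)[OF eta_tendsto_0 assms(3)] .
  moreover have "(\<lambda>n. - (1 / real (Suc n))) \<longlonglongrightarrow> - 0"
    by (intro tendsto_minus LIMSEQ_inverse_real_of_nat[unfolded inverse_eq_divide])
  then have "\<forall>\<^sub>F n in sequentially. x0 < - (1 / real (Suc n))"
    using order_tendstoD(1) assms(1) by force
  ultimately have "\<forall>\<^sub>F n in sequentially. y < Re (eta_transform M (of_real (- 1 / real (Suc n)))) \<and> x0 < - (1 / real (Suc n))"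
    by eventually_elim simp
  then obtain n where n: "y < Re (eta_transform M (of_real (- 1 / real (Suc n))))" "x0 < - 1 / real (Suc n)"
    by (auto simp: eventually_sequentially)
  define x1 where "x1 = - 1 / real (Suc n)"
  have x1: "x0 < x1" "x1 < 0" "y < Re (eta_transform M (of_real x1))"
    using n unfolding x1_def by (auto simp del: of_nat_Suc)
  have "continuous_on slit_plane (eta_transform M)"
    using eta_holomorphic by (rule holomorphic_on_imp_continuous_on)
  moreover have "complex_of_real ` {x0..x1} \<subseteq> slit_plane"
    using x1 by (auto simp: slit_plane_iff)
  ultimately have "continuous_on {x0..x1} (\<lambda>x. Re (eta_transform M (of_real x)))"
    by (intro continuous_on_Re) (rule continuous_on_compose2, auto intro: continuous_on_of_real_id)
  then obtain x where x: "x0 \<le> x" "x \<le> x1" "Re (eta_transform M (of_real x)) = y"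
    using IVT'[of "\<lambda>x. Re (eta_transform M (of_real x))" x0 y x1] x1 assms(2) by force
  then have "x0 < x" using assms(2) by (cases "x = x0") auto
  then show thesis using that x x1 by force
qed

lemma Sigma_transform_eta:
  assumes "x < 0" "Re (eta_transform M (of_real x)) = z"
  shows "Sigma_transform M z = x / z"
  unfolding Sigma_transform_def using the_inv_into_f_f[OF eta_inj, of x] assms by simp

text \<open>The constant is the imaginary part of \<open>resolvent_mean M \<i>\<close>. Eta decays
  no faster than linearly at \<open>0\<close> and grows no faster than linearly at infinity; raised
  to the power \<open>1 - 1 / t < 1\<close>, it then exceeds the order of \<open>y\<close> near
  \<open>0\<close> and falls below it at infinity. This later excludes \<open>0\<close> and infinity
  as Denjoy-Wolff points.\<close>

lemma eta_imaginary_axis: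
  obtains c where "c > 0"
    "\<And>y. 0 < y \<Longrightarrow> y \<le> 1 \<Longrightarrow> c * y \<le> cmod (eta_transform M (\<i> * of_real y))"
    "\<And>y. y \<ge> 1 \<Longrightarrow> cmod (eta_transform M (\<i> * of_real y)) \<le> 1 + y / c"
proof -
  define c where "c = (\<integral>s. s / (1 + s\<^sup>2) \<partial>M)"
  have pos: "1 + (y * s)\<^sup>2 > 0" for y s :: real by (simp add: add_pos_nonneg)
  have bd: "\<bar>s\<bar> / (1 + s\<^sup>2) \<le> 1" for s :: real
    using pos[of 1 s] sum_squares_bound[of "1::real" "\<bar>s\<bar>"] by (simp add: divide_simps)
  have int: "integrable M (\<lambda>s. s / (1 + s\<^sup>2))"
  proof (rule integrable_bounded[of _ 1], measurable)
    fix s :: real assume "s \<ge> 0"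
    then show "norm (s / (1 + s\<^sup>2)) \<le> 1" using bd[of s] by simp
  qed
  have c: "c > 0" unfolding c_def
    by (rule integral_pos[OF int]) (auto simp: add_pos_nonneg)
  have nrm: "(cmod (1 - \<i> * of_real y * of_real s))\<^sup>2 = 1 + (y * s)\<^sup>2" for y s
    by (simp add: cmod_power2 power_mult_distrib)
  have inty: "integrable M (\<lambda>s. s / (1 + (y * s)\<^sup>2))" if "y > 0" for y
  proof (rule integrable_bounded[of _ "1 / y"], measurable)
    fix s :: real
    have "\<bar>y * s\<bar> / (1 + (y * s)\<^sup>2) \<le> 1" by (rule bd)
    then show "norm (s / (1 + (y * s)\<^sup>2)) \<le> 1 / y"
      using that pos[of y s] by (simp add: abs_mult divide_simps mult_ac)
  qed
  have ImA: "Im (resolvent_mean M (\<i> * of_real y)) = y * (\<integral>s. s / (1 + (y * s)\<^sup>2) \<partial>M)" if "y > 0" for y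
    using weighted_mean_pos(1)[of "\<i> * of_real y"] that unfolding nrm by simp
  have slit: "\<i> * of_real y \<in> slit_plane" if "y > 0" for y
    using that by (simp add: slit_plane_iff)
  have low: "c * y \<le> cmod (eta_transform M (\<i> * of_real y))" if y: "0 < y" "y \<le> 1" for y
  proof -
    let ?A = "resolvent_mean M (\<i> * of_real y)"
    have A0: "?A \<noteq> 0" by (rule resolvent_mean_nonzero[OF slit[OF y(1)]])
    have "cmod ?A \<le> 1"
      unfolding resolvent_mean_def
    proof (rule norm_integral_le, measurable)
      fix s :: real
      have "1 \<le> (cmod (1 - \<i> * of_real y * of_real s))\<^sup>2" unfolding nrm by simp
      then have "1 \<le> cmod (1 - \<i> * of_real y * of_real s)"
        by (metis norm_ge_zero one_power2 power2_le_imp_le)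
      then show "cmod (1 / (1 - \<i> * of_real y * of_real s)) \<le> 1" by (simp add: norm_divide divide_le_eq_1)
    qed
    have "c \<le> (\<integral>s. s / (1 + (y * s)\<^sup>2) \<partial>M)"
      unfolding c_def
    proof (rule integral_mono_AE[OF int inty[OF y(1)]])
      show "AE s in M. s / (1 + s\<^sup>2) \<le> s / (1 + (y * s)\<^sup>2)"
        using AE_nonneg
      proof eventually_elim
        case (elim s)
        have "(y * s)\<^sup>2 \<le> s\<^sup>2" using y elim by (intro power_mono) (auto intro: mult_left_le_one_le)
        then show ?case using elim pos[of y s] by (intro divide_left_mono) (auto simp: add_pos_nonneg)
      qed
    qed
    then have "c * y \<le> Im (?A - 1)" unfolding minus_complex.sel ImA[OF y(1)] using y by simp
    also have "\<dots> \<le> cmod (?A - 1)" using abs_Im_le_cmod[of "?A - 1"] by linarith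
    also have "\<dots> = cmod (eta_transform M (\<i> * of_real y)) * cmod ?A"
      unfolding eta_transform_eq[OF slit[OF y(1)]] norm_mult[symmetric] using A0 by (simp add: left_diff_distrib)
    also have "\<dots> \<le> cmod (eta_transform M (\<i> * of_real y))"
      using \<open>cmod ?A \<le> 1\<close> by (simp add: mult_left_le)
    finally show ?thesis .
  qed
  have upp: "cmod (eta_transform M (\<i> * of_real y)) \<le> 1 + y / c" if y: "y \<ge> 1" for y
  proof -
    have y0: "y > 0" using y by simp
    let ?A = "resolvent_mean M (\<i> * of_real y)"
    have "c \<le> (\<integral>s. y\<^sup>2 * (s / (1 + (y * s)\<^sup>2)) \<partial>M)"
      unfolding c_def
    proof (rule integral_mono_AE[OF int integrable_mult_right[OF inty[OF y0]]])
      show "AE s in M. s / (1 + s\<^sup>2) \<le> y\<^sup>2 * (s / (1 + (y * s)\<^sup>2))"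
        using AE_nonneg
      proof eventually_elim
        case (elim s)
        have "1 \<le> y\<^sup>2" using y by simp
        then have "1 + (y * s)\<^sup>2 \<le> y\<^sup>2 * (1 + s\<^sup>2)" by (simp add: power_mult_distrib algebra_simps)
        then have "s * (1 + (y * s)\<^sup>2) \<le> s * (y\<^sup>2 * (1 + s\<^sup>2))" using elim by (rule mult_left_mono)
        then show ?case using pos[of y s] pos[of 1 s] by (simp add: divide_simps mult_ac)
      qed
    qed
    also have "\<dots> = y * Im ?A" unfolding ImA[OF y0] integral_mult_right_zero by (simp only: power2_eq_square mult.assoc)
    also have "\<dots> \<le> y * cmod ?A" using abs_Im_le_cmod[of ?A] y0 by simp
    finally have A: "c / y \<le> cmod ?A" using y0 by (simp add: divide_simps mult_ac)
    moreover have cy: "c / y > 0" using c y0 by simp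
    ultimately have "1 / cmod ?A \<le> 1 / (c / y)" by (intro divide_left_mono mult_pos_pos) auto
    moreover have "cmod (eta_transform M (\<i> * of_real y)) \<le> 1 + 1 / cmod ?A"
      unfolding eta_transform_eq[OF slit[OF y0]] using norm_triangle_ineq4[of 1 "1 / ?A"] by (simp add: norm_divide)
    ultimately show ?thesis by simp
  qed
  show thesis using that[OF c low upp] .
qed

text \<open>The factor \<open>(1 - z / x) / (1 - z * s)\<close> is \<open>1\<close> at
  \<open>s = 1 / x\<close> and tends to \<open>0\<close> at every other \<open>s\<close>; dominated
  convergence applies because the approach is nontangential.\<close>

lemma atom_mass_limit:
  assumes x: "x > 0" and Z: "Z \<longlonglongrightarrow> of_real x"
    and ev: "\<forall>\<^sub>F n in sequentially. Im (Z n) > 0 \<and> cmod (Z n - of_real x) \<le> C * Im (Z n)"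
  shows "(\<lambda>n. (1 - Z n / of_real x) * resolvent_mean M (Z n)) \<longlonglongrightarrow> of_real (measure M {1 / x})"
proof -
  have "\<forall>\<^sub>F n in sequentially. dist (Z n) (of_real x) < x / 2"
    using tendstoD[OF Z, of "x / 2"] x by simp
  with ev have "\<forall>\<^sub>F n in sequentially. Im (Z n) > 0 \<and> cmod (Z n - of_real x) \<le> C * Im (Z n)
      \<and> cmod (Z n - of_real x) \<le> x / 2"
    by eventually_elim (auto simp: dist_norm)
  then obtain N where N: "\<And>n. n \<ge> N \<Longrightarrow> Im (Z n) > 0 \<and> cmod (Z n - of_real x) \<le> C * Im (Z n)
      \<and> cmod (Z n - of_real x) \<le> x / 2"
    by (auto simp: eventually_sequentially)
  define Y where "Y n = Z (n + N)" for n
  have Y: "Im (Y n) > 0" "cmod (Y n - of_real x) \<le> C * Im (Y n)" "cmod (Y n - of_real x) \<le> x / 2" for n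
    using N[of "n + N"] by (auto simp: Y_def)
  have Ylim: "Y \<longlonglongrightarrow> of_real x" unfolding Y_def by (rule LIMSEQ_ignore_initial_segment[OF Z])
  have Yslit: "Y n \<in> slit_plane" for n using Y(1)[of n] by (simp add: slit_plane_iff)
  have C: "C \<ge> 0"
    using Y(1)[of 0] order_trans[OF norm_ge_zero Y(2)[of 0]] by (simp add: zero_le_mult_iff)
  have "(\<lambda>n. \<integral>s. (1 - Y n / of_real x) * (1 / (1 - Y n * of_real s)) \<partial>M)
      \<longlonglongrightarrow> (\<integral>s. of_real (indicator {1 / x} s) \<partial>M)"
  proof (rule integral_dominated_convergence[where w = "\<lambda>_. 2 * C + 2"])
    show "AE s in M. (\<lambda>n. (1 - Y n / of_real x) * (1 / (1 - Y n * of_real s)))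
        \<longlonglongrightarrow> complex_of_real (indicator {1 / x} s)"
    proof (rule AE_I2)
      fix s :: real
      show "(\<lambda>n. (1 - Y n / of_real x) * (1 / (1 - Y n * of_real s)))
        \<longlonglongrightarrow> complex_of_real (indicator {1 / x} s)"
      proof (cases "s = 1 / x")
        case True
        have "1 - Y n / of_real x \<noteq> 0" for n
          using Y(1)[of n] x by (auto simp: field_simps complex_eq_iff)
        then have "(1 - Y n / of_real x) * (1 / (1 - Y n * of_real s)) = 1" for n
          using True by simp
        then show ?thesis using True by simp
      next
        case False
        then have "1 - x * s \<noteq> 0" using x by (auto simp: field_simps)
        then have "complex_of_real (1 - x * s) \<noteq> 0" by (simp only: of_real_eq_0_iff) simp
        then have nz: "1 - complex_of_real x * of_real s \<noteq> 0" by simp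
        have "(\<lambda>n. (1 - Y n / of_real x) * (1 / (1 - Y n * of_real s)))
            \<longlonglongrightarrow> (1 - complex_of_real x / of_real x) * (1 / (1 - of_real x * of_real s))"
          using x nz by (intro tendsto_intros Ylim) auto
        then show ?thesis using False x by simp
      qed
    qed
    show "AE s in M. norm ((1 - Y n / of_real x) * (1 / (1 - Y n * of_real s))) \<le> 2 * C + 2" for n
      using AE_nonneg
    proof eventually_elim
      case (elim s)
      have e: "1 - Y n / of_real x = - (Y n - of_real x) / of_real x" using x by (simp add: field_simps)
      then have num: "cmod (1 - Y n / of_real x) = cmod (Y n - of_real x) / x"
        using x by (simp add: norm_divide norm_minus_commute)
      have pos: "cmod (1 - Y n * of_real s) > 0" using one_minus_mult_nonzero[OF Yslit elim] by simp
      \<comment> \<open>For \<open>s\<close> away from \<open>0\<close> the imaginary part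
        \<open>Im (Y n) * s\<close> bounds the denominator from below, and the cone condition
        compares it with the numerator. For small \<open>s\<close> the denominator is at least
        \<open>1 / 4\<close>.\<close>
      have "cmod (1 - Y n / of_real x) \<le> (2 * C + 2) * cmod (1 - Y n * of_real s)"
      proof (cases "s \<ge> 1 / (2 * x)")
        case True
        have "Im (Y n) * (1 / (2 * x)) \<le> Im (Y n) * s" using True Y(1)[of n] by (intro mult_left_mono) auto
        also have "\<dots> \<le> cmod (1 - Y n * of_real s)"
          using abs_Im_le_cmod[of "1 - Y n * of_real s"] by simp
        finally have 1: "Im (Y n) / (2 * x) \<le> cmod (1 - Y n * of_real s)" by simp
        have "cmod (1 - Y n / of_real x) \<le> C * Im (Y n) / x" unfolding num using Y(2)[of n] x by (simp add: divide_right_mono)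
        also have "\<dots> = 2 * C * (Im (Y n) / (2 * x))" by simp
        also have "\<dots> \<le> (2 * C + 2) * cmod (1 - Y n * of_real s)"
          using 1 C Y(1)[of n] x by (intro mult_mono) auto
        finally show ?thesis .
      next
        case False
        have "cmod (Y n) \<le> x + x / 2"
          using Y(3)[of n] norm_triangle_ineq2[of "Y n" "of_real x"] x by simp
        then have "cmod (Y n * of_real s) \<le> (x + x / 2) * (1 / (2 * x))"
          unfolding norm_mult using elim False x by (intro mult_mono) auto
        also have "\<dots> = 3 / 4" using x by (simp add: field_simps)
        finally have "1 / 4 \<le> cmod (1 - Y n * of_real s)"
          using norm_triangle_ineq2[of 1 "Y n * of_real s"] by simp
        then have "(2 * C + 2) * (1 / 4) \<le> (2 * C + 2) * cmod (1 - Y n * of_real s)"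
          using C by (intro mult_left_mono) auto
        moreover have "cmod (1 - Y n / of_real x) \<le> 1 / 2" unfolding num using Y(3)[of n] x by (simp add: divide_simps)
        moreover have "1 / 2 \<le> (2 * C + 2) * (1 / 4)" using C by simp
        ultimately show ?thesis by (meson order_trans)
      qed
      then show ?case using pos unfolding norm_mult norm_divide norm_one by (simp add: divide_simps)
    qed
  qed simp_all
  moreover have "(\<integral>s. (1 - Y n / of_real x) * (1 / (1 - Y n * of_real s)) \<partial>M)
      = (1 - Y n / of_real x) * resolvent_mean M (Y n)" for n
    unfolding resolvent_mean_def by (rule integral_mult_right_zero)
  moreover have "(\<integral>s. complex_of_real (indicator {1 / x} s) \<partial>M) = of_real (measure M {1 / x})"
    by simp
  ultimately have "(\<lambda>n. (1 - Y n / of_real x) * resolvent_mean M (Y n)) \<longlonglongrightarrow> of_real (measure M {1 / x})"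
    by simp
  then show ?thesis unfolding Y_def by (rule LIMSEQ_offset)
qed

end

section \<open>Stieltjes inversion\<close>

lemma nn_integral_poisson_Icc:
  fixes s :: real
  assumes "a \<le> b" "\<epsilon> > 0"
  shows "(\<integral>\<^sup>+y. ennreal (\<epsilon> / ((y - s)\<^sup>2 + \<epsilon>\<^sup>2)) * indicator {a..b} y \<partial>lborel)
    = ennreal (arctan ((b - s) / \<epsilon>) - arctan ((a - s) / \<epsilon>))"
proof (rule nn_integral_FTC_Icc)
  fix y :: real
  have "1 + ((y - s) / \<epsilon>)\<^sup>2 \<noteq> 0" by (metis add_pos_nonneg less_numeral_extra(3) zero_le_power2 zero_less_one)
  moreover have "(y - s)\<^sup>2 + \<epsilon>\<^sup>2 \<noteq> 0" using assms by (simp add: sum_power2_eq_zero_iff)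
  ultimately have "inverse (1 + ((y - s) / \<epsilon>)\<^sup>2) * (1 / \<epsilon>) = \<epsilon> / ((y - s)\<^sup>2 + \<epsilon>\<^sup>2)"
    using assms by (simp add: power_divide divide_simps) (simp add: algebra_simps power2_eq_square)
  moreover have "((\<lambda>y. arctan ((y - s) / \<epsilon>)) has_real_derivative inverse (1 + ((y - s) / \<epsilon>)\<^sup>2) * (1 / \<epsilon>)) (at y)"
    using assms by (auto intro!: derivative_eq_intros)
  ultimately show "((\<lambda>y. arctan ((y - s) / \<epsilon>)) has_real_derivative \<epsilon> / ((y - s)\<^sup>2 + \<epsilon>\<^sup>2)) (at y)" by simp
qed (use assms in auto)

lemma arctan_quotient_tendsto:
  fixes d :: real
  shows "(\<lambda>n. arctan (d / (1 / real (Suc n)))) \<longlonglongrightarrow> sgn d * (pi / 2)"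
proof -
  have top: "filterlim (\<lambda>n. real (Suc n)) at_top sequentially"
    by (rule filterlim_compose[OF filterlim_real_sequentially filterlim_Suc])
  consider "d > 0" | "d = 0" | "d < 0" by linarith
  then show ?thesis
  proof cases
    case 1
    have "filterlim (\<lambda>n. d * real (Suc n)) at_top sequentially"
      by (rule filterlim_tendsto_pos_mult_at_top[OF tendsto_const 1 top])
    then show ?thesis using filterlim_compose[OF tendsto_arctan_at_top] 1 by simp
  next
    case 3
    have "filterlim (\<lambda>n. d * real (Suc n)) at_bot sequentially"
      by (rule filterlim_tendsto_neg_mult_at_bot[OF tendsto_const 3 top])
    then show ?thesis using filterlim_compose[OF tendsto_arctan_at_bot] 3 by simp
  qed simp
qed

text \<open>The half-plane Poisson integral without its factor \<open>1 / pi\<close>; equivalently,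
  minus the imaginary part of the Cauchy transform at \<open>y + \<i> \<epsilon>\<close>.\<close>

definition poisson :: "real measure \<Rightarrow> real \<Rightarrow> real \<Rightarrow> real" where
  "poisson M y \<epsilon> = (\<integral>s. \<epsilon> / ((y - s)\<^sup>2 + \<epsilon>\<^sup>2) \<partial>M)"

context real_distribution
begin

lemma poisson_kernel_integrable:
  assumes "\<epsilon> > 0"
  shows "integrable M (\<lambda>s. \<epsilon> / ((y - s)\<^sup>2 + \<epsilon>\<^sup>2))"
proof (rule integrable_const_bound)
  have "\<epsilon> / ((y - s)\<^sup>2 + \<epsilon>\<^sup>2) \<le> 1 / \<epsilon>" for s
  proof -
    have "(y - s)\<^sup>2 + \<epsilon>\<^sup>2 > 0" using assms by (simp add: sum_power2_gt_zero_iff)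
    then show ?thesis using assms by (simp add: divide_simps) (simp add: power2_eq_square)
  qed
  then show "AE s in M. norm (\<epsilon> / ((y - s)\<^sup>2 + \<epsilon>\<^sup>2)) \<le> 1 / \<epsilon>"
    using assms by (intro AE_I2) simp
qed measurable

lemma poisson_nonneg: "\<epsilon> > 0 \<Longrightarrow> poisson M y \<epsilon> \<ge> 0"
  unfolding poisson_def by (intro integral_nonneg_AE AE_I2) simp

lemma nn_integral_poisson:
  assumes ab: "a \<le> b" and \<epsilon>: "\<epsilon> > 0"
  shows "(\<integral>\<^sup>+y. ennreal (poisson M y \<epsilon>) * indicator {a..b} y \<partial>lborel)
    = ennreal (\<integral>s. arctan ((b - s) / \<epsilon>) - arctan ((a - s) / \<epsilon>) \<partial>M)"
proof -
  interpret pair_sigma_finite lborel M ..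
  have nn: "ennreal (poisson M y \<epsilon>) = (\<integral>\<^sup>+s. ennreal (\<epsilon> / ((y - s)\<^sup>2 + \<epsilon>\<^sup>2)) \<partial>M)" for y
    unfolding poisson_def
    using \<epsilon> by (intro nn_integral_eq_integral[symmetric] poisson_kernel_integrable AE_I2) auto
  have mono: "arctan ((a - s) / \<epsilon>) \<le> arctan ((b - s) / \<epsilon>)" for s
    unfolding arctan_le_iff using ab \<epsilon> by (intro divide_right_mono) auto
  have "(\<integral>\<^sup>+y. ennreal (poisson M y \<epsilon>) * indicator {a..b} y \<partial>lborel)
      = (\<integral>\<^sup>+y. \<integral>\<^sup>+s. ennreal (\<epsilon> / ((y - s)\<^sup>2 + \<epsilon>\<^sup>2)) * indicator {a..b} y \<partial>M \<partial>lborel)"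
    unfolding nn by (intro nn_integral_cong nn_integral_multc[symmetric]) measurable
  also have "\<dots> = (\<integral>\<^sup>+s. \<integral>\<^sup>+y. ennreal (\<epsilon> / ((y - s)\<^sup>2 + \<epsilon>\<^sup>2)) * indicator {a..b} y \<partial>lborel \<partial>M)"
    by (rule Fubini'[symmetric]) measurable
  also have "\<dots> = (\<integral>\<^sup>+s. ennreal (arctan ((b - s) / \<epsilon>) - arctan ((a - s) / \<epsilon>)) \<partial>M)"
    unfolding nn_integral_poisson_Icc[OF ab \<epsilon>] ..
  also have "\<dots> = ennreal (\<integral>s. arctan ((b - s) / \<epsilon>) - arctan ((a - s) / \<epsilon>) \<partial>M)"
  proof (rule nn_integral_eq_integral)
    have "\<bar>arctan u\<bar> \<le> pi / 2" for u using arctan_bounded[of u] by linarith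
    then have "\<bar>arctan u - arctan v\<bar> \<le> pi" for u v
      using abs_triangle_ineq4[of "arctan u" "arctan v"] by (smt (verit) field_sum_of_halves)
    then show "integrable M (\<lambda>s. arctan ((b - s) / \<epsilon>) - arctan ((a - s) / \<epsilon>))"
      by (intro integrable_const_bound[where B = pi] AE_I2) auto
  qed (use mono in auto)
  finally show ?thesis .
qed

text \<open>The average of the two indicators gives the endpoints half of their mass, since \<open>arctan 0 = 0\<close>.\<close>

lemma Stieltjes_inversion_Icc:
  assumes "a < b"
    and cont: "continuous_on ({a..b} \<times> {0..1}) (\<lambda>(y, \<epsilon>). P y \<epsilon>)"
    and P: "\<And>y \<epsilon>. y \<in> {a..b} \<Longrightarrow> 0 < \<epsilon> \<Longrightarrow> \<epsilon> \<le> 1 \<Longrightarrow> P y \<epsilon> = poisson M y \<epsilon>"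
  shows "(\<integral>\<^sup>+y. ennreal (P y 0) * indicator {a..b} y \<partial>lborel)
       = ennreal (pi * (\<integral>s. (indicator {a..b} s + indicator {a<..<b} s) / 2 \<partial>M))"
proof -
  have ab: "a \<le> b" using assms(1) by simp
  define e where "e n = 1 / real (Suc n)" for n
  have e: "0 < e n" "0 \<le> e n" "e n \<le> 1" for n by (auto simp: e_def)
  have elim: "e \<longlonglongrightarrow> 0"
    unfolding e_def[abs_def] by (rule LIMSEQ_inverse_real_of_nat[unfolded inverse_eq_divide])
  have contP: "continuous_on {a..b} (\<lambda>y. P y u)" if "0 \<le> u" "u \<le> 1" for u
    using that by (intro continuous_on_compose2[OF cont, where f = "\<lambda>y. (y, u)", simplified]) (auto intro!: continuous_intros)
  have meas: "(\<lambda>y. P y 0 * indicator {a..b} y) \<in> borel_measurable borel"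
    using borel_measurable_continuous_on_indicator[OF _ contP[of 0]] by (simp add: mult.commute)
  have measn: "(\<lambda>y. P y (e n) * indicator {a..b} y) \<in> borel_measurable borel" for n
    using borel_measurable_continuous_on_indicator[OF _ contP[of "e n"]] e[of n] by (simp add: mult.commute)
  have "compact ((\<lambda>(y, \<epsilon>). P y \<epsilon>) ` ({a..b} \<times> {0..1}))"
    by (intro compact_continuous_image cont compact_Times) auto
  then obtain B where B0: "\<forall>v\<in>(\<lambda>(y, \<epsilon>). P y \<epsilon>) ` ({a..b} \<times> {0..1}). norm v \<le> B"
    using compact_imp_bounded bounded_iff by metis
  then have B: "\<bar>P y u\<bar> \<le> B" if "y \<in> {a..b}" "0 \<le> u" "u \<le> 1" for y u
    using that by auto
  have nonneg: "P y u \<ge> 0" if y: "y \<in> {a..b}" "0 < u" "u \<le> 1" for y u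
    using P[OF y] poisson_nonneg[OF y(2)] by simp
  have Plim: "(\<lambda>n. P y (e n)) \<longlonglongrightarrow> P y 0" if y: "y \<in> {a..b}" for y
  proof -
    have "((\<lambda>n. (\<lambda>(y, \<epsilon>). P y \<epsilon>) (y, e n)) \<longlonglongrightarrow> (\<lambda>(y, \<epsilon>). P y \<epsilon>) (y, 0))"
      using e y by (intro continuous_on_tendsto_compose[OF cont] tendsto_intros elim) auto
    then show ?thesis by simp
  qed
  have nonneg0: "P y 0 \<ge> 0" if y: "y \<in> {a..b}" for y
    by (rule LIMSEQ_le_const[OF Plim[OF y]]) (use nonneg[OF y] e in auto)
  \<comment> \<open>Both sides of \<open>nn_integral_poisson\<close> pass to the limit by dominated
    convergence, the left one with the bound \<open>B\<close>, the right one with the bound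
    \<open>pi\<close>.\<close>
  have "(\<lambda>n. \<integral>y. P y (e n) * indicator {a..b} y \<partial>lborel) \<longlonglongrightarrow> (\<integral>y. P y 0 * indicator {a..b} y \<partial>lborel)"
  proof (rule integral_dominated_convergence[where w = "\<lambda>y. B * indicator {a..b} y"])
    show "AE y in lborel. (\<lambda>n. P y (e n) * indicat_real {a..b} y) \<longlonglongrightarrow> P y 0 * indicat_real {a..b} y"
      using Plim by (intro AE_I2) (auto simp: indicator_def)
    show "AE y in lborel. norm (P y (e n) * indicat_real {a..b} y) \<le> B * indicat_real {a..b} y" for n
      using B e[of n] by (intro AE_I2) (auto simp: indicator_def less_imp_le)
    show "integrable lborel (\<lambda>y. B * indicat_real {a..b} y)"
      using ab by (intro integrable_mult_right integrable_real_indicator) auto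
  qed (use meas measn in auto)
  moreover have int: "integrable lborel (\<lambda>y. P y u * indicator {a..b} y)" if "0 \<le> u" "u \<le> 1" for u
    using borel_integrable_atLeastAtMost'[OF contP[OF that]]
    by (simp add: set_integrable_def mult.commute)
  have eqn: "(\<integral>y. P y (e n) * indicator {a..b} y \<partial>lborel)
      = (\<integral>s. arctan ((b - s) / e n) - arctan ((a - s) / e n) \<partial>M)" for n
  proof -
    have "ennreal (\<integral>y. P y (e n) * indicator {a..b} y \<partial>lborel)
        = (\<integral>\<^sup>+y. ennreal (P y (e n) * indicator {a..b} y) \<partial>lborel)"
      using int[of "e n"] e[of n] nonneg
      by (intro nn_integral_eq_integral[symmetric] AE_I2) (auto simp: indicator_def)
    also have "\<dots> = (\<integral>\<^sup>+y. ennreal (poisson M y (e n)) * indicator {a..b} y \<partial>lborel)"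
      using P e by (intro nn_integral_cong) (auto simp: indicator_def)
    also have "\<dots> = ennreal (\<integral>s. arctan ((b - s) / e n) - arctan ((a - s) / e n) \<partial>M)"
      by (rule nn_integral_poisson[OF ab e(1)])
    finally have *: "ennreal (\<integral>y. P y (e n) * indicator {a..b} y \<partial>lborel)
        = ennreal (\<integral>s. arctan ((b - s) / e n) - arctan ((a - s) / e n) \<partial>M)" .
    have "arctan ((a - s) / e n) \<le> arctan ((b - s) / e n)" for s
      unfolding arctan_le_iff using ab e(1)[of n] by (intro divide_right_mono) auto
    then have "0 \<le> (\<integral>s. arctan ((b - s) / e n) - arctan ((a - s) / e n) \<partial>M)"
      by (intro integral_nonneg_AE AE_I2) simp
    moreover have "0 \<le> (\<integral>y. P y (e n) * indicator {a..b} y \<partial>lborel)"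
      using nonneg e[of n] by (intro integral_nonneg_AE AE_I2) (auto simp: indicator_def)
    ultimately show ?thesis using * by (simp only: ennreal_inj)
  qed
  moreover have "(\<lambda>n. \<integral>s. arctan ((b - s) / e n) - arctan ((a - s) / e n) \<partial>M)
      \<longlonglongrightarrow> (\<integral>s. pi * ((indicator {a..b} s + indicator {a<..<b} s) / 2) \<partial>M)"
  proof (rule integral_dominated_convergence[where w = "\<lambda>_. pi"])
    show "AE s in M. (\<lambda>n. arctan ((b - s) / e n) - arctan ((a - s) / e n))
        \<longlonglongrightarrow> pi * ((indicator {a..b} s + indicator {a<..<b} s) / 2)"
    proof (rule AE_I2)
      fix s :: real
      have "(\<lambda>n. arctan ((b - s) / e n) - arctan ((a - s) / e n))
          \<longlonglongrightarrow> sgn (b - s) * (pi / 2) - sgn (a - s) * (pi / 2)"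
        unfolding e_def by (intro tendsto_diff arctan_quotient_tendsto)
      moreover have "sgn (b - s) * (pi / 2) - sgn (a - s) * (pi / 2)
          = pi * ((indicator {a..b} s + indicator {a<..<b} s) / 2)"
        using \<open>a < b\<close> by (auto simp: indicator_def sgn_if)
      ultimately show "(\<lambda>n. arctan ((b - s) / e n) - arctan ((a - s) / e n))
        \<longlonglongrightarrow> pi * ((indicator {a..b} s + indicator {a<..<b} s) / 2)" by (simp only:)
    qed
    have "\<bar>arctan u\<bar> \<le> pi / 2" for u using arctan_bounded[of u] by linarith
    then have "\<bar>arctan u - arctan v\<bar> \<le> pi" for u v
      using abs_triangle_ineq4[of "arctan u" "arctan v"] by (smt (verit) field_sum_of_halves)
    then show "AE s in M. norm (arctan ((b - s) / e n) - arctan ((a - s) / e n)) \<le> pi" for n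
      by (intro AE_I2) simp
  qed simp_all
  ultimately have "(\<integral>y. P y 0 * indicator {a..b} y \<partial>lborel)
      = (\<integral>s. pi * ((indicator {a..b} s + indicator {a<..<b} s) / 2) \<partial>M)"
    using LIMSEQ_unique by (simp only:) blast
  also have "\<dots> = pi * (\<integral>s. (indicator {a..b} s + indicator {a<..<b} s) / 2 \<partial>M)"
    by (rule integral_mult_right_zero)
  finally have "(\<integral>y. P y 0 * indicator {a..b} y \<partial>lborel) = \<dots>" .
  moreover have "(\<integral>\<^sup>+y. ennreal (P y 0) * indicator {a..b} y \<partial>lborel)
      = ennreal (\<integral>y. P y 0 * indicator {a..b} y \<partial>lborel)"
  proof -
    have "(\<integral>\<^sup>+y. ennreal (P y 0) * indicator {a..b} y \<partial>lborel)
        = (\<integral>\<^sup>+y. ennreal (P y 0 * indicator {a..b} y) \<partial>lborel)"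
      by (intro nn_integral_cong) (auto simp: indicator_def)
    also have "\<dots> = ennreal (\<integral>y. P y 0 * indicator {a..b} y \<partial>lborel)"
      using int[of 0] nonneg0 by (intro nn_integral_eq_integral AE_I2) (auto simp: indicator_def)
    finally show ?thesis .
  qed
  ultimately show "(\<integral>\<^sup>+y. ennreal (P y 0) * indicator {a..b} y \<partial>lborel)
       = ennreal (pi * (\<integral>s. (indicator {a..b} s + indicator {a<..<b} s) / 2 \<partial>M))" by (simp only:)
qed

text \<open>The inversion formula for the interval of radius \<open>h\<close> around
  \<open>y\<close> counts the centre with full weight, so \<open>pi\<close> times the mass of
  \<open>y\<close> is at most the integral of a bounded function over an interval of length
  \<open>2 * h\<close>, for every small \<open>h\<close>.\<close>

lemma Stieltjes_no_atom:
  assumes U: "open U" "y \<in> U"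
    and cont: "continuous_on (U \<times> {0..1}) (\<lambda>(y, \<epsilon>). P y \<epsilon>)"
    and P: "\<And>y \<epsilon>. y \<in> U \<Longrightarrow> 0 < \<epsilon> \<Longrightarrow> \<epsilon> \<le> 1 \<Longrightarrow> P y \<epsilon> = poisson M y \<epsilon>"
  shows "measure M {y} = 0"
proof -
  obtain d where d: "d > 0" "cball y d \<subseteq> U"
    using U open_contains_cball_eq by blast
  have sub: "{y - h..y + h} \<subseteq> U" if "h \<le> d" for h
    using d(2) that by (auto simp: cball_eq_atLeastAtMost subset_eq)
  have "continuous_on (cball y d) (\<lambda>u. P u 0)"
    using d(2) by (intro continuous_on_compose2[OF cont, where f = "\<lambda>u. (u, 0)", simplified]) (auto intro!: continuous_intros)
  then have "bounded ((\<lambda>u. P u 0) ` cball y d)"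
    by (intro compact_imp_bounded compact_continuous_image) auto
  then obtain B where B: "\<forall>v\<in>(\<lambda>u. P u 0) ` cball y d. norm v \<le> B" using bounded_iff by metis
  have B0: "B \<ge> 0" using B d(1) by (metis centre_in_cball image_eqI less_imp_le norm_ge_zero order_trans)
  have main: "pi * measure M {y} \<le> B * (2 * h)" if h: "0 < h" "h \<le> d" for h
  proof -
    let ?j = "\<lambda>s. (indicat_real {y - h..y + h} s + indicat_real {y - h<..<y + h} s) / 2"
    have "measure M {y} = (\<integral>s. indicat_real {y} s \<partial>M)" by simp
    also have "\<dots> \<le> (\<integral>s. ?j s \<partial>M)"
    proof (rule integral_mono)
      show "integrable M (indicat_real {y})" "integrable M ?j"
        by (intro integrable_const_bound[where B = 1] AE_I2; simp add: indicator_def)+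
      show "indicat_real {y} s \<le> ?j s" for s using h by (auto simp: indicator_def)
    qed
    finally have "ennreal (pi * measure M {y}) \<le> ennreal (pi * (\<integral>s. ?j s \<partial>M))" by (intro ennreal_leI) simp
    also have "\<dots> = (\<integral>\<^sup>+u. ennreal (P u 0) * indicator {y - h..y + h} u \<partial>lborel)"
      using h sub[OF h(2)] P
      by (intro Stieltjes_inversion_Icc[symmetric] continuous_on_subset[OF cont]) auto
    also have "\<dots> \<le> (\<integral>\<^sup>+u. ennreal B * indicator {y - h..y + h} u \<partial>lborel)"
    proof (intro nn_integral_mono)
      fix u
      show "ennreal (P u 0) * indicator {y - h..y + h} u \<le> ennreal B * indicator {y - h..y + h} u"
      proof (cases "u \<in> {y - h..y + h}")
        case True
        then have "u \<in> cball y d" using h by (auto simp: cball_eq_atLeastAtMost)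
        then have "norm (P u 0) \<le> B" using B by blast
        then have "P u 0 \<le> B" by simp
        then show ?thesis using True by (simp add: ennreal_leI)
      qed simp
    qed
    also have "\<dots> = ennreal B * ennreal (2 * h)"
      using h by (simp add: nn_integral_cmult_indicator)
    finally have "ennreal (pi * measure M {y}) \<le> ennreal (B * (2 * h))"
      using B0 h by (simp add: ennreal_mult)
    then show ?thesis using B0 h by (simp add: ennreal_le_iff)
  qed
  have "pi * measure M {y} \<le> 0 + e" if e: "e > 0" for e
  proof -
    define h where "h = min d (e / (2 * (B + 1)))"
    have h: "0 < h" "h \<le> d" "h \<le> e / (2 * (B + 1))" using d(1) e B0 by (auto simp: h_def)
    have "B * (2 * h) \<le> (B + 1) * (2 * h)" using h by simp
    also have "\<dots> \<le> (B + 1) * (2 * (e / (2 * (B + 1))))" using h B0 by (intro mult_left_mono) auto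
    also have "\<dots> = e" using B0 by (simp add: field_simps)
    finally show ?thesis using main[OF h(1,2)] by simp
  qed
  then have "pi * measure M {y} \<le> 0" by (rule field_le_epsilon)
  then have "measure M {y} \<le> 0" using pi_gt_zero by (auto simp: mult_le_0_iff)
  then show ?thesis by (simp add: measure_le_0_iff)
qed

text \<open>Without atoms in \<open>U\<close> the half weights at the endpoints disappear, so
  inversion determines the measure of half-open intervals, then of Borel sets inside one interval,
  and finally of all Borel subsets of \<open>U\<close> by countable additivity.\<close>

lemma Stieltjes_density:
  assumes U: "open U"
    and cont: "continuous_on (U \<times> {0..1}) (\<lambda>(y, \<epsilon>). P y \<epsilon>)"
    and P: "\<And>y \<epsilon>. y \<in> U \<Longrightarrow> 0 < \<epsilon> \<Longrightarrow> \<epsilon> \<le> 1 \<Longrightarrow> P y \<epsilon> = poisson M y \<epsilon>"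
    and A: "A \<in> sets borel" "A \<subseteq> U"
  shows "emeasure M A = emeasure (density lborel (\<lambda>y. ennreal (P y 0 / pi) * indicator U y)) A"
proof -
  define f where "f y = ennreal (P y 0 / pi) * indicator U y" for y
  have "continuous_on U (\<lambda>y. P y 0)"
    by (intro continuous_on_compose2[OF cont, where f = "\<lambda>u. (u, 0)", simplified]) (auto intro!: continuous_intros)
  then have [measurable]: "(\<lambda>y. indicator U y *\<^sub>R P y 0) \<in> borel_measurable borel"
    using U by (intro borel_measurable_continuous_on_indicator) auto
  \<comment> \<open>\<open>P y 0\<close> is unconstrained outside \<open>U\<close>; an indicator
    inside \<open>ennreal\<close> as well makes the integrand visibly measurable.\<close>
  have "(\<lambda>y. ennreal (indicator U y *\<^sub>R P y 0 / pi) * indicator U y) \<in> borel_measurable borel"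
    using borel_open[OF U] by measurable
  also have "(\<lambda>y. ennreal (indicator U y *\<^sub>R P y 0 / pi) * indicator U y) = f"
    by (auto simp: f_def indicator_def)
  finally have fm[measurable]: "f \<in> borel_measurable borel" .
  have Ioc: "emeasure M {a<..b} = (\<integral>\<^sup>+y. f y * indicator {a<..b} y \<partial>lborel)" if ab: "a < b" "{a..b} \<subseteq> U" for a b
  proof -
    have "measure M {a} = 0" "measure M {b} = 0"
      using Stieltjes_no_atom[OF U _ cont P, of a] Stieltjes_no_atom[OF U _ cont P, of b] ab
      by (auto simp: subset_eq)
    then have "AE s in M. s \<noteq> a" "AE s in M. s \<noteq> b"
      by (intro AE_I[of _ _ "{a}"] AE_I[of _ _ "{b}"]; simp add: emeasure_eq_measure)+
    then have "AE s in M. (indicator {a..b} s + indicator {a<..<b} s) / 2 = indicat_real {a<..b} s"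
      by eventually_elim (auto simp: indicator_def)
    then have "(\<integral>s. (indicator {a..b} s + indicator {a<..<b} s) / 2 \<partial>M) = (\<integral>s. indicat_real {a<..b} s \<partial>M)"
      by (intro integral_cong_AE) auto
    then have "ennreal (pi * measure M {a<..b}) = (\<integral>\<^sup>+y. ennreal (P y 0) * indicator {a..b} y \<partial>lborel)"
      using ab P by (subst Stieltjes_inversion_Icc) (auto intro: continuous_on_subset[OF cont])
    also have "\<dots> = (\<integral>\<^sup>+y. ennreal pi * (f y * indicator {a<..b} y) \<partial>lborel)"
    proof (rule nn_integral_cong_AE)
      show "AE y in lborel. ennreal (P y 0) * indicator {a..b} y = ennreal pi * (f y * indicator {a<..b} y)"
        using AE_lborel_singleton[of a]
      proof eventually_elim
        case (elim y)
        have "ennreal (P y 0) = ennreal pi * ennreal (P y 0 / pi)"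
          by (simp add: ennreal_mult'[symmetric])
        then show ?case using elim ab by (auto simp: indicator_def f_def)
      qed
    qed
    also have "\<dots> = ennreal pi * (\<integral>\<^sup>+y. f y * indicator {a<..b} y \<partial>lborel)"
      by (intro nn_integral_cmult) measurable
    finally have "ennreal pi * ennreal (measure M {a<..b}) = ennreal pi * (\<integral>\<^sup>+y. f y * indicator {a<..b} y \<partial>lborel)"
      by (simp add: ennreal_mult)
    then show ?thesis by (simp add: ennreal_mult_cancel_left emeasure_eq_measure)
  qed
  \<comment> \<open>Restricted to \<open>{a<..b}\<close> both measures are finite, hence determined
    by their values on the rays \<open>{x<..}\<close>.\<close>
  have local: "emeasure M S = emeasure (density lborel f) S"
    if ab: "{a..b} \<subseteq> U" and S: "S \<in> sets borel" "S \<subseteq> {a<..b}" for a b S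
  proof -
    let ?M = "density M (indicator {a<..b})" and ?N = "density lborel (\<lambda>y. f y * indicator {a<..b} y)"
    have sub: "(indicator {a<..b} y :: ennreal) * indicator {x<..} y = indicator {max a x<..b} y" for x y
      by (auto simp: indicator_def)
    have eM: "emeasure ?M {x<..} = emeasure M {max a x<..b}" for x
      by (simp add: emeasure_density sub)
    moreover have "emeasure ?N {x<..} = (\<integral>\<^sup>+y. f y * indicator {max a x<..b} y \<partial>lborel)" for x
      by (simp add: emeasure_density mult.assoc sub)
    moreover have "emeasure M {max a x<..b} = (\<integral>\<^sup>+y. f y * indicator {max a x<..b} y \<partial>lborel)" for x
    proof (cases "max a x < b")
      case True
      then show ?thesis using ab by (intro Ioc) auto
    qed auto
    ultimately have eq: "emeasure ?M {x<..} = emeasure ?N {x<..}" for x using eM by simp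
    have "?M = ?N"
    proof (rule measure_eqI_lessThan)
      show "emeasure ?M {x<..} < \<infinity>" for x unfolding eM by (simp add: emeasure_eq_measure)
    qed (use eq in simp_all)
    then have "emeasure ?M S = emeasure ?N S" by simp
    moreover have "(indicator {a<..b} y :: ennreal) * indicator S y = indicator S y" for y
      using S(2) by (auto simp: indicator_def)
    ultimately show ?thesis using S by (simp add: emeasure_density mult.assoc)
  qed
  \<comment> \<open>Countably many of these intervals cover \<open>U\<close>; made disjoint, they
    cut \<open>A\<close> into pieces to which \<open>local\<close> applies.\<close>
  define F where "F = {{a<..<b} | a b. {a..b} \<subseteq> U}"
  have "open S" if "S \<in> F" for S using that by (auto simp: F_def)
  then obtain F' where F': "F' \<subseteq> F" "countable F'" "\<Union>F' = \<Union>F" using Lindelof by metis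
  have "U \<subseteq> \<Union>F"
  proof
    fix y assume "y \<in> U"
    then obtain d where d: "d > 0" "cball y d \<subseteq> U" using U open_contains_cball_eq by blast
    then have "{y - d<..<y + d} \<in> F" unfolding F_def cball_eq_atLeastAtMost by blast
    then show "y \<in> \<Union>F" by (rule UnionI) (use d(1) in auto)
  qed
  show ?thesis
  proof (cases "F' = {}")
    case True
    then have "A = {}" using A \<open>U \<subseteq> \<Union>F\<close> F' by auto
    then show ?thesis by simp
  next
    case False
    define S where "S = from_nat_into F'"
    have rS: "range S = F'" unfolding S_def by (rule range_from_nat_into[OF False F'(2)])
    have SF: "S n \<in> F" for n using rS F'(1) by auto
    have Sm: "S n \<in> sets borel" for n using SF[of n] by (auto simp: F_def)
    have dm: "disjointed S n \<in> sets borel" for n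
      using sets.range_disjointed_sets[of S borel] Sm by auto
    have A_eq: "A = (\<Union>n. A \<inter> disjointed S n)"
      using A(2) \<open>U \<subseteq> \<Union>F\<close> F'(3) rS UN_disjointed_eq[of S] by auto
    have disj: "disjoint_family (\<lambda>n. A \<inter> disjointed S n)"
      using disjoint_family_disjointed[of S] by (auto simp: disjoint_family_on_def)
    have each: "emeasure M (A \<inter> disjointed S n) = emeasure (density lborel f) (A \<inter> disjointed S n)" for n
    proof -
      obtain a b where "S n = {a<..<b}" "{a..b} \<subseteq> U" using SF[of n] by (auto simp: F_def)
      moreover have "disjointed S n \<subseteq> S n" by (rule disjointed_subset)
      ultimately show ?thesis using A dm[of n] by (intro local[of a b]) auto
    qed
    have "emeasure M A = (\<Sum>n. emeasure M (A \<inter> disjointed S n))"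
      using A(1) dm disj by (subst A_eq, intro suminf_emeasure[symmetric]) auto
    also have "\<dots> = (\<Sum>n. emeasure (density lborel f) (A \<inter> disjointed S n))" unfolding each ..
    also have "\<dots> = emeasure (density lborel f) A"
      using A(1) dm disj by (subst (2) A_eq, intro suminf_emeasure) auto
    finally show ?thesis unfolding f_def .
  qed
qed

end

section \<open>Subordination\<close>

lemma frequently_upper_sequence:
  assumes "\<exists>\<^sub>F z in at (of_real x) within {z. Im z > 0}. P z"
  obtains Z where "Z \<longlonglongrightarrow> of_real x" "\<forall>n. Im (Z n) > 0 \<and> P (Z n)"
proof -
  have "\<exists>z. Im z > 0 \<and> dist z (of_real x) < 1 / real (Suc n) \<and> P z" for n
  proof -
    have "\<forall>\<^sub>F z in at (complex_of_real x) within {z. Im z > 0}. Im z > 0 \<and> dist z (of_real x) < 1 / real (Suc n)"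
      unfolding eventually_at by (intro exI[of _ "1 / real (Suc n)"]) auto
    from frequently_eventually_conj[OF assms this]
    show ?thesis by (auto dest!: frequently_ex)
  qed
  then obtain Z where Z: "\<And>n. Im (Z n) > 0" "\<And>n. dist (Z n) (of_real x) < 1 / real (Suc n)" "\<And>n. P (Z n)"
    by metis
  have "(\<lambda>n. 1 / real (Suc n)) \<longlonglongrightarrow> 0" by (rule LIMSEQ_inverse_real_of_nat[unfolded inverse_eq_divide])
  then have "(\<lambda>n. Z n - of_real x) \<longlonglongrightarrow> 0"
    by (rule Lim_null_comparison[rotated]) (use Z(2) in \<open>simp add: dist_norm less_imp_le del: of_nat_Suc\<close>)
  then have "Z \<longlonglongrightarrow> of_real x" by (rule LIM_zero_cancel)
  then show thesis using that Z by blast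
qed

lemma at_upper_half_plane_nontrivial: "at (complex_of_real x) within {z. Im z > 0} \<noteq> bot"
proof -
  have "complex_of_real x islimpt {z. Im z > 0}"
    unfolding islimpt_approachable
  proof (intro allI impI)
    fix e :: real assume "e > 0"
    then show "\<exists>x'\<in>{z. Im z > 0}. x' \<noteq> of_real x \<and> dist x' (of_real x) < e"
      by (intro bexI[of _ "of_real x + \<i> * of_real (e / 2)"]) (auto simp: dist_norm norm_mult complex_eq_iff)
  qed
  then show ?thesis by (simp add: trivial_limit_within)
qed

text \<open>Caratheodory's form of the derivative avoids division by \<open>X n - a\<close>, which
  may be \<open>0\<close>; the denominator \<open>Y n\<close> is the increment of another
  variable.\<close>

lemma DERIV_difference_quotient_tendsto:
  fixes f :: "complex \<Rightarrow> complex"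
  assumes "(f has_field_derivative D) (at a)" "X \<longlonglongrightarrow> a" "(\<lambda>n. (X n - a) / Y n) \<longlonglongrightarrow> l"
  shows "(\<lambda>n. (f (X n) - f a) / Y n) \<longlonglongrightarrow> D * l"
proof -
  obtain g where g: "\<And>z. f z - f a = g z * (z - a)" "isCont g a" "g a = D"
    using assms(1) CARAT_DERIV by metis
  have "(\<lambda>n. g (X n) * ((X n - a) / Y n)) \<longlonglongrightarrow> g a * l"
    by (intro tendsto_mult isCont_tendsto_compose[OF g(2)] assms)
  then show ?thesis by (simp add: g(1,3))
qed

text \<open>A boundary value near \<open>x\<close> is itself a limit of values of \<open>f\<close>
  close to \<open>b x\<close>, so the existence of the limits makes the boundary function
  continuous.\<close>

lemma continuous_on_upper_boundary:
  fixes f :: "complex \<Rightarrow> complex"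
  assumes f: "continuous_on {z. Im z > 0} f"
    and b: "\<And>x. x > 0 \<Longrightarrow> (f \<longlongrightarrow> b x) (at (of_real x) within {z. Im z > 0})"
  shows "continuous_on {z. Im z > 0 \<or> Im z = 0 \<and> Re z > 0} (\<lambda>z. if Im z > 0 then f z else b (Re z))"
    (is "continuous_on ?S ?g")
  unfolding continuous_on_eq_continuous_within
proof
  fix z0 assume z0: "z0 \<in> ?S"
  show "continuous (at z0 within ?S) ?g"
  proof (cases "Im z0 > 0")
    case True
    have op: "open {z. Im z > 0}" by (rule open_halfspace_Im_gt)
    have "isCont f z0" using f op True by (simp add: continuous_on_eq_continuous_at)
    moreover have ev: "\<forall>\<^sub>F z in nhds z0. f z = ?g z"
      using eventually_nhds_in_open[OF op, of z0] True by (auto elim: eventually_mono)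
    ultimately have "isCont ?g z0" using isCont_cong[OF ev] by blast
    then show ?thesis by (rule continuous_at_imp_continuous_at_within)
  next
    case False
    define x where "x = Re z0"
    have x: "x > 0" "z0 = of_real x" using False z0 by (auto simp: x_def complex_eq_iff)
    show ?thesis
      unfolding continuous_within_eps_delta
    proof (intro allI impI)
      fix e :: real assume e: "e > 0"
      have "\<forall>e>0. \<exists>d>0. \<forall>z\<in>{z. Im z > 0}. 0 < dist z z0 \<and> dist z z0 < d \<longrightarrow> dist (f z) (b x) < e"
        using b[OF x(1)] unfolding x(2)[symmetric] Lim_within .
      then obtain d where d0: "d > 0"
        "\<forall>z\<in>{z. Im z > 0}. 0 < dist z z0 \<and> dist z z0 < d \<longrightarrow> dist (f z) (b x) < e / 2"
        using half_gt_zero[OF e] by blast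
      have d: "d > 0" "\<And>z. Im z > 0 \<Longrightarrow> dist z z0 < d \<Longrightarrow> dist (f z) (b x) < e / 2"
        using d0 False by force+
      have "dist (?g z) (?g z0) < e" if z: "z \<in> ?S" "dist z z0 < d" for z
      proof (cases "Im z > 0")
        case True
        then show ?thesis using d(2)[of z] z e False by (simp add: x_def)
      next
        case nz: False
        then have zr: "Re z > 0" "z = of_real (Re z)" using z by (auto simp: complex_eq_iff)
        let ?F = "at z within {z. Im z > 0}"
        have "\<forall>\<^sub>F v in ?F. dist v z0 < d"
          using z(2) by (intro order_tendstoD(2)[OF tendsto_dist[OF tendsto_ident_at tendsto_const]])
        moreover have "\<forall>\<^sub>F v in ?F. Im v > 0" by (simp add: eventually_at_filter)
        ultimately have "\<forall>\<^sub>F v in ?F. dist (f v) (b x) \<le> e / 2"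
          by eventually_elim (use d(2) in \<open>force intro: less_imp_le\<close>)
        moreover have "(f \<longlongrightarrow> b (Re z)) ?F" using b[OF zr(1)] zr(2) by simp
        moreover have "?F \<noteq> bot" using at_upper_half_plane_nontrivial[of "Re z"] zr(2) by simp
        ultimately have "dist (b (Re z)) (b x) \<le> e / 2"
          using tendsto_upperbound[OF tendsto_dist[OF _ tendsto_const]] by blast
        then show ?thesis using nz False e by (simp add: x_def)
      qed
      then show "\<exists>d>0. \<forall>z\<in>?S. dist z z0 < d \<longrightarrow> dist (?g z) (?g z0) < e" using d(1) by blast
    qed
  qed
qed

lemma (in prob_space) finite_heavy_points:
  assumes "c > 0" "\<And>a. {a} \<in> events"
  shows "finite {a. prob {a} \<ge> c}"
proof (rule ccontr)
  assume inf: "infinite {a. prob {a} \<ge> c}"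
  obtain n :: nat where n: "1 / c < real n" using reals_Archimedean2 by blast
  obtain F where F: "finite F" "card F = n" "F \<subseteq> {a. prob {a} \<ge> c}"
    using infinite_arbitrarily_large[OF inf] by blast
  have "real n * c = (\<Sum>a\<in>F. c)" using F by simp
  also have "\<dots> \<le> (\<Sum>a\<in>F. prob {a})" using F by (intro sum_mono) auto
  also have "\<dots> = prob F" using F assms(2) by (intro finite_measure_eq_sum_singleton[symmetric]) auto
  also have "\<dots> \<le> 1" by simp
  finally show False using n assms(1) by (simp add: field_simps)
qed

text \<open>Powers of the real number \<open>u - y\<close> are real, so imaginary parts may be taken
  coefficientwise in the Taylor series of \<open>K\<close>.\<close>

lemma real_analytic_at_Im:
  assumes K: "K holomorphic_on ball (of_real y) r" "r > 0"
    and f: "\<And>u. \<bar>u - y\<bar> < r \<Longrightarrow> f u = Im (K (of_real u))"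
  shows "real_analytic_at f y"
  unfolding real_analytic_at_def
proof (intro exI conjI allI impI)
  let ?a = "\<lambda>n. (deriv ^^ n) K (of_real y) / fact n"
  fix u assume u: "\<bar>u - y\<bar> < r"
  then have "complex_of_real u \<in> ball (of_real y) r"
    by (simp add: dist_real_def abs_minus_commute)
  then have "(\<lambda>n. ?a n * (of_real u - of_real y) ^ n) sums K (of_real u)"
    by (rule holomorphic_power_series[OF K(1)])
  then have "(\<lambda>n. Im (?a n * of_real ((u - y) ^ n))) sums Im (K (of_real u))"
    by (intro sums_Im) simp
  then show "(\<lambda>n. Im (?a n) * (u - y) ^ n) sums f u"
    using f[OF u] by (simp only: times_complex.sel Im_complex_of_real Re_complex_of_real) simp
qed (rule K(2))

lemma Ln_upper_half_plane:
  assumes "Im z > 0"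
  shows "0 < Im (Ln z)" "Im (Ln z) < pi" "z \<noteq> 0"
  using assms Im_Ln_pos_lt_imp by (auto simp: complex_eq_iff)

lemma exp_in_upper_half_plane:
  assumes "0 < Im v" "Im v < pi"
  shows "Im (exp v) > 0" "Ln (exp v) = v"
  using assms by (auto simp: Im_exp sin_gt_zero)

section \<open>The subordination function as a fixed point\<close>

locale free_power = mu: nonneg_law \<mu> + nu: nonneg_law \<nu> for \<mu> \<nu> +
  fixes t :: real
  assumes t: "t > 1"
    and Sigma_eq: "\<forall>\<^sub>F z in at_left 0. Sigma_transform \<nu> z = Sigma_transform \<mu> z powr t"
begin

text \<open>Both the exponent of eta in the fixed-point equation and the critical mass
  \<open>(t - 1) / t\<close>.\<close>

definition "c = 1 - 1 / t"

lemma c: "0 < c" "c < 1" "1 / t = 1 - c" "1 / t > 0" "c + 1 / t = 1"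
  using t by (auto simp: c_def)

text \<open>A convex combination of angles, with weights \<open>1 / t\<close> and \<open>c\<close>.
  Allowing \<open>b = 0\<close> covers the boundary points \<open>x > 0\<close>, where
  \<open>\<zeta> = ln x\<close> is real.\<close>

lemma mix_bounds:
  assumes "0 < a" "a < pi" "0 \<le> b" "b < pi"
  shows "0 < b / t + c * a" "b / t + c * a < pi"
proof -
  have "c * a > 0" "b / t \<ge> 0" using c assms t by auto
  then show "0 < b / t + c * a" by simp
  have "c * a < c * pi" "b / t \<le> pi / t" using c assms t by (auto simp: divide_right_mono)
  moreover have "c * pi + pi / t = pi" by (simp add: c_def algebra_simps)
  ultimately show "b / t + c * a < pi" by linarith
qed

text \<open>
  The subordination function; the exponent avoids any discussion of branches, since on the upper
  half-plane \<open>Im (Ln z)\<close> and \<open>Im (Ln (\<eta> z))\<close> both lie in \<open>(0, \<pi>)\<close>.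
\<close>

definition om :: "complex \<Rightarrow> complex" where
  "om z = exp (Ln z / of_real t + of_real c * Ln (eta_transform \<nu> z))"

text \<open>
  For \<open>\<zeta> = Ln z\<close> this self-map of the upper half-plane has \<open>om z\<close> as its only fixed point.
\<close>

definition T :: "complex \<Rightarrow> complex \<Rightarrow> complex" where
  "T \<zeta> w = exp (\<zeta> / of_real t + of_real c * Ln (eta_transform \<mu> w))"

lemma Ln_T:
  assumes "0 \<le> Im \<zeta>" "Im \<zeta> < pi" "Im w > 0"
  shows "Ln (T \<zeta> w) = \<zeta> / of_real t + of_real c * Ln (eta_transform \<mu> w)" "Im (T \<zeta> w) > 0"
  using exp_in_upper_half_plane[of "\<zeta> / of_real t + of_real c * Ln (eta_transform \<mu> w)"]
    mix_bounds[OF Ln_upper_half_plane(1,2)[OF mu.eta_Im_pos[OF assms(3)]] assms(1,2)]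
  by (auto simp: T_def)

lemma Ln_om:
  assumes "Im z > 0"
  shows "Ln (om z) = Ln z / of_real t + of_real c * Ln (eta_transform \<nu> z)" "Im (om z) > 0"
  using exp_in_upper_half_plane[of "Ln z / of_real t + of_real c * Ln (eta_transform \<nu> z)"]
    mix_bounds[OF Ln_upper_half_plane(1,2)[OF nu.eta_Im_pos[OF assms]]
      less_imp_le[OF Ln_upper_half_plane(1)[OF assms]] Ln_upper_half_plane(2)[OF assms]]
  by (auto simp: om_def)

lemma slit_uminus: "- z \<notin> \<real>\<^sub>\<le>\<^sub>0" if "z \<in> slit_plane"
  using that by (auto simp: slit_plane_iff complex_nonpos_Reals_iff)

text \<open>The weights \<open>1 / t\<close> and \<open>c\<close> add up to \<open>1\<close>, which
  turns the product of powers into the usual formula for the subordination function, with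
  \<open>y\<close> the value of eta at \<open>x\<close> and a positive power.\<close>

lemma sub_neg_axis:
  assumes "x < 0" "y < 0"
  shows "- exp (Ln (- of_real x) / of_real t + of_real c * Ln (- of_real y))
    = of_real (y * (x / y) powr (1 / t))"
proof -
  have "(- x) powr (1 / t) = (x / y) powr (1 / t) * (- y) powr (1 / t)"
    using powr_mult[of "x / y" "- y" "1 / t"] assms by (simp add: divide_nonpos_nonpos)
  then have "(- x) powr (1 / t) * (- y) powr c = (x / y) powr (1 / t) * ((- y) powr c * (- y) powr (1 / t))"
    by (simp only: mult_ac)
  then have "y * (x / y) powr (1 / t) = - ((- x) powr (1 / t) * (- y) powr c)"
    using assms c(5) by (simp flip: powr_add)
  moreover have "Ln (- of_real x) = of_real (ln (- x))" "Ln (- of_real y) = of_real (ln (- y))"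
    using assms Ln_of_real[of "- x"] Ln_of_real[of "- y"] by simp_all
  then have "exp (Ln (- of_real x) / of_real t + of_real c * Ln (- of_real y))
      = complex_of_real (exp (ln (- x) / t + c * ln (- y)))"
    by (simp flip: exp_of_real)
  moreover have "exp (ln (- x) / t + c * ln (- y)) = (- x) powr (1 / t) * (- y) powr c"
    using assms by (simp add: powr_def exp_add)
  ultimately show ?thesis by simp
qed

text \<open>
  The \<open>\<Sigma>\<close>-transforms only give the identity on a piece of the negative axis; with \<open>Ln (- z)\<close> in place
  of \<open>Ln z\<close> the function \<open>om\<close> extends analytically across it.
\<close>

lemma subordination:
  assumes "Im z > 0"
  shows "eta_transform \<mu> (om z) = eta_transform \<nu> z"
proof -
  define om' where "om' z = - exp (Ln (- z) / of_real t + of_real c * Ln (- eta_transform \<nu> z))" for z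
  have hol': "om' holomorphic_on slit_plane"
    unfolding om'_def using slit_uminus nu.eta_slit t
    by (intro holomorphic_intros nu.eta_holomorphic) auto
  \<comment> \<open>The angles of \<open>- z\<close> and of minus eta are both less than
    \<open>pi\<close> in absolute value, hence so is their weighted mean; a value of
    \<open>om'\<close> on the nonnegative axis would give \<open>exp ?v\<close> the angle
    \<open>pi\<close>.\<close>
  have slit': "om' z \<in> slit_plane" if z: "z \<in> slit_plane" for z
  proof (rule ccontr)
    let ?v = "Ln (- z) / of_real t + of_real c * Ln (- eta_transform \<nu> z)"
    assume *: "om' z \<notin> slit_plane"
    have nz: "- z \<noteq> 0" "- eta_transform \<nu> z \<noteq> 0"
      using z nu.eta_slit[OF z] by (auto simp: slit_plane_def)
    have "\<bar>Im (Ln (- z))\<bar> < pi" "\<bar>Im (Ln (- eta_transform \<nu> z))\<bar> < pi"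
      using slit_uminus[OF z] slit_uminus[OF nu.eta_slit[OF z]]
        mpi_less_Im_Ln[of "- z"] mpi_less_Im_Ln[of "- eta_transform \<nu> z"] nz
        Im_Ln_less_pi[of "- z"] Im_Ln_less_pi[of "- eta_transform \<nu> z"]
      by (simp_all add: abs_less_iff)
    then have "\<bar>Im (Ln (- z)) / t\<bar> < pi / t" "\<bar>c * Im (Ln (- eta_transform \<nu> z))\<bar> < c * pi"
      using t c by (auto simp: abs_mult divide_strict_right_mono)
    moreover have "c * pi + pi / t = pi" by (simp add: c_def algebra_simps)
    moreover have "Im ?v = Im (Ln (- z)) / t + c * Im (Ln (- eta_transform \<nu> z))" by simp
    ultimately have "\<bar>Im ?v\<bar> < pi" by linarith
    then have "Ln (exp ?v) = ?v" by (intro Ln_exp) auto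
    moreover have "Im (exp ?v) = 0 \<and> Re (exp ?v) \<le> 0"
      using * by (auto simp: om'_def slit_plane_iff)
    then have "Im (exp ?v) = 0 \<and> Re (exp ?v) < 0"
      using exp_not_eq_zero[of ?v] by (metis complex_eq_iff less_eq_real_def zero_complex.sel)
    then have "Im (Ln (exp ?v)) = pi"
      using Im_Ln_eq_pi[OF exp_not_eq_zero[of ?v]] by blast
    ultimately show False using \<open>\<bar>Im ?v\<bar> < pi\<close> by simp
  qed
  have "\<exists>a<0. \<forall>z>a. z < 0 \<longrightarrow> Sigma_transform \<nu> z = Sigma_transform \<mu> z powr t"
    using Sigma_eq by (simp add: eventually_at_left_field)
  then obtain a where a: "a < 0" "\<And>z. a < z \<Longrightarrow> z < 0 \<Longrightarrow> Sigma_transform \<nu> z = Sigma_transform \<mu> z powr t"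
    by blast
  \<comment> \<open>Arguments in \<open>(a', 0)\<close> satisfy the Sigma identity and are values of
    \<open>eta_transform \<mu>\<close> on \<open>(-1, 0)\<close>. Halving a negative number puts
    \<open>a''\<close> strictly closer to \<open>0\<close>.\<close>
  define a' where "a' = max a (Re (eta_transform \<mu> (of_real (- 1))))"
  define a'' where "a'' = max a' (Re (eta_transform \<nu> (of_real (- 1)))) / 2"
  have em: "Re (eta_transform \<mu> (of_real (- 1))) < 0" "Re (eta_transform \<nu> (of_real (- 1))) < 0"
    using mu.eta_neg(2)[of "- 1"] nu.eta_neg(2)[of "- 1"] by auto
  have a': "a' < 0" using a em by (simp add: a'_def)
  have a'': "a'' < 0" "a' < a''" "Re (eta_transform \<nu> (of_real (- 1))) < a''"
    using a' em by (auto simp: a''_def)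
  obtain x0 where x0: "-1 < x0" "x0 < 0" "Re (eta_transform \<nu> (of_real x0)) = a''"
    using nu.eta_range[of "- 1" a''] a'' by auto
  have on_axis: "eta_transform \<mu> (om' (of_real x)) = eta_transform \<nu> (of_real x)"
    if x: "x0 < x" "x < 0" for x
  proof -
    define y where "y = Re (eta_transform \<nu> (of_real x))"
    have "a'' < y" using nu.eta_strict_mono[OF x] x0 by (simp add: y_def)
    then have y: "a' < y" "y < 0" using a'' nu.eta_neg(2)[OF x(2)] by (auto simp: y_def)
    then obtain u where u: "u < 0" "Re (eta_transform \<mu> (of_real u)) = y"
      using mu.eta_range[of "- 1" y] by (auto simp: a'_def)
    have "x / y = (u / y) powr t"
      using a(2)[of y] y nu.Sigma_transform_eta[OF x(2) y_def[symmetric]] mu.Sigma_transform_eta[OF u]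
      by (simp add: a'_def)
    then have "(x / y) powr (1 / t) = u / y"
      using u y t by (simp add: powr_powr divide_neg_neg)
    then have "u = y * (x / y) powr (1 / t)" using y by simp
    moreover have ey: "eta_transform \<nu> (of_real x) = of_real y"
      unfolding y_def nu.eta_neg(1)[OF x(2)] by simp
    ultimately have "om' (of_real x) = of_real u"
      using sub_neg_axis[OF x(2) y(2)] by (simp add: om'_def)
    moreover have "eta_transform \<mu> (of_real u) = of_real y"
      unfolding u(2)[symmetric] mu.eta_neg(1)[OF u(1)] by simp
    ultimately show ?thesis using ey by simp
  qed
  \<comment> \<open>The identity theorem on the connected slit plane, starting from a segment of the
    negative axis.\<close>
  have "eta_transform \<mu> (om' z) - eta_transform \<nu> z = 0"
  proof (rule analytic_continuation[where S = slit_plane and U = "complex_of_real ` {x0<..<0}"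
        and \<xi> = "of_real (x0 / 2)" and f = "\<lambda>z. eta_transform \<mu> (om' z) - eta_transform \<nu> z"])
    have "(eta_transform \<mu> \<circ> om') holomorphic_on slit_plane"
      by (rule holomorphic_on_compose_gen[OF hol' mu.eta_holomorphic]) (use slit' in auto)
    then show "(\<lambda>z. eta_transform \<mu> (om' z) - eta_transform \<nu> z) holomorphic_on slit_plane"
      by (intro holomorphic_on_diff nu.eta_holomorphic) (simp add: o_def)
    show "complex_of_real (x0 / 2) islimpt complex_of_real ` {x0<..<0}"
      unfolding islimpt_approachable
    proof (intro allI impI)
      fix e :: real assume e: "e > 0"
      define x where "x = x0 / 2 + min (e / 2) (- x0 / 4)"
      have d: "0 < min (e / 2) (- x0 / 4)" "min (e / 2) (- x0 / 4) < e" "min (e / 2) (- x0 / 4) \<le> - x0 / 4"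
        using e x0 by auto
      then have "x \<in> {x0<..<0}" "x \<noteq> x0 / 2" using x0 by (auto simp: x_def)
      moreover have "dist (complex_of_real x) (of_real (x0 / 2)) < e"
        unfolding dist_of_real using d by (simp add: x_def dist_real_def)
      ultimately show "\<exists>x'\<in>complex_of_real ` {x0<..<0}. x' \<noteq> of_real (x0 / 2) \<and> dist x' (of_real (x0 / 2)) < e"
        by (intro bexI[of _ "of_real x"]) (auto simp del: of_real_divide)
    qed
  qed (use open_slit_plane connected_slit_plane x0 on_axis assms in \<open>auto simp: slit_plane_iff\<close>)
  \<comment> \<open>Each \<open>Ln (- v)\<close> is \<open>Ln v - \<i> * pi\<close>; as the weights
    add up to \<open>1\<close>, the total factor is \<open>exp (- \<i> * pi) = - 1\<close>, which
    cancels the sign in \<open>om'\<close>.\<close>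
  moreover have "om' z = om z"
  proof -
    have e: "Im (eta_transform \<nu> z) > 0" by (rule nu.eta_Im_pos[OF assms])
    have L: "Ln (- v) = Ln v - \<i> * pi" if "Im v > 0" for v
      using that by (subst Ln_minus) auto
    have "Ln (- z) / of_real t + of_real c * Ln (- eta_transform \<nu> z)
        = Ln z / of_real t + of_real c * Ln (eta_transform \<nu> z) - \<i> * pi * of_real (c + 1 / t)"
      unfolding L[OF assms] L[OF e] using t by (simp add: field_simps)
    then show ?thesis unfolding om'_def om_def c(5) by (simp add: exp_diff)
  qed
  ultimately show ?thesis by simp
qed

lemma om_fixed_point: "T (Ln z) (om z) = om z" if "Im z > 0"
  unfolding T_def subordination[OF that] by (simp add: om_def)

lemma T_holomorphic:
  "T \<zeta> holomorphic_on {w. Im w > 0}"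
proof -
  have *: "eta_transform \<mu> holomorphic_on {w. Im w > 0}"
    using mu.eta_holomorphic by (rule holomorphic_on_subset) (auto simp: slit_plane_iff)
  have "eta_transform \<mu> w \<notin> \<real>\<^sub>\<le>\<^sub>0" if "Im w > 0" for w
    using mu.eta_Im_pos[OF that] by (auto simp: complex_nonpos_Reals_iff)
  then show ?thesis unfolding T_def[abs_def]
    using t by (intro holomorphic_intros *) auto
qed

text \<open>All values of \<open>T \<zeta>\<close> have argument below \<open>\<theta> < pi\<close>,
  so a point with argument halfway between \<open>\<theta>\<close> and \<open>pi\<close> is
  moved.\<close>

lemma T_not_id:
  assumes "0 \<le> Im \<zeta>" "Im \<zeta> < pi"
  shows "\<exists>w. Im w > 0 \<and> T \<zeta> w \<noteq> w"
proof -
  define \<theta> where "\<theta> = Im \<zeta> / t + c * pi"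
  have \<theta>: "0 < \<theta>" "\<theta> < pi"
  proof -
    have "Im \<zeta> / t < pi / t" "Im \<zeta> / t \<ge> 0" using assms t by (auto simp: divide_strict_right_mono)
    moreover have "c * pi + pi / t = pi" by (simp add: c_def algebra_simps)
    moreover have "c * pi > 0" using c by simp
    ultimately show "0 < \<theta>" "\<theta> < pi" by (auto simp: \<theta>_def)
  qed
  define w where "w = exp (\<i> * of_real ((\<theta> + pi) / 2))"
  have w: "Im w > 0" "Ln w = \<i> * of_real ((\<theta> + pi) / 2)"
    using exp_in_upper_half_plane[of "\<i> * of_real ((\<theta> + pi) / 2)"] \<theta> by (auto simp: w_def)
  have "Im (Ln (T \<zeta> w)) < \<theta>"
    unfolding Ln_T(1)[OF assms w(1)] \<theta>_def using c Ln_upper_half_plane(2)[OF mu.eta_Im_pos[OF w(1)]]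
    by simp
  moreover have "Im (Ln w) > \<theta>" unfolding w(2) using \<theta> by simp
  ultimately show ?thesis using w(1) by (intro exI[of _ w]) auto
qed

lemma fixed_point_unique:
  assumes "0 \<le> Im \<zeta>" "Im \<zeta> < pi" "Im u > 0" "Im v > 0" "T \<zeta> u = u" "T \<zeta> v = v"
  shows "u = v"
  using half_plane_map_eq_id[OF T_holomorphic Ln_T(2)[OF assms(1,2)] assms(3,5)] assms T_not_id[OF assms(1,2)]
  by metis

lemma deriv_T_fixed_point:
  assumes "0 \<le> Im \<zeta>" "Im \<zeta> < pi" "Im u > 0" "T \<zeta> u = u"
  shows "deriv (T \<zeta>) u \<noteq> 1"
  using half_plane_map_eq_id[OF T_holomorphic Ln_T(2)[OF assms(1,2)] assms(3,4)] T_not_id[OF assms(1,2)]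
  by metis

text \<open>With the fixed point \<open>om z\<close> as base point, the factor
  \<open>Im (om z)\<close> cancels; what remains survives in the limit even if \<open>om z\<close>
  tends to the real axis.\<close>

lemma Schwarz_Pick_om:
  assumes "Im z > 0" "Im w > 0"
  shows "(cmod (T (Ln z) w - om z))\<^sup>2 * Im w \<le> (cmod (w - om z))\<^sup>2 * Im (T (Ln z) w)"
proof -
  have L: "0 \<le> Im (Ln z)" "Im (Ln z) < pi" using Ln_upper_half_plane[OF assms(1)] by auto
  have "(cmod (T (Ln z) w - om z))\<^sup>2 * Im w * Im (om z) \<le> (cmod (w - om z))\<^sup>2 * Im (T (Ln z) w) * Im (om z)"
    using Schwarz_Pick_upper_half_plane[OF T_holomorphic Ln_T(2)[OF L] Ln_om(2)[OF assms(1)] assms(2)]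
    by (simp add: om_fixed_point[OF assms(1)])
  then show ?thesis using Ln_om(2)[OF assms(1)] by (simp only: mult_le_cancel_right)
qed

section \<open>Boundary values\<close>

text \<open>
  The invariant-horoball condition of \<open>Denjoy_Wolff_unique\<close>, that is, \<open>q\<close> is the Denjoy-Wolff point of the
  map belonging to the boundary point \<open>x\<close>.
\<close>

definition attracting :: "real \<Rightarrow> complex \<Rightarrow> bool" where
  "attracting x q \<longleftrightarrow> Im q \<ge> 0 \<and> (\<forall>w. Im w > 0 \<longrightarrow>
     (cmod (T (of_real (ln x)) w - q))\<^sup>2 * Im w \<le> (cmod (w - q))\<^sup>2 * Im (T (of_real (ln x)) w))"

lemma T_real_pos: "Im w > 0 \<Longrightarrow> Im (T (of_real r) w) > 0"
  by (rule Ln_T(2)) auto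

lemma attracting_unique:
  assumes "attracting x a" "attracting x b"
  shows "a = b"
  using Denjoy_Wolff_unique[OF T_holomorphic T_real_pos T_not_id, of "of_real (ln x)" a b] assms
  by (auto simp: attracting_def)

lemma cmod_T: "cmod (T (of_real (ln x)) w) = x powr (1 / t) * cmod (eta_transform \<mu> w) powr c"
  if "Im w > 0" "x > 0"
proof -
  have "eta_transform \<mu> w \<noteq> 0" using mu.eta_Im_pos[OF that(1)] by auto
  then show ?thesis using that unfolding T_def norm_exp_eq_Re by (simp add: powr_def exp_add)
qed

text \<open>The point \<open>q + \<i> y\<close> is the top of the horoball of diameter
  \<open>y\<close> at \<open>q\<close>; its image stays in this horoball, all of whose points are
  within \<open>y\<close> of \<open>q\<close>.\<close>

lemma attracting_real_close:
assumes q: "attracting x q" and Imq: "Im q = 0" and y: "y > 0"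
shows "cmod (T (of_real (ln x)) (q + \<i> * of_real y) - q) \<le> y"
proof -
  let ?T = "T (of_real (ln x))"
  let ?w = "q + \<i> * of_real y"
  have w: "Im ?w > 0" using y Imq by simp
  have "(cmod (?T ?w - q))\<^sup>2 * Im ?w \<le> (cmod (?w - q))\<^sup>2 * Im (?T ?w)"
    using q w unfolding attracting_def by blast
  then have "(cmod (?T ?w - q))\<^sup>2 * y \<le> y\<^sup>2 * Im (?T ?w)" using Imq y by (simp add: norm_mult)
  also have "\<dots> \<le> y\<^sup>2 * cmod (?T ?w - q)"
    using abs_Im_le_cmod[of "?T ?w - q"] Imq by (intro mult_left_mono) auto
  finally have "(cmod (?T ?w - q) * y) * cmod (?T ?w - q) \<le> (cmod (?T ?w - q) * y) * y"
    by (simp add: power2_eq_square mult_ac)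
  then show ?thesis using y by (cases "?T ?w = q") (auto simp: mult_le_cancel_left)
qed

text \<open>If \<open>q = 0\<close>, the image of \<open>\<i> * y\<close> has modulus at most
  \<open>y\<close>, but for small \<open>y\<close> it has at least the order of
  \<open>y powr c\<close>. A negative \<open>q\<close> would be a limit of values of
  \<open>T\<close>, whose arguments are at most \<open>c * pi < pi\<close>.\<close>

lemma attracting_slit:
  assumes x: "x > 0" and q: "attracting x q"
  shows "q \<notin> \<real>\<^sub>\<le>\<^sub>0"
proof
  assume "q \<in> \<real>\<^sub>\<le>\<^sub>0"
  then have Imq: "Im q = 0" and Req: "Re q \<le> 0" by (auto simp: complex_nonpos_Reals_iff)
  let ?T = "T (of_real (ln x))"
  note close = attracting_real_close[OF q Imq]
  show False
  proof (cases "q = 0")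
    case True
    obtain c0 where c0: "c0 > 0" "\<And>y. 0 < y \<Longrightarrow> y \<le> 1 \<Longrightarrow> c0 * y \<le> cmod (eta_transform \<mu> (\<i> * of_real y))"
      using mu.eta_imaginary_axis by metis
    define K where "K = x powr (1 / t) * c0 powr c"
    have K: "K > 0" using x c0 by (simp add: K_def)
    \<comment> \<open>Chosen so that \<open>y powr (1 / t) \<le> K / 2\<close>, against the bound
      \<open>K \<le> y powr (1 / t)\<close> derived below.\<close>
    define y where "y = min 1 ((K / 2) powr t)"
    have y: "0 < y" "y \<le> 1" using K by (auto simp: y_def)
    have "K * y powr c = x powr (1 / t) * (c0 * y) powr c"
      using c0 y by (simp add: K_def powr_mult)
    also have "\<dots> \<le> x powr (1 / t) * cmod (eta_transform \<mu> (\<i> * of_real y)) powr c"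
      using c0 y c by (intro mult_left_mono powr_mono2) auto
    also have "\<dots> = cmod (?T (\<i> * of_real y))" using cmod_T[of "\<i> * of_real y" x] y x by simp
    also have "\<dots> \<le> y" using close[OF y(1)] True by simp
    also have "y = y powr (1 / t) * y powr c" using y c(5) by (simp flip: powr_add add: add.commute)
    finally have "K \<le> y powr (1 / t)" using y by simp
    also have "\<dots> \<le> ((K / 2) powr t) powr (1 / t)" using y t by (intro powr_mono2) (auto simp: y_def)
    also have "\<dots> = K / 2" using K t by (simp add: powr_powr)
    finally show False using K by simp
  next
    case False
    define w where "w n = q + \<i> * of_real (1 / real (Suc n))" for n
    have w: "Im (w n) > 0" for n using Imq by (simp add: w_def)
    have inv: "(\<lambda>n. 1 / real (Suc n)) \<longlonglongrightarrow> 0" by (rule LIMSEQ_inverse_real_of_nat[unfolded inverse_eq_divide])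
    have bd: "\<forall>n. norm (?T (w n) - q) \<le> 1 / real (Suc n)" using close by (simp add: w_def del: of_nat_Suc of_real_divide)
    have "(\<lambda>n. ?T (w n) - q) \<longlonglongrightarrow> 0" by (rule Lim_null_comparison[OF always_eventually[OF bd] inv])
    \<comment> \<open>Signs are reversed because \<open>q\<close> lies on the branch cut of
      \<open>Ln\<close>, while \<open>- q\<close> does not.\<close>
    then have lim: "(\<lambda>n. - ?T (w n)) \<longlonglongrightarrow> - q" by (intro tendsto_minus) (rule LIM_zero_cancel)
    have nq: "- q \<notin> \<real>\<^sub>\<le>\<^sub>0" using Imq Req False by (auto simp: complex_nonpos_Reals_iff complex_eq_iff)
    then have L: "(\<lambda>n. Im (Ln (- ?T (w n)))) \<longlonglongrightarrow> Im (Ln (- q))" by (intro tendsto_intros lim)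
    have q0: "Im (Ln (- q)) = 0"
      using Imq Req False nq by (subst Im_Ln_eq_0) (auto simp: complex_eq_iff)
    have bound: "Im (Ln (- ?T (w n))) \<le> c * pi - pi" for n
    proof -
      have Tn: "Im (?T (w n)) > 0" by (rule T_real_pos[OF w])
      then have "Im (Ln (- ?T (w n))) = Im (Ln (?T (w n))) - pi" by (subst Ln_minus) auto
      also have "Im (Ln (?T (w n))) = c * Im (Ln (eta_transform \<mu> (w n)))"
        using Ln_T(1)[of "of_real (ln x)" "w n"] w by simp
      also have "\<dots> \<le> c * pi" using c Ln_upper_half_plane(2)[OF mu.eta_Im_pos[OF w[of n]]] by simp
      finally show ?thesis by simp
    qed
    have "Im (Ln (- q)) \<le> c * pi - pi"
      by (rule LIMSEQ_le_const2[OF L]) (use bound in blast)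
    then have "0 \<le> c * pi - pi" unfolding q0 .
    then show False using c(2) by simp
  qed
qed

lemma T_Ln_tendsto:
  assumes "x > 0"
  shows "((\<lambda>z. T (Ln z) w) \<longlongrightarrow> T (of_real (ln x)) w) (at (of_real x) within A)"
proof -
  have "isCont (\<lambda>z. T (Ln z) w) (of_real x)"
    unfolding T_def using assms t by (intro continuous_intros) auto
  then have "((\<lambda>z. T (Ln z) w) \<longlongrightarrow> T (Ln (of_real x)) w) (at (of_real x) within A)"
    using continuous_at_imp_continuous_at_within continuous_within by blast
  then show ?thesis using assms by (simp add: Ln_of_real)
qed

text \<open>High up on the imaginary axis \<open>T\<close> lowers the modulus, since it grows at
  most like \<open>y powr c\<close>. For very large \<open>om z\<close> the Schwarz-Pick inequality
  at such a point \<open>w\<close> would compare nearly equal distances and force the image to have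
  almost the height of \<open>w\<close>.\<close>

lemma om_eventually_bounded:
  assumes x: "x > 0"
  obtains R where "\<forall>\<^sub>F z in at (of_real x) within {z. Im z > 0}. cmod (om z) \<le> R"
proof -
  let ?T = "T (of_real (ln x))" and ?F = "at (complex_of_real x) within {z. Im z > 0}"
  obtain c0 where c0: "c0 > 0" "\<And>y. y \<ge> 1 \<Longrightarrow> cmod (eta_transform \<mu> (\<i> * of_real y)) \<le> 1 + y / c0"
    using mu.eta_imaginary_axis by metis
  define K where "K = x powr (1 / t) * (1 + 1 / c0) powr c"
  have "1 + 1 / c0 > 0" using c0(1) by (simp add: add_pos_pos)
  then have K: "K > 0" using x by (simp add: K_def)
  \<comment> \<open>Large enough for \<open>(K + 1) * y powr c \<le> y\<close>.\<close>
  define y where "y = max 1 ((K + 1) powr t)"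
  have y: "y \<ge> 1" "y > 0" by (auto simp: y_def)
  define w where "w = \<i> * complex_of_real y"
  have w: "Im w = y" "cmod w = y" using y by (auto simp: w_def norm_mult)
  have "1 + y / c0 \<le> (1 + 1 / c0) * y" using y by (simp add: algebra_simps)
  then have "cmod (eta_transform \<mu> w) powr c \<le> ((1 + 1 / c0) * y) powr c"
    using c0(2)[OF y(1)] c unfolding w_def by (intro powr_mono2) auto
  then have "cmod (?T w) \<le> x powr (1 / t) * ((1 + 1 / c0) * y) powr c"
    using cmod_T[of w x] w y x by (simp add: mult_left_mono)
  also have "\<dots> = K * y powr c" using c0 y by (simp add: K_def powr_mult)
  also have "\<dots> < (K + 1) * y powr c" using y by simp
  also have "(K + 1) = ((K + 1) powr t) powr (1 / t)" using K t by (simp add: powr_powr)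
  also have "\<dots> * y powr c \<le> y powr (1 / t) * y powr c"
    using K t by (intro mult_right_mono powr_mono2) (auto simp: y_def)
  also have "\<dots> = y" using y c(5) by (simp flip: powr_add add: add.commute)
  finally have Tw: "cmod (?T w) < y" .
  define \<tau> where "\<tau> = (cmod (?T w) + y) / 2"
  have \<tau>: "cmod (?T w) < \<tau>" "\<tau> < y" using Tw by (auto simp: \<tau>_def)
  have \<tau>0: "\<tau> > 0" using \<tau> norm_ge_zero[of "?T w"] by linarith
  have "((\<lambda>z. cmod (T (Ln z) w)) \<longlongrightarrow> cmod (?T w)) ?F" by (intro tendsto_norm T_Ln_tendsto x)
  then have ev: "\<forall>\<^sub>F z in ?F. cmod (T (Ln z) w) < \<tau>" by (rule order_tendstoD) (use \<tau> in auto)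
  have ev2: "\<forall>\<^sub>F z in ?F. Im z > 0" by (simp add: eventually_at_filter)
  \<comment> \<open>The fraction solves \<open>(r - \<tau>) * sqrt y = (r + y) * sqrt \<tau>\<close>
    for \<open>r\<close>; adding \<open>\<tau>\<close> also covers moduli up to
    \<open>\<tau>\<close>.\<close>
  define R where "R = \<tau> + (\<tau> * sqrt y + y * sqrt \<tau>) / (sqrt y - sqrt \<tau>)"
  have d: "sqrt y - sqrt \<tau> > 0" using \<tau> by simp
  have R\<tau>: "\<tau> \<le> R" using d \<tau>0 y by (simp add: R_def)
  have "\<forall>\<^sub>F z in ?F. cmod (om z) \<le> R"
    using ev ev2
  proof eventually_elim
    case (elim z)
    let ?r = "cmod (om z)"
    show ?case
    proof (cases "?r \<le> \<tau>")
      case True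
      then show ?thesis using R\<tau> by simp
    next
      case False
      have "(?r - \<tau>)\<^sup>2 \<le> (cmod (T (Ln z) w - om z))\<^sup>2"
        using False elim norm_triangle_ineq2[of "om z" "T (Ln z) w"]
        by (intro power_mono) (auto simp: norm_minus_commute)
      then have "(?r - \<tau>)\<^sup>2 * y \<le> (cmod (T (Ln z) w - om z))\<^sup>2 * Im w" using w y by simp
      also have "\<dots> \<le> (cmod (w - om z))\<^sup>2 * Im (T (Ln z) w)"
        using Schwarz_Pick_om[of z w] elim w y by simp
      also have "\<dots> \<le> (?r + y)\<^sup>2 * \<tau>"
        using Ln_T(2)[of "Ln z" w] Ln_upper_half_plane[OF elim(2)] y norm_triangle_ineq4[of w "om z"] w elim abs_Im_le_cmod[of "T (Ln z) w"] \<tau>0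
        by (intro mult_mono power_mono) auto
      finally have "((?r - \<tau>) * sqrt y)\<^sup>2 \<le> ((?r + y) * sqrt \<tau>)\<^sup>2"
        using y \<tau>0 by (simp add: power_mult_distrib)
      then have "(?r - \<tau>) * sqrt y \<le> (?r + y) * sqrt \<tau>"
        by (rule power2_le_imp_le) (use y \<tau>0 in auto)
      then have "?r * (sqrt y - sqrt \<tau>) \<le> \<tau> * sqrt y + y * sqrt \<tau>" by (simp add: algebra_simps)
      then have "?r \<le> (\<tau> * sqrt y + y * sqrt \<tau>) / (sqrt y - sqrt \<tau>)" using d by (simp add: pos_le_divide_eq)
      then show ?thesis using \<tau>0 by (simp add: R_def)
    qed
  qed
  then show thesis by (rule that)
qed

lemma attracting_cluster:
  assumes x: "x > 0" and Z: "Z \<longlonglongrightarrow> of_real x" "\<And>n. Im (Z n) > 0"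
    and lim: "(\<lambda>n. om (Z n)) \<longlonglongrightarrow> q"
  shows "attracting x q"
  unfolding attracting_def
proof (intro conjI allI impI)
  have "(\<lambda>n. Im (om (Z n))) \<longlonglongrightarrow> Im q" by (intro tendsto_intros lim)
  then show "Im q \<ge> 0"
    by (rule LIMSEQ_le_const) (use Ln_om(2)[OF Z(2)] in \<open>auto intro: less_imp_le\<close>)
  fix w assume w: "Im w > 0"
  have "isCont (\<lambda>z. T (Ln z) w) (of_real x)"
    using T_Ln_tendsto[OF x, of w UNIV] x by (simp add: isCont_def Ln_of_real)
  then have Tlim: "(\<lambda>n. T (Ln (Z n)) w) \<longlonglongrightarrow> T (of_real (ln x)) w"
    using isCont_tendsto_compose[OF _ Z(1)] x by (force simp: Ln_of_real)
  show "(cmod (T (of_real (ln x)) w - q))\<^sup>2 * Im w \<le> (cmod (w - q))\<^sup>2 * Im (T (of_real (ln x)) w)"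
  proof (rule LIMSEQ_le)
    show "(\<lambda>n. (cmod (T (Ln (Z n)) w - om (Z n)))\<^sup>2 * Im w) \<longlonglongrightarrow> (cmod (T (of_real (ln x)) w - q))\<^sup>2 * Im w"
      by (intro tendsto_intros Tlim lim)
    show "(\<lambda>n. (cmod (w - om (Z n)))\<^sup>2 * Im (T (Ln (Z n)) w)) \<longlonglongrightarrow> (cmod (w - q))\<^sup>2 * Im (T (of_real (ln x)) w)"
      by (intro tendsto_intros Tlim lim)
    show "\<exists>N. \<forall>n\<ge>N. (cmod (T (Ln (Z n)) w - om (Z n)))\<^sup>2 * Im w \<le> (cmod (w - om (Z n)))\<^sup>2 * Im (T (Ln (Z n)) w)"
      using Schwarz_Pick_om[OF Z(2) w] by blast
  qed
qed

lemma om_cluster_subsequence: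
  assumes x: "x > 0" and Z: "Z \<longlonglongrightarrow> of_real x" "\<And>n. Im (Z n) > 0" "\<And>n. cmod (om (Z n)) \<le> R"
  obtains r q where "strict_mono r" "(\<lambda>n. om (Z (r n))) \<longlonglongrightarrow> q" "attracting x q"
proof -
  have "bounded (range (\<lambda>n. om (Z n)))" using Z(3) by (auto simp: bounded_iff)
  then obtain q r where r: "strict_mono r" "((\<lambda>n. om (Z n)) \<circ> r) \<longlonglongrightarrow> q"
    using bounded_imp_convergent_subsequence by blast
  have "(\<lambda>n. Z (r n)) \<longlonglongrightarrow> of_real x"
    using LIMSEQ_subseq_LIMSEQ[OF Z(1) r(1)] by (simp add: o_def)
  then have "attracting x q"
    using attracting_cluster[OF x, of "\<lambda>n. Z (r n)" q] Z(2) r(2) by (simp add: o_def)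
  then show thesis using that r by (simp add: o_def)
qed

text \<open>Near \<open>x\<close> the function \<open>om\<close> is bounded, and every cluster value
  is attracting, hence the same point.\<close>

lemma om_tendsto:
  assumes x: "x > 0"
  obtains q where "attracting x q" "(om \<longlongrightarrow> q) (at (of_real x) within {z. Im z > 0})"
proof -
  let ?F = "at (complex_of_real x) within {z. Im z > 0}"
  obtain R where R: "\<forall>\<^sub>F z in ?F. cmod (om z) \<le> R" using om_eventually_bounded[OF x] .
  obtain Z where Z: "Z \<longlonglongrightarrow> of_real x" "\<forall>n. Im (Z n) > 0 \<and> cmod (om (Z n)) \<le> R"
    using frequently_upper_sequence[OF eventually_frequently[OF at_upper_half_plane_nontrivial R]] .
  have Zn: "\<And>n. Im (Z n) > 0" "\<And>n. cmod (om (Z n)) \<le> R" using Z(2) by auto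
  obtain r :: "nat \<Rightarrow> nat" and q where "strict_mono r" "(\<lambda>n. om (Z (r n))) \<longlonglongrightarrow> q" and q: "attracting x q"
    by (rule om_cluster_subsequence[OF x Z(1) Zn])
  have "(om \<longlongrightarrow> q) ?F"
  proof (rule ccontr)
    assume "\<not> (om \<longlongrightarrow> q) ?F"
    then obtain e where e: "e > 0" "\<exists>\<^sub>F z in ?F. \<not> dist (om z) q < e"
      by (auto simp: tendsto_iff not_eventually)
    obtain Y where Y: "Y \<longlonglongrightarrow> of_real x" "\<forall>n. Im (Y n) > 0 \<and> \<not> dist (om (Y n)) q < e \<and> cmod (om (Y n)) \<le> R"
      by (rule frequently_upper_sequence[OF frequently_eventually_conj[OF e(2) R]]) blast
    have Yn: "\<And>n. Im (Y n) > 0" "\<And>n. cmod (om (Y n)) \<le> R" using Y(2) by auto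
    obtain r :: "nat \<Rightarrow> nat" and q' where r: "strict_mono r" "(\<lambda>n. om (Y (r n))) \<longlonglongrightarrow> q'" "attracting x q'"
      by (rule om_cluster_subsequence[OF x Y(1) Yn])
    have "q' = q" using attracting_unique r(3) q by blast
    then have "\<forall>\<^sub>F n in sequentially. dist (om (Y (r n))) q < e" using tendstoD[OF r(2) e(1)] by simp
    then show False using Y(2) by (auto simp: eventually_sequentially)
  qed
  with q show thesis by (rule that)
qed

text \<open>Characterised by the Denjoy-Wolff property instead of a limit, so that exhibiting an
  attracting point identifies the value.\<close>

definition om_bd :: "real \<Rightarrow> complex" where
  "om_bd x = (THE q. attracting x q)"

lemma om_bd_eq: "attracting x q \<Longrightarrow> om_bd x = q"
  unfolding om_bd_def using attracting_unique by blast

lemma om_bd: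
  assumes "x > 0"
  shows "attracting x (om_bd x)" "(om \<longlongrightarrow> om_bd x) (at (of_real x) within {z. Im z > 0})"
  using om_tendsto[OF assms] om_bd_eq by metis+

text \<open>
  \<^const>\<open>om_bd\<close> is the boundary value of \<^const>\<open>om\<close>, and solving the definition of \<^const>\<open>om\<close> for
  \<open>Ln (\<eta> z)\<close> gives the boundary value of the latter.
\<close>

definition log_eta_bd :: "real \<Rightarrow> complex" where
  "log_eta_bd x = (Ln (om_bd x) - of_real (ln x) / of_real t) / of_real c"

text \<open>The imaginary part of the logarithm is tracked because the range \<open>[0, pi]\<close>
  lets one recover \<open>log_eta_bd x = 0\<close> from
  \<open>eta_boundary \<nu> x = 1\<close>.\<close>

lemma eta_boundary_limit:
  assumes x: "x > 0"
  shows "(eta_transform \<nu> \<longlongrightarrow> exp (log_eta_bd x)) (at (of_real x) within {z. Im z > 0})"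
    "eta_boundary \<nu> x = exp (log_eta_bd x)"
    "0 \<le> Im (log_eta_bd x)" "Im (log_eta_bd x) \<le> pi"
proof -
  let ?F = "at (complex_of_real x) within {z. Im z > 0}"
  have ev: "\<forall>\<^sub>F z in ?F. Im z > 0" by (simp add: eventually_at_filter)
  have cx: "((\<lambda>z. Ln z) \<longlongrightarrow> of_real (ln x)) ?F"
    using tendsto_Ln[OF tendsto_ident_at, of "of_real x" "{z. Im z > 0}"] x by (simp add: Ln_of_real)
  have lim: "((\<lambda>z. (Ln (om z) - Ln z / of_real t) / of_real c) \<longlongrightarrow> log_eta_bd x) ?F"
    unfolding log_eta_bd_def
    using attracting_slit[OF x om_bd(1)[OF x]] c t
    by (intro tendsto_intros om_bd(2)[OF x] cx) auto
  have eq: "\<forall>\<^sub>F z in ?F. (Ln (om z) - Ln z / of_real t) / of_real c = Ln (eta_transform \<nu> z)"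
    using ev by eventually_elim (use c in \<open>simp add: Ln_om(1)\<close>)
  have limL: "((\<lambda>z. Ln (eta_transform \<nu> z)) \<longlongrightarrow> log_eta_bd x) ?F"
    using Lim_transform_eventually[OF lim eq] .
  have "\<forall>\<^sub>F z in ?F. exp (Ln (eta_transform \<nu> z)) = eta_transform \<nu> z"
    using ev
  proof eventually_elim
    case (elim z)
    then show ?case using nu.eta_Im_pos[OF elim] by (intro exp_Ln) auto
  qed
  then show l: "(eta_transform \<nu> \<longlongrightarrow> exp (log_eta_bd x)) ?F"
    using Lim_transform_eventually[OF tendsto_exp[OF limL]] by blast
  show "eta_boundary \<nu> x = exp (log_eta_bd x)"
    unfolding eta_boundary_def by (rule tendsto_Lim[OF at_upper_half_plane_nontrivial l])
  have b: "\<forall>\<^sub>F z in ?F. 0 \<le> Im (Ln (eta_transform \<nu> z)) \<and> Im (Ln (eta_transform \<nu> z)) \<le> pi"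
    using ev by eventually_elim (use Ln_upper_half_plane nu.eta_Im_pos in \<open>force intro: less_imp_le\<close>)
  show "0 \<le> Im (log_eta_bd x)"
    by (rule tendsto_lowerbound[OF tendsto_Im[OF limL] _ at_upper_half_plane_nontrivial])
      (use b in \<open>auto elim: eventually_mono\<close>)
  show "Im (log_eta_bd x) \<le> pi"
    by (rule tendsto_upperbound[OF tendsto_Im[OF limL] _ at_upper_half_plane_nontrivial])
      (use b in \<open>auto elim: eventually_mono\<close>)
qed

lemma eta_boundary_eq_1_iff:
  assumes x: "x > 0"
  shows "eta_boundary \<nu> x = 1 \<longleftrightarrow> om_bd x = of_real (x powr (1 / t))"
proof
  assume "eta_boundary \<nu> x = 1"
  then obtain n :: int where n: "Re (log_eta_bd x) = 0" "Im (log_eta_bd x) = of_int (2 * n) * pi"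
    using eta_boundary_limit(2)[OF x] by (metis exp_eq_1)
  have "0 \<le> real_of_int (2 * n) * pi" "real_of_int (2 * n) * pi \<le> 1 * pi"
    using eta_boundary_limit(3,4)[OF x] n by auto
  then have "0 \<le> real_of_int (2 * n)" "real_of_int (2 * n) \<le> 1"
    using pi_gt_zero by (simp_all add: zero_le_mult_iff mult_le_cancel_right)
  then have "n = 0" by linarith
  then have "log_eta_bd x = 0" using n by (simp add: complex_eq_iff)
  then have "Ln (om_bd x) = of_real (ln x / t)" using c by (simp add: log_eta_bd_def)
  moreover have "om_bd x \<noteq> 0" using attracting_slit[OF x om_bd(1)[OF x]] by auto
  ultimately have "om_bd x = exp (of_real (ln x / t))" by (metis exp_Ln)
  then show "om_bd x = of_real (x powr (1 / t))" using x by (simp add: powr_def flip: exp_of_real)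
next
  assume "om_bd x = of_real (x powr (1 / t))"
  then have "Ln (om_bd x) = of_real (ln x / t)"
    using x by (simp add: Ln_of_real ln_powr del: of_real_divide)
  then have "log_eta_bd x = 0" by (simp add: log_eta_bd_def)
  then show "eta_boundary \<nu> x = 1" using eta_boundary_limit(2)[OF x] by simp
qed

section \<open>Atoms\<close>

text \<open>Increments for the vertical, hence nontangential, approach to a real point.\<close>

definition step :: "nat \<Rightarrow> complex" where
  "step n = \<i> * of_real (1 / real (Suc n))"

lemma step: "step n \<noteq> 0" "Im (step n) = 1 / real (Suc n)" "Im (step n) > 0" "Re (step n) = 0"
  "cmod (step n) = 1 / real (Suc n)" "step \<longlonglongrightarrow> 0"
proof -
  have "(\<lambda>n. 1 / real (Suc n)) \<longlonglongrightarrow> 0" by (rule LIMSEQ_inverse_real_of_nat[unfolded inverse_eq_divide])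
  then have "(\<lambda>n. \<i> * complex_of_real (1 / real (Suc n))) \<longlonglongrightarrow> \<i> * complex_of_real 0"
    by (intro tendsto_intros)
  then show "step \<longlonglongrightarrow> 0" by (simp add: step_def[abs_def])
  show "cmod (step n) = 1 / real (Suc n)"
    unfolding step_def norm_mult norm_of_real by (simp del: of_nat_Suc)
qed (auto simp: step_def complex_eq_iff simp del: of_nat_Suc)

lemma quotient_step_Im: "Im (v / step n) = - Re v * real (Suc n)" "Re (v / step n) = Im v * real (Suc n)"
  by (auto simp: step_def Im_divide Re_divide power2_eq_square simp del: of_nat_Suc)

lemma mass_along_step:
  assumes p: "p > 0"
  shows "(\<lambda>n. (- step n / of_real p) / (1 - eta_transform \<mu> (of_real p + step n)))
    \<longlonglongrightarrow> of_real (measure \<mu> {1 / p})"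
proof -
  have "(\<lambda>n. of_real p + step n) \<longlonglongrightarrow> of_real p + 0" by (intro tendsto_intros step)
  then have "(\<lambda>n. (1 - (of_real p + step n) / of_real p) * resolvent_mean \<mu> (of_real p + step n))
      \<longlonglongrightarrow> of_real (measure \<mu> {1 / p})"
    by (intro mu.atom_mass_limit[OF p, where C = 1]) (auto simp: step(2,5) simp del: of_nat_Suc)
  moreover have "(1 - (of_real p + step n) / of_real p) * resolvent_mean \<mu> (of_real p + step n)
      = (- step n / of_real p) / (1 - eta_transform \<mu> (of_real p + step n))" for n
  proof -
    have "of_real p + step n \<in> slit_plane" using step(3)[of n] by (simp add: slit_plane_iff)
    then show ?thesis using p by (simp add: mu.eta_transform_eq field_simps)
  qed
  ultimately show ?thesis by simp
qed

text \<open>Inverting the limit for the mass gives the angular derivative of eta at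
  \<open>p\<close>, namely \<open>1 / (p * m)\<close> for an atom at \<open>1 / p\<close> of mass
  \<open>m > 0\<close>.\<close>

lemma eta_along_step:
  assumes p: "p > 0" and m: "measure \<mu> {1 / p} > 0"
  shows "(\<lambda>n. eta_transform \<mu> (of_real p + step n)) \<longlonglongrightarrow> 1"
    "(\<lambda>n. (eta_transform \<mu> (of_real p + step n) - 1) / step n) \<longlonglongrightarrow> of_real (1 / (p * measure \<mu> {1 / p}))"
proof -
  let ?\<eta> = "\<lambda>n. eta_transform \<mu> (of_real p + step n)"
  have "(\<lambda>n. 1 / ((- step n / of_real p) / (1 - ?\<eta> n)) / of_real p) \<longlonglongrightarrow> 1 / of_real (measure \<mu> {1 / p}) / of_real p"
    using m p by (intro tendsto_divide tendsto_const mass_along_step) auto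
  moreover have "1 / ((- step n / of_real p) / (1 - ?\<eta> n)) / of_real p = (?\<eta> n - 1) / step n" for n
    using step(1)[of n] p by (simp add: divide_simps)
  ultimately show l: "(\<lambda>n. (?\<eta> n - 1) / step n) \<longlonglongrightarrow> of_real (1 / (p * measure \<mu> {1 / p}))"
    by (simp add: mult.commute)
  have "(\<lambda>n. (?\<eta> n - 1) / step n * step n + 1) \<longlonglongrightarrow> of_real (1 / (p * measure \<mu> {1 / p})) * 0 + 1"
    by (intro tendsto_intros l step)
  then show "?\<eta> \<longlonglongrightarrow> 1" using step(1) by simp
qed

lemma Ln_root: "x > 0 \<Longrightarrow> Ln (of_real (x powr (1 / t))) = of_real (ln x) / of_real t"
  by (simp add: Ln_of_real ln_powr)

lemma one_over_root: "x > 0 \<Longrightarrow> 1 / (x powr (1 / t)) = x powr (- 1 / t)"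
  by (simp add: powr_minus_divide)

text \<open>Julia's lemma: in the Schwarz-Pick inequality the base point \<open>w' n\<close> tends
  vertically to \<open>p\<close>, and the ratio of the imaginary parts of its image and of
  \<open>w' n\<close> tends to the angular derivative \<open>c / m\<close>, which is at most
  \<open>1\<close>.\<close>

lemma attracting_root_if:
  assumes x: "x > 0" and m: "measure \<mu> {x powr (- 1 / t)} \<ge> c"
  shows "attracting x (of_real (x powr (1 / t)))"
  unfolding attracting_def
proof (intro conjI allI impI)
  define p where "p = x powr (1 / t)"
  have p: "p > 0" using x by (simp add: p_def)
  define m where "m = measure \<mu> {1 / p}"
  have mc: "m \<ge> c" using assms by (simp add: m_def p_def one_over_root)
  then have m0: "m > 0" using c by simp
  let ?T = "T (of_real (ln x))"
  fix w assume w: "Im w > 0"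
  define w' where "w' n = of_real p + step n" for n
  have w': "Im (w' n) > 0" for n using step(3) by (simp add: w'_def)
  have w'lim: "w' \<longlonglongrightarrow> of_real p + 0" unfolding w'_def by (intro tendsto_intros step)
  \<comment> \<open>The outer function of \<open>T\<close>, with derivative \<open>p * c\<close> at
    \<open>1\<close>; the chain rule multiplies this with the derivative \<open>1 / (p * m)\<close>
    of eta.\<close>
  define F where "F v = exp (of_real (ln x) / of_real t + of_real c * Ln v)" for v
  have FT: "F (eta_transform \<mu> v) = ?T v" for v by (simp add: F_def T_def)
  have F1: "F 1 = of_real p"
    using Ln_root[OF x] p by (simp add: F_def p_def exp_Ln flip: Ln_root[OF x])
  have dF: "(F has_field_derivative F 1 * of_real c) (at 1)"
    unfolding F_def by (auto intro!: derivative_eq_intros)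
  note e = eta_along_step[OF p m0[unfolded m_def], folded m_def w'_def]
  have "(\<lambda>n. (?T (w' n) - of_real p) / step n) \<longlonglongrightarrow> of_real p * of_real c * of_real (1 / (p * m))"
    using DERIV_difference_quotient_tendsto[OF dF e] unfolding FT F1 .
  then have q: "(\<lambda>n. (?T (w' n) - of_real p) / step n) \<longlonglongrightarrow> of_real (c / m)" using p by simp
  then have "(\<lambda>n. Re ((?T (w' n) - of_real p) / step n)) \<longlonglongrightarrow> Re (of_real (c / m))" by (rule tendsto_Re)
  then have ImT: "(\<lambda>n. Im (?T (w' n)) * real (Suc n)) \<longlonglongrightarrow> c / m"
    unfolding quotient_step_Im by simp
  have "(\<lambda>n. (?T (w' n) - of_real p) / step n * step n + of_real p) \<longlonglongrightarrow> of_real (c / m) * 0 + of_real p"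
    by (intro tendsto_intros q step)
  then have Tlim: "(\<lambda>n. ?T (w' n)) \<longlonglongrightarrow> of_real p" using step(1) by simp
  have "(cmod (?T w - of_real p))\<^sup>2 * Im w \<le> (cmod (w - of_real p))\<^sup>2 * Im (?T w) * (c / m)"
  proof (rule LIMSEQ_le)
    show "(\<lambda>n. (cmod (?T w - ?T (w' n)))\<^sup>2 * Im w) \<longlonglongrightarrow> (cmod (?T w - of_real p))\<^sup>2 * Im w"
      by (intro tendsto_intros Tlim)
    show "(\<lambda>n. (cmod (w - w' n))\<^sup>2 * Im (?T w) * (Im (?T (w' n)) * real (Suc n)))
        \<longlonglongrightarrow> (cmod (w - of_real p))\<^sup>2 * Im (?T w) * (c / m)"
      using w'lim by (intro tendsto_intros ImT) simp
    have "(cmod (?T w - ?T (w' n)))\<^sup>2 * Im w \<le> (cmod (w - w' n))\<^sup>2 * Im (?T w) * (Im (?T (w' n)) * real (Suc n))" for n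
    proof -
      have "Im (w' n) = 1 / real (Suc n)" by (simp add: w'_def step(2) del: of_nat_Suc)
      then show ?thesis
        using Schwarz_Pick_upper_half_plane[OF T_holomorphic T_real_pos w'[of n] w, of "ln x"]
        by (simp add: pos_divide_le_eq mult.assoc del: of_nat_Suc)
    qed
    then show "\<exists>N. \<forall>n\<ge>N. (cmod (?T w - ?T (w' n)))\<^sup>2 * Im w \<le> (cmod (w - w' n))\<^sup>2 * Im (?T w) * (Im (?T (w' n)) * real (Suc n))"
      by blast
  qed
  also have "\<dots> \<le> (cmod (w - of_real p))\<^sup>2 * Im (?T w)"
    using mc m0 T_real_pos[OF w, of "ln x"] by (intro mult_left_le) auto
  finally show "(cmod (?T w - of_real (x powr (1 / t))))\<^sup>2 * Im w
      \<le> (cmod (w - of_real (x powr (1 / t))))\<^sup>2 * Im (?T w)" by (simp add: p_def)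
qed simp

text \<open>The image of \<open>w' n\<close> is within \<open>cmod (step n)\<close> of
  \<open>p\<close>, so eta cannot leave \<open>1\<close> faster than the inverse of the outer
  function of \<open>T\<close> allows. As the speed of eta is governed by the mass, this bounds the
  mass from below.\<close>

lemma mass_if_attracting_root:
  assumes x: "x > 0" and q: "attracting x (of_real (x powr (1 / t)))"
  shows "measure \<mu> {x powr (- 1 / t)} \<ge> c"
proof -
  define p where "p = x powr (1 / t)"
  have p: "p > 0" using x by (simp add: p_def)
  define m where "m = measure \<mu> {1 / p}"
  let ?T = "T (of_real (ln x))"
  define w' where "w' n = of_real p + step n" for n
  have w': "Im (w' n) > 0" for n using step(3) by (simp add: w'_def)
  have close: "cmod (?T (w' n) - of_real p) \<le> cmod (step n)" for n
    using attracting_real_close[OF q, of "1 / real (Suc n)"]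
    by (simp add: p_def w'_def step_def norm_mult del: of_nat_Suc of_real_divide)
  have "(\<lambda>n. cmod (step n)) \<longlonglongrightarrow> 0" using step(6) by (rule tendsto_norm_zero)
  then have "(\<lambda>n. ?T (w' n) - of_real p) \<longlonglongrightarrow> 0"
    by (rule Lim_null_comparison[OF always_eventually[rule_format], OF close])
  then have Tlim: "(\<lambda>n. ?T (w' n)) \<longlonglongrightarrow> of_real p" by (rule LIM_zero_cancel)
  \<comment> \<open>Recovers eta from the value of \<open>T\<close>; the derivative at
    \<open>p\<close> is \<open>1 / (p * c)\<close>.\<close>
  define g where "g v = exp ((Ln v - of_real (ln x) / of_real t) / of_real c)" for v
  have g1: "g (of_real p) = 1" using Ln_root[OF x] by (simp add: g_def p_def)
  have gT: "g (?T (w' n)) = eta_transform \<mu> (w' n)" for n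
  proof -
    have "eta_transform \<mu> (w' n) \<noteq> 0" using mu.eta_Im_pos[OF w', of n] by auto
    then show ?thesis unfolding g_def using Ln_T(1)[of "of_real (ln x)" "w' n"] w'[of n] c
      by simp
  qed
  have "(g has_field_derivative g (of_real p) * (1 / of_real p / of_real c)) (at (of_real p))"
    unfolding g_def using p c by (auto intro!: derivative_eq_intros simp: divide_inverse mult_ac)
  then obtain G where G: "\<And>z. g z - g (of_real p) = G z * (z - of_real p)" "isCont G (of_real p)"
      "G (of_real p) = of_real (1 / (p * c))"
    unfolding CARAT_DERIV g1 by (auto simp: mult.commute)
  define A where "A n = (- step n / of_real p) / (1 - eta_transform \<mu> (w' n))" for n
  have Alim: "A \<longlonglongrightarrow> of_real m" using mass_along_step[OF p] by (simp add: A_def[abs_def] w'_def m_def)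
  have le: "1 / p \<le> cmod (A n) * cmod (G (?T (w' n)))" for n
  proof -
    have "1 - eta_transform \<mu> (w' n) \<noteq> 0" using mu.eta_Im_pos[OF w', of n] by (auto simp: complex_eq_iff)
    then have "- step n / of_real p = A n * (1 - eta_transform \<mu> (w' n))" by (simp add: A_def)
    then have "cmod (step n) / p = cmod (A n) * cmod (eta_transform \<mu> (w' n) - 1)"
      using p by (metis norm_mult norm_divide norm_minus_cancel norm_minus_commute norm_of_real abs_of_pos)
    also have "\<dots> = cmod (A n) * (cmod (G (?T (w' n))) * cmod (?T (w' n) - of_real p))"
      using G(1)[of "?T (w' n)"] by (simp add: gT g1 norm_mult)
    also have "\<dots> \<le> cmod (A n) * (cmod (G (?T (w' n))) * cmod (step n))"
      using close by (intro mult_left_mono) auto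
    finally have "(1 / p) * cmod (step n) \<le> (cmod (A n) * cmod (G (?T (w' n)))) * cmod (step n)" by simp
    then show ?thesis using step(1)[of n] by (simp only: mult_le_cancel_right) auto
  qed
  have "(\<lambda>n. cmod (A n) * cmod (G (?T (w' n)))) \<longlonglongrightarrow> cmod (of_real m) * cmod (G (of_real p))"
    by (intro tendsto_intros Alim isCont_tendsto_compose[OF G(2)] Tlim)
  then have "1 / p \<le> cmod (of_real m) * cmod (G (of_real p))"
    by (rule LIMSEQ_le_const) (use le in blast)
  moreover have "m \<ge> 0" by (simp add: m_def)
  ultimately have "1 / p \<le> m * (1 / (p * c))"
    unfolding G(3) norm_of_real using p c by simp
  then have "c \<le> m" using p c by (simp add: field_simps)
  then show ?thesis using x by (simp add: m_def p_def one_over_root)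
qed

lemma eta_boundary_eq_1_iff_mass:
  assumes "x > 0"
  shows "eta_boundary \<nu> x = 1 \<longleftrightarrow> measure \<mu> {x powr (- 1 / t)} \<ge> c"
  unfolding eta_boundary_eq_1_iff[OF assms]
  using attracting_root_if[OF assms] mass_if_attracting_root[OF assms] om_bd(1)[OF assms] om_bd_eq
  by metis

text \<open>The points \<open>Z n\<close> are built so that \<open>om (Z n)\<close> runs down the
  vertical line to \<open>p\<close>. Along them the eta of \<open>\<nu>\<close> equals the eta of
  \<open>\<mu>\<close> on that line, and the two speeds of approach give the mass as
  \<open>\<kappa> * p * m\<close>.\<close>

lemma atom_mass:
  assumes x: "x > 0" and m: "measure \<mu> {x powr (- 1 / t)} > c"
  shows "measure \<nu> {1 / x} = t * measure \<mu> {x powr (- 1 / t)} - (t - 1)"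
proof -
  define p where "p = x powr (1 / t)"
  have p: "p > 0" using x by (simp add: p_def)
  define m where "m = measure \<mu> {1 / p}"
  have mc: "m > c" using assms by (simp add: m_def p_def one_over_root)
  then have m0: "m > 0" using c by simp
  have tc: "t * c = t - 1" using t by (simp add: c_def field_simps)
  define w' where "w' n = of_real p + step n" for n
  have w': "Im (w' n) > 0" for n using step(3) by (simp add: w'_def)
  have w'lim: "w' \<longlonglongrightarrow> of_real p" unfolding w'_def using tendsto_add[OF tendsto_const step(6)] by fastforce
  note e = eta_along_step[OF p m0[unfolded m_def], folded m_def w'_def]
  \<comment> \<open>The limit of the difference quotients of \<open>H\<close> below; it is positive
    since \<open>m\<close> exceeds \<open>c\<close>.\<close>
  define \<kappa> where "\<kappa> = (t - (t - 1) / m) / p"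
  have "t * m > t * c" using mc t by simp
  then have \<kappa>: "\<kappa> > 0" unfolding \<kappa>_def using p m0 tc by (simp add: field_simps)
  \<comment> \<open>Solves \<open>T \<zeta> (w' n) = w' n\<close> for
    \<open>\<zeta>\<close>.\<close>
  define H where "H n = of_real t * Ln (w' n) - of_real (t - 1) * Ln (eta_transform \<mu> (w' n))" for n
  have "(Ln has_field_derivative 1 / of_real p) (at (of_real p))"
    using p by (auto intro!: derivative_eq_intros simp: inverse_eq_divide)
  then have L1: "(\<lambda>n. (Ln (w' n) - Ln (of_real p)) / step n) \<longlonglongrightarrow> 1 / of_real p * 1"
    by (rule DERIV_difference_quotient_tendsto[OF _ w'lim]) (simp add: w'_def step(1))
  have "(Ln has_field_derivative 1) (at 1)" by (auto intro!: derivative_eq_intros)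
  then have L2: "(\<lambda>n. (Ln (eta_transform \<mu> (w' n)) - Ln 1) / step n) \<longlonglongrightarrow> 1 * of_real (1 / (p * m))"
    by (rule DERIV_difference_quotient_tendsto[OF _ e])
  have "(\<lambda>n. of_real t * ((Ln (w' n) - Ln (of_real p)) / step n)
        - of_real (t - 1) * ((Ln (eta_transform \<mu> (w' n)) - Ln 1) / step n))
      \<longlonglongrightarrow> of_real t * (1 / of_real p * 1) - of_real (t - 1) * (1 * of_real (1 / (p * m)))"
    by (intro tendsto_intros L1 L2)
  also have "of_real t * (1 / of_real p * 1) - of_real (t - 1) * (1 * of_real (1 / (p * m))) = complex_of_real \<kappa>"
    using p m0 by (simp add: \<kappa>_def diff_divide_distrib mult.commute)
  also have "(\<lambda>n. of_real t * ((Ln (w' n) - Ln (of_real p)) / step n)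
        - of_real (t - 1) * ((Ln (eta_transform \<mu> (w' n)) - Ln 1) / step n))
      = (\<lambda>n. (H n - of_real (ln x)) / step n)"
    using Ln_root[OF x] t by (simp add: H_def p_def fun_eq_iff diff_divide_distrib right_diff_distrib)
  finally have Hq: "(\<lambda>n. (H n - of_real (ln x)) / step n) \<longlonglongrightarrow> of_real \<kappa>" .
  have "(\<lambda>n. (H n - of_real (ln x)) / step n * step n + of_real (ln x)) \<longlonglongrightarrow> of_real \<kappa> * 0 + of_real (ln x)"
    by (intro tendsto_intros Hq step)
  then have Hlim: "H \<longlonglongrightarrow> of_real (ln x)" using step(1) by simp
  define Z where "Z n = exp (H n)" for n
  have ex: "exp (complex_of_real (ln x)) = of_real x" using x by (simp add: exp_of_real)
  have Zlim: "Z \<longlonglongrightarrow> of_real x" unfolding Z_def using tendsto_exp[OF Hlim] ex by simp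
  have dexp: "(exp has_field_derivative of_real x) (at (complex_of_real (ln x)))"
    using DERIV_exp[of "complex_of_real (ln x)"] unfolding ex .
  then have Zq: "(\<lambda>n. (Z n - of_real x) / step n) \<longlonglongrightarrow> of_real (x * \<kappa>)"
    using DERIV_difference_quotient_tendsto[OF dexp Hlim Hq] unfolding Z_def ex by simp
  have ev1: "\<forall>\<^sub>F n in sequentially. 0 < Im (H n)"
  proof -
    have "\<forall>\<^sub>F n in sequentially. 0 < Re ((H n - of_real (ln x)) / step n)"
      using order_tendstoD(1)[OF tendsto_Re[OF Hq]] \<kappa> by simp
    then show ?thesis unfolding quotient_step_Im by eventually_elim (auto simp: zero_less_mult_iff)
  qed
  have ev2: "\<forall>\<^sub>F n in sequentially. Im (H n) < pi"
    using order_tendstoD(2)[OF tendsto_Im[OF Hlim]] by simp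
  \<comment> \<open>The quotient of \<open>Z n - x\<close> by \<open>step n\<close> tends to
    \<open>x * \<kappa>\<close>; keeping it between one half and three halves of the limit gives the
    cone constant \<open>3\<close>.\<close>
  have ev3: "\<forall>\<^sub>F n in sequentially. Im (Z n) > 0 \<and> cmod (Z n - of_real x) \<le> 3 * Im (Z n)"
  proof -
    have xk: "x * \<kappa> > 0" using x \<kappa> by simp
    have "\<forall>\<^sub>F n in sequentially. x * \<kappa> / 2 < Re ((Z n - of_real x) / step n)"
      by (rule order_tendstoD(1)[OF tendsto_Re[OF Zq]]) (use xk in \<open>simp add: mult.commute del: of_real_mult\<close>)
    moreover have "\<forall>\<^sub>F n in sequentially. cmod ((Z n - of_real x) / step n) < 3 / 2 * (x * \<kappa>)"
    proof (rule order_tendstoD(2)[OF tendsto_norm[OF Zq]])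
      show "cmod (of_real (x * \<kappa>)) < 3 / 2 * (x * \<kappa>)"
        unfolding norm_of_real abs_of_pos[OF xk] using xk by linarith
    qed
    ultimately show ?thesis
    proof eventually_elim
      case (elim n)
      have a: "x * \<kappa> / 2 < Im (Z n) * real (Suc n)" using elim(1) unfolding quotient_step_Im by simp
      have b: "cmod (Z n - of_real x) * real (Suc n) < 3 / 2 * (x * \<kappa>)"
        using elim(2) by (simp add: norm_divide step(5) del: of_nat_Suc)
      have "0 < Im (Z n) * real (Suc n)" using a xk by linarith
      then have "Im (Z n) > 0" by (simp add: zero_less_mult_iff)
      moreover have "cmod (Z n - of_real x) * real (Suc n) \<le> (3 * Im (Z n)) * real (Suc n)"
        using a b by linarith
      then have "cmod (Z n - of_real x) \<le> 3 * Im (Z n)"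
        by (simp only: mult_le_cancel_right)
      ultimately show ?case by blast
    qed
  qed
  have "(\<lambda>n. (1 - Z n / of_real x) * resolvent_mean \<nu> (Z n)) \<longlonglongrightarrow> of_real (measure \<nu> {1 / x})"
    by (rule nu.atom_mass_limit[OF x Zlim ev3])
  moreover have "\<forall>\<^sub>F n in sequentially. (1 - Z n / of_real x) * resolvent_mean \<nu> (Z n)
      = ((Z n - of_real x) / step n / of_real x) / ((eta_transform \<mu> (w' n) - 1) / step n)"
    using ev1 ev2 ev3
  proof eventually_elim
    case (elim n)
    have LnZ: "Ln (Z n) = H n" "Im (Z n) > 0" using elim exp_in_upper_half_plane[of "H n"] by (auto simp: Z_def)
    have "H n / of_real t + of_real c * Ln (eta_transform \<mu> (w' n)) = Ln (w' n)"
      using t by (simp add: H_def c_def field_simps)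
    then have "T (H n) (w' n) = w' n" using w'[of n] unfolding T_def by (subst \<open>_ = Ln (w' n)\<close>) (auto intro: exp_Ln)
    moreover have "T (H n) (om (Z n)) = om (Z n)" using om_fixed_point[OF LnZ(2)] LnZ(1) by simp
    \<comment> \<open>Both points are fixed by \<open>T (H n)\<close>, which has only one fixed
      point in the half-plane.\<close>
    ultimately have "om (Z n) = w' n"
      using fixed_point_unique[of "H n" "om (Z n)" "w' n"] elim Ln_om(2)[OF LnZ(2)] w' by simp
    then have eta: "eta_transform \<nu> (Z n) = eta_transform \<mu> (w' n)"
      using subordination[OF LnZ(2)] by simp
    have Zs: "Z n \<in> slit_plane" using LnZ(2) by (simp add: slit_plane_iff)
    have "1 - eta_transform \<mu> (w' n) = 1 / resolvent_mean \<nu> (Z n)"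
      unfolding eta[symmetric] nu.eta_transform_eq[OF Zs] by simp
    then have *: "resolvent_mean \<nu> (Z n) = - 1 / (eta_transform \<mu> (w' n) - 1)"
      by (metis divide_divide_eq_right div_by_1 minus_diff_eq minus_divide_right mult_1 divide_minus_left)
    have cancel: "u / s / v / (b / s) = u / v / b" if "s \<noteq> 0" for u s v b :: complex
      using that by (simp add: divide_simps)
    have "1 - Z n / of_real x = - ((Z n - of_real x) / of_real x)" using x by (simp add: diff_divide_distrib)
    then show ?case unfolding * cancel[OF step(1)] by (simp only: divide_minus_left minus_mult_minus times_divide_eq_right mult_1_right)
  qed
  ultimately have "(\<lambda>n. ((Z n - of_real x) / step n / of_real x) / ((eta_transform \<mu> (w' n) - 1) / step n))
      \<longlonglongrightarrow> of_real (measure \<nu> {1 / x})"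
    by (rule Lim_transform_eventually)
  moreover have "(\<lambda>n. ((Z n - of_real x) / step n / of_real x) / ((eta_transform \<mu> (w' n) - 1) / step n))
      \<longlonglongrightarrow> (of_real (x * \<kappa>) / of_real x) / of_real (1 / (p * m))"
    using x p m0 by (intro tendsto_intros Zq e) auto
  ultimately have "complex_of_real (measure \<nu> {1 / x}) = (of_real (x * \<kappa>) / of_real x) / of_real (1 / (p * m))"
    by (rule LIMSEQ_unique)
  also have "\<dots> = of_real ((x * \<kappa> / x) / (1 / (p * m)))" by simp
  finally have "measure \<nu> {1 / x} = (x * \<kappa> / x) / (1 / (p * m))" by (simp only: of_real_eq_iff)
  also have "\<dots> = t * m - (t - 1)" unfolding \<kappa>_def using x p m0 by (simp add: field_simps)
  finally show ?thesis using x by (simp add: m_def p_def one_over_root)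
qed

section \<open>The density\<close>

lemma om_holomorphic: "om holomorphic_on {z. Im z > 0}"
proof -
  have *: "eta_transform \<nu> holomorphic_on {w. Im w > 0}"
    using nu.eta_holomorphic by (rule holomorphic_on_subset) (auto simp: slit_plane_iff)
  have "eta_transform \<nu> w \<notin> \<real>\<^sub>\<le>\<^sub>0" if "Im w > 0" for w
    using nu.eta_Im_pos[OF that] by (auto simp: complex_nonpos_Reals_iff)
  then show ?thesis unfolding om_def[abs_def]
    using t by (intro holomorphic_intros *) (auto simp: complex_nonpos_Reals_iff)
qed

lemma om_bd_isCont:
  assumes "x > 0"
  shows "isCont om_bd x"
proof -
  let ?S = "{z. Im z > 0 \<or> Im z = 0 \<and> Re z > 0}"
  have "continuous_on ?S (\<lambda>z. if Im z > 0 then om z else om_bd (Re z))"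
    by (intro continuous_on_upper_boundary om_bd(2) holomorphic_on_imp_continuous_on om_holomorphic)
  then have "continuous_on {0<..} (\<lambda>x. (\<lambda>z. if Im z > 0 then om z else om_bd (Re z)) (complex_of_real x))"
    by (rule continuous_on_compose2) (auto intro: continuous_on_of_real_id)
  then have "continuous_on {0<..} om_bd" by simp
  then show ?thesis using assms by (simp add: continuous_on_eq_continuous_at)
qed

text \<open>Inserting \<open>w = om_bd x\<close> in the attracting condition makes its right-hand
  side \<open>0\<close>, so \<open>om_bd x\<close> is a fixed point. The logarithmic form is the
  equation that is inverted locally for analyticity.\<close>

lemma interior_boundary_point:
  assumes x: "x > 0" and q: "Im (om_bd x) > 0"
  shows "T (of_real (ln x)) (om_bd x) = om_bd x" "eta_boundary \<nu> x = eta_transform \<mu> (om_bd x)"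
    "of_real t * Ln (om_bd x) - of_real (t - 1) * Ln (eta_transform \<mu> (om_bd x)) = of_real (ln x)"
proof -
  let ?T = "T (of_real (ln x))"
  have "(cmod (?T (om_bd x) - om_bd x))\<^sup>2 * Im (om_bd x) \<le> 0"
    using om_bd(1)[OF x] q unfolding attracting_def by fastforce
  then show fp: "?T (om_bd x) = om_bd x" using q by (simp add: mult_le_0_iff)
  have L: "Ln (om_bd x) = of_real (ln x) / of_real t + of_real c * Ln (eta_transform \<mu> (om_bd x))"
    using Ln_T(1)[of "of_real (ln x)" "om_bd x"] q fp by simp
  have ne: "eta_transform \<mu> (om_bd x) \<noteq> 0" using mu.eta_Im_pos[OF q] by auto
  have "log_eta_bd x = Ln (eta_transform \<mu> (om_bd x))" unfolding log_eta_bd_def L using c by simp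
  then show "eta_boundary \<nu> x = eta_transform \<mu> (om_bd x)"
    using eta_boundary_limit(2)[OF x] ne by simp
  show "of_real t * Ln (om_bd x) - of_real (t - 1) * Ln (eta_transform \<mu> (om_bd x)) = of_real (ln x)"
    unfolding L c_def using t by (simp add: field_simps)
qed

text \<open>If \<open>om_bd x\<close> is not in the open half-plane, it is a positive real number,
  so its logarithm and with it \<open>log_eta_bd x\<close> are real.\<close>

lemma boundary_cases:
  assumes x: "x > 0"
  shows "Im (eta_boundary \<nu> x) \<ge> 0" "Im (eta_boundary \<nu> x) > 0 \<Longrightarrow> Im (om_bd x) > 0"
proof -
  have "Im (om_bd x) > 0 \<Longrightarrow> Im (eta_boundary \<nu> x) > 0"
    using interior_boundary_point(2)[OF x] mu.eta_Im_pos by simp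
  moreover have "Im (eta_boundary \<nu> x) = 0" if "\<not> Im (om_bd x) > 0"
  proof -
    have "Im (om_bd x) = 0" using that om_bd(1)[OF x] by (simp add: attracting_def)
    moreover have "om_bd x \<notin> \<real>\<^sub>\<le>\<^sub>0" by (rule attracting_slit[OF x om_bd(1)[OF x]])
    ultimately have "om_bd x = of_real (Re (om_bd x))" "Re (om_bd x) > 0"
      by (auto simp: complex_eq_iff complex_nonpos_Reals_iff)
    then have "Ln (om_bd x) = of_real (ln (Re (om_bd x)))" by (metis Ln_of_real)
    then have "Im (log_eta_bd x) = 0" by (simp add: log_eta_bd_def)
    then show ?thesis using eta_boundary_limit(2)[OF x] by (simp add: Im_exp)
  qed
  ultimately show "Im (eta_boundary \<nu> x) \<ge> 0" "Im (eta_boundary \<nu> x) > 0 \<Longrightarrow> Im (om_bd x) > 0"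
    by force+
qed

text \<open>The equation \<open>H (om_bd u) = ln u\<close> determines \<open>om_bd\<close> near
  \<open>x\<close>, since at \<open>om_bd x\<close> the derivative of \<open>H\<close> is
  \<open>t * (1 - D) / om_bd x\<close> with \<open>D \<noteq> 1\<close>. The local inverse
  \<open>g\<close> yields the continuation \<open>eta_transform \<mu> (g (Ln z))\<close>.\<close>

lemma eta_boundary_analytic:
  assumes x: "x > 0" and q: "Im (om_bd x) > 0"
  obtains r h where "r > 0" "r < x" "h holomorphic_on ball (of_real x) r"
    "\<forall>z\<in>ball (of_real x) r. Im (h z) > 0"
    "\<forall>u. \<bar>u - x\<bar> < r \<longrightarrow> h (of_real u) = eta_boundary \<nu> u"
proof -
  define H where "H w = of_real t * Ln w - of_real (t - 1) * Ln (eta_transform \<mu> w)" for w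
  let ?U = "{w. Im w > 0}" and ?q = "om_bd x"
  have opU: "open ?U" by (rule open_halfspace_Im_gt)
  have heta: "eta_transform \<mu> holomorphic_on ?U"
    using mu.eta_holomorphic by (rule holomorphic_on_subset) (auto simp: slit_plane_iff)
  have nonpos: "v \<notin> \<real>\<^sub>\<le>\<^sub>0" if "Im v > 0" for v
    using that by (auto simp: complex_nonpos_Reals_iff)
  have holH: "H holomorphic_on ?U"
    unfolding H_def[abs_def] using nonpos mu.eta_Im_pos by (intro holomorphic_intros heta) auto
  have HT: "H w = of_real (ln x) + of_real t * (Ln w - Ln (T (of_real (ln x)) w))" if "Im w > 0" for w
  proof -
    have "Ln (T (of_real (ln x)) w) = of_real (ln x) / of_real t + of_real c * Ln (eta_transform \<mu> w)"
      using Ln_T(1)[of "of_real (ln x)" w] that by simp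
    then show ?thesis unfolding H_def c_def using t by (simp add: field_simps)
  qed
  have fp: "T (of_real (ln x)) ?q = ?q" by (rule interior_boundary_point(1)[OF x q])
  define D where "D = deriv (T (of_real (ln x))) ?q"
  have D1: "D \<noteq> 1" unfolding D_def by (rule deriv_T_fixed_point) (use fp q in auto)
  have dT: "(T (of_real (ln x)) has_field_derivative D) (at ?q)"
    unfolding D_def using T_holomorphic opU q by (intro holomorphic_derivI) auto
  have "((\<lambda>w. of_real (ln x) + of_real t * (Ln w - Ln (T (of_real (ln x)) w))) has_field_derivative
      of_real t * (1 / ?q - D / ?q)) (at ?q)"
    using nonpos[OF q] by (auto intro!: derivative_eq_intros dT simp: fp divide_inverse)
  then have dH: "(H has_field_derivative of_real t * (1 / ?q - D / ?q)) (at ?q)"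
    by (rule has_field_derivative_transform_within_open[OF _ opU]) (use q HT in auto)
  have "?q \<noteq> 0" using q by auto
  then have "deriv H ?q \<noteq> 0" using DERIV_imp_deriv[OF dH] D1 t by (simp flip: diff_divide_distrib)
  then obtain s where s: "s > 0" "ball ?q s \<subseteq> ?U" "inj_on H (ball ?q s)"
    using has_complex_derivative_locally_injective[OF holH _ opU] q by blast
  have holHs: "H holomorphic_on ball ?q s" using holH s(2) by (rule holomorphic_on_subset)
  obtain g where g: "g holomorphic_on H ` ball ?q s" "\<And>z. z \<in> ball ?q s \<Longrightarrow> g (H z) = z"
    using holomorphic_has_inverse[OF holHs open_ball s(3)] by metis
  have opH: "open (H ` ball ?q s)" by (rule open_mapping_thm3[OF holHs open_ball s(3)])
  have Hq: "H ?q = of_real (ln x)" unfolding H_def by (rule interior_boundary_point(3)[OF x q])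
  have contL: "isCont Ln (complex_of_real x)" using x by (intro continuous_intros) auto
  have "Ln (of_real x) = H ?q" using Hq x by (simp add: Ln_of_real)
  then have "Ln (of_real x) \<in> H ` ball ?q s" using s(1) by auto
  then obtain e where e: "e > 0" "ball (Ln (of_real x)) e \<subseteq> H ` ball ?q s"
    using opH open_contains_ball_eq by blast
  obtain r1 where r1: "r1 > 0" "\<forall>z. dist z (of_real x) < r1 \<longrightarrow> dist (Ln z) (Ln (of_real x)) < e"
    using contL e(1) unfolding continuous_at_eps_delta by blast
  have r1': "Ln z \<in> H ` ball ?q s" if "dist z (of_real x) < r1" for z
    using that r1(2) e(2) by (auto simp: dist_commute)
  \<comment> \<open>Continuity of \<open>om_bd\<close> keeps it in the ball where \<open>H\<close>
    is injective, so \<open>g\<close> at \<open>ln u\<close> is \<open>om_bd u\<close> and not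
    another solution.\<close>
  have "\<exists>r2>0. \<forall>u. dist u x < r2 \<longrightarrow> dist (om_bd u) ?q < s"
    using om_bd_isCont[OF x] s(1) unfolding continuous_at_eps_delta by blast
  then obtain r2 where r2: "r2 > 0" "\<And>u. dist u x < r2 \<Longrightarrow> dist (om_bd u) ?q < s" by blast
  define r where "r = min (x / 2) (min r1 r2)"
  have r: "r > 0" "r < x" "r \<le> r1" "r \<le> r2" using x r1 r2 by (auto simp: r_def)
  define h where "h z = eta_transform \<mu> (g (Ln z))" for z
  have inU: "Im (g (Ln z)) > 0" if "z \<in> ball (of_real x) r" for z
  proof -
    have "Ln z \<in> H ` ball ?q s" using r1'[of z] that r by (simp add: dist_commute)
    then show ?thesis using g(2) s(2) by auto
  qed
  have nonpos_ball: "z \<notin> \<real>\<^sub>\<le>\<^sub>0" if z: "z \<in> ball (complex_of_real x) r" for z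
  proof
    assume "z \<in> \<real>\<^sub>\<le>\<^sub>0"
    then have "x \<le> Re (complex_of_real x - z)" by (simp add: complex_nonpos_Reals_iff)
    also have "\<dots> \<le> cmod (complex_of_real x - z)" by (rule complex_Re_le_cmod)
    finally show False using z r by (simp add: dist_norm)
  qed
  have "(g \<circ> Ln) holomorphic_on ball (of_real x) r"
    by (rule holomorphic_on_compose_gen[OF _ g(1)])
      (use nonpos_ball r1' r in \<open>auto intro!: holomorphic_intros simp: dist_commute\<close>)
  then have "(eta_transform \<mu> \<circ> (g \<circ> Ln)) holomorphic_on ball (of_real x) r"
    by (rule holomorphic_on_compose_gen[OF _ heta]) (use inU in auto)
  then have holh: "h holomorphic_on ball (of_real x) r" by (simp add: h_def[abs_def] o_def)
  have him: "\<forall>z\<in>ball (of_real x) r. Im (h z) > 0" using inU mu.eta_Im_pos by (simp add: h_def)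
  have hu: "h (of_real u) = eta_boundary \<nu> u" if u: "\<bar>u - x\<bar> < r" for u
  proof -
    have u0: "u > 0" using u r by (simp add: abs_less_iff)
    have ball: "om_bd u \<in> ball ?q s" using r2(2)[of u] u r by (simp add: dist_real_def dist_commute)
    then have qu: "Im (om_bd u) > 0" using s(2) by auto
    have "H (om_bd u) = of_real (ln u)" unfolding H_def by (rule interior_boundary_point(3)[OF u0 qu])
    then have "g (Ln (of_real u)) = om_bd u" using g(2)[OF ball] u0 by (simp add: Ln_of_real)
    then show ?thesis using interior_boundary_point(2)[OF u0 qu] by (simp add: h_def)
  qed
  show thesis using that[OF r(1,2) holh him] hu by blast
qed

section \<open>Regular points and the Poisson integral up to the boundary\<close>

definition critical_points :: "real set" where
  "critical_points = {1 / x | x. x > 0 \<and> eta_boundary \<nu> x = 1}"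

text \<open>Each critical point is determined by an atom of \<open>\<mu>\<close> of mass at least
  \<open>c > 0\<close>, and a probability measure has only finitely many of those.\<close>

lemma finite_critical_points: "finite critical_points"
proof (rule finite_subset)
  show "critical_points \<subseteq> (\<lambda>a. 1 / (a powr (- t))) ` {a. measure \<mu> {a} \<ge> c}"
  proof
    fix y assume "y \<in> critical_points"
    then obtain x where x: "x > 0" "y = 1 / x" "eta_boundary \<nu> x = 1" by (auto simp: critical_points_def)
    have "x powr (- 1 / t) \<in> {a. measure \<mu> {a} \<ge> c}"
      using eta_boundary_eq_1_iff_mass[OF x(1)] x(3) by simp
    moreover have "(x powr (- 1 / t)) powr (- t) = x" using x t by (simp add: powr_powr)
    ultimately show "y \<in> (\<lambda>a. 1 / (a powr (- t))) ` {a. measure \<mu> {a} \<ge> c}"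
      using x(2) by (intro image_eqI[where x = "x powr (- 1 / t)"]) auto
  qed
  show "finite ((\<lambda>a. 1 / (a powr (- t))) ` {a. measure \<mu> {a} \<ge> c})"
    using mu.finite_heavy_points[OF c(1)] by simp
qed

definition regular_points :: "real set" where
  "regular_points = {0<..} - critical_points"

lemma open_regular_points: "open regular_points"
  unfolding regular_points_def using finite_critical_points by (intro open_Diff finite_imp_closed) auto

lemma regular_pointsD:
  assumes "y \<in> regular_points"
  shows "y > 0" "eta_boundary \<nu> (1 / y) \<noteq> 1"
  using assms by (auto simp: regular_points_def critical_points_def)

definition eta_ext :: "complex \<Rightarrow> complex" where
  "eta_ext z = (if Im z > 0 then eta_transform \<nu> z else eta_boundary \<nu> (Re z))"

lemma eta_ext_continuous: "continuous_on {z. Im z > 0 \<or> Im z = 0 \<and> Re z > 0} eta_ext"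
proof -
  have "eta_transform \<nu> holomorphic_on {z. Im z > 0}"
    using nu.eta_holomorphic by (rule holomorphic_on_subset) (auto simp: slit_plane_iff)
  then show ?thesis unfolding eta_ext_def
    using eta_boundary_limit(1,2)
    by (intro continuous_on_upper_boundary holomorphic_on_imp_continuous_on) auto
qed

text \<open>
  On \<open>\<epsilon> > 0\<close> this is the Poisson integral of \<open>\<nu>\<close>, written in terms of \<open>\<eta>\<close> so that it extends
  continuously to \<open>\<epsilon> = 0\<close>.
\<close>

definition P :: "real \<Rightarrow> real \<Rightarrow> real" where
  "P y \<epsilon> = (let z = 1 / Complex y (- \<epsilon>) in Im (z / (1 - eta_ext z)))"

lemma inverse_point:
  assumes "y > 0" "\<epsilon> \<ge> 0"
  shows "Im (1 / Complex y (- \<epsilon>)) = \<epsilon> / (y\<^sup>2 + \<epsilon>\<^sup>2)" "Re (1 / Complex y (- \<epsilon>)) > 0"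
    "1 / Complex y 0 = of_real (1 / y)" "Complex y (- \<epsilon>) \<noteq> 0"
proof -
  have "y\<^sup>2 + \<epsilon>\<^sup>2 > 0" using assms by (simp add: sum_power2_gt_zero_iff)
  then show "Im (1 / Complex y (- \<epsilon>)) = \<epsilon> / (y\<^sup>2 + \<epsilon>\<^sup>2)" "Re (1 / Complex y (- \<epsilon>)) > 0"
    using assms by (simp_all add: Im_divide Re_divide)
  show "1 / Complex y 0 = of_real (1 / y)" by (simp add: complex_eq_iff Im_divide Re_divide power2_eq_square)
  show "Complex y (- \<epsilon>) \<noteq> 0" using assms by (simp add: complex_eq_iff)
qed

lemma eta_ext_inverse_point_ne_1:
  assumes "y \<in> regular_points" "\<epsilon> \<ge> 0"
  shows "eta_ext (1 / Complex y (- \<epsilon>)) \<noteq> 1"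
proof (cases "\<epsilon> = 0")
  case True
  then show ?thesis
    using regular_pointsD[OF assms(1)] inverse_point(3)[OF regular_pointsD(1)[OF assms(1)], of 0]
    by (simp add: eta_ext_def)
next
  case False
  have y: "y > 0" by (rule regular_pointsD(1)[OF assms(1)])
  have "\<epsilon> / (y\<^sup>2 + \<epsilon>\<^sup>2) > 0" using False assms y by (simp add: sum_power2_gt_zero_iff)
  then have im: "Im (1 / Complex y (- \<epsilon>)) > 0" using inverse_point(1)[OF y assms(2)] by simp
  then have "Im (eta_ext (1 / Complex y (- \<epsilon>))) > 0" unfolding eta_ext_def using nu.eta_Im_pos by simp
  then show ?thesis by auto
qed

lemma P_continuous: "continuous_on (regular_points \<times> {0..1}) (\<lambda>(y, \<epsilon>). P y \<epsilon>)"
proof -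
  let ?S = "regular_points \<times> {0..1::real}" and ?z = "\<lambda>p. 1 / Complex (fst p) (- snd p)"
  have pos: "fst p > 0" "snd p \<ge> 0" "fst p \<in> regular_points" if "p \<in> ?S" for p
    using that regular_pointsD(1) by auto
  have "continuous_on ?S (\<lambda>p. Complex (fst p) (- snd p))"
    unfolding Complex_eq by (intro continuous_intros)
  then have cz: "continuous_on ?S ?z"
    using inverse_point(4) pos by (intro continuous_intros) auto
  have ce: "continuous_on ?S (\<lambda>p. eta_ext (?z p))"
  proof (rule continuous_on_compose2[OF eta_ext_continuous cz])
    show "?z ` ?S \<subseteq> {z. Im z > 0 \<or> Im z = 0 \<and> Re z > 0}"
    proof (rule image_subsetI)
      fix p assume p: "p \<in> ?S"
      have "0 \<le> snd p / ((fst p)\<^sup>2 + (snd p)\<^sup>2)" using pos(2)[OF p] by simp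
      then show "?z p \<in> {z. Im z > 0 \<or> Im z = 0 \<and> Re z > 0}"
        using inverse_point(1,2)[OF pos(1,2)[OF p]] by (metis (mono_tags, lifting) less_eq_real_def mem_Collect_eq)
    qed
  qed
  have "continuous_on ?S (\<lambda>p. Im (?z p / (1 - eta_ext (?z p))))"
    using eta_ext_inverse_point_ne_1[OF pos(3) pos(2)] by (intro continuous_intros cz ce) force
  then show ?thesis by (simp add: P_def case_prod_unfold Let_def)
qed

text \<open>The point \<open>z = 1 / (y - \<i> \<epsilon>)\<close> lies in the upper half-plane, and
  \<open>z\<close> divided by one minus eta is the Cauchy transform of \<open>\<nu>\<close> at
  \<open>y - \<i> \<epsilon>\<close>, whose imaginary part is the Poisson integral.\<close>

lemma P_eq_poisson:
  assumes y: "y > 0" and \<epsilon>: "\<epsilon> > 0"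
  shows "P y \<epsilon> = poisson \<nu> y \<epsilon>"
proof -
  define z where "z = 1 / Complex y (- \<epsilon>)"
  have im: "Im z > 0"
    using inverse_point(1)[OF y less_imp_le[OF \<epsilon>]] y \<epsilon> by (simp add: z_def sum_power2_gt_zero_iff)
  then have zs: "z \<in> slit_plane" by (simp add: slit_plane_iff)
  have ne: "Complex y (- \<epsilon>) \<noteq> 0" using y by (simp add: complex_eq_iff)
  have eq: "z * (1 / (1 - z * of_real s)) = 1 / Complex (y - s) (- \<epsilon>)" if "s \<ge> 0" for s
  proof -
    have "1 - z * of_real s = (Complex y (- \<epsilon>) - of_real s) / Complex y (- \<epsilon>)"
      using ne by (simp add: z_def diff_divide_distrib)
    moreover have "Complex y (- \<epsilon>) - of_real s = Complex (y - s) (- \<epsilon>)" by (simp add: complex_eq_iff)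
    ultimately show ?thesis using ne by (simp add: z_def)
  qed
  have "P y \<epsilon> = Im (z * resolvent_mean \<nu> z)"
    using im nu.eta_transform_eq[OF zs] by (simp add: P_def eta_ext_def Let_def flip: z_def)
  also have "z * resolvent_mean \<nu> z = (\<integral>s. z * (1 / (1 - z * of_real s)) \<partial>\<nu>)"
    unfolding resolvent_mean_def by (rule integral_mult_right_zero[symmetric])
  also have "Im \<dots> = (\<integral>s. Im (z * (1 / (1 - z * of_real s))) \<partial>\<nu>)"
    using nu.kernel_integrable[OF zs] by (intro integral_Im[symmetric] integrable_mult_right)
  also have "\<dots> = poisson \<nu> y \<epsilon>"
    unfolding poisson_def
  proof (rule integral_cong_AE)
    show "AE s in \<nu>. Im (z * (1 / (1 - z * of_real s))) = \<epsilon> / ((y - s)\<^sup>2 + \<epsilon>\<^sup>2)"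
      using nu.AE_nonneg by eventually_elim (simp only: eq, simp add: Im_divide)
  qed measurable
  finally show ?thesis .
qed

text \<open>Extension by \<open>0\<close> confines the question of analyticity at points of nonzero
  density to the regular points.\<close>

definition dens :: "real \<Rightarrow> real" where
  "dens y = (if y \<in> regular_points then P y 0 / pi else 0)"

lemma P_0: "y > 0 \<Longrightarrow> P y 0 = Im (of_real (1 / y) / (1 - eta_boundary \<nu> (1 / y)))"
  using inverse_point(3)[of y 0] by (simp add: P_def eta_ext_def Let_def)

lemma dens_nonneg: "dens y \<ge> 0"
proof (cases "y \<in> regular_points")
  case True
  have y: "y > 0" by (rule regular_pointsD(1)[OF True])
  have "Im (eta_boundary \<nu> (1 / y)) \<ge> 0" by (rule boundary_cases(1)) (use y in simp)
  then show ?thesis using True y by (simp add: dens_def P_0 Im_divide)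
qed (simp add: dens_def)

lemma dens_continuous: "continuous_on regular_points dens"
proof -
  have "continuous_on regular_points (\<lambda>y. P y 0)"
    by (intro continuous_on_compose2[OF P_continuous, where f = "\<lambda>y. (y, 0)", simplified]) (auto intro!: continuous_intros)
  then have "continuous_on regular_points (\<lambda>y. P y 0 / pi)" by (intro continuous_intros) auto
  then show ?thesis by (rule continuous_on_eq) (simp add: dens_def)
qed

lemma dens_measurable: "dens \<in> borel_measurable borel"
proof -
  have "(\<lambda>y. indicator regular_points y *\<^sub>R dens y) \<in> borel_measurable borel"
    using open_regular_points by (intro borel_measurable_continuous_on_indicator dens_continuous) auto
  also have "(\<lambda>y. indicator regular_points y *\<^sub>R dens y) = dens"
    by (auto simp: dens_def indicator_def)
  finally show ?thesis .
qed

lemma emeasure_regular: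
  assumes "A \<in> sets borel" "A \<subseteq> regular_points"
  shows "emeasure \<nu> A = emeasure (density lborel (\<lambda>y. ennreal (dens y))) A"
proof -
  have "(\<lambda>y. ennreal (P y 0 / pi) * indicator regular_points y) = (\<lambda>y. ennreal (dens y))"
    by (auto simp: dens_def indicator_def)
  then show ?thesis
    using nu.Stieltjes_density[OF open_regular_points P_continuous _ assms] P_eq_poisson regular_pointsD(1)
    by simp
qed

lemma atoms_not_regular:
  assumes "y \<in> atoms \<nu>"
  shows "y \<notin> regular_points"
proof
  assume "y \<in> regular_points"
  then have "measure \<nu> {y} = 0"
    using nu.Stieltjes_no_atom[OF open_regular_points _ P_continuous] P_eq_poisson regular_pointsD(1) by simp
  then show False using assms by (simp add: atoms_def)
qed

text \<open>In the closed half-line only the finite set of critical points and \<open>0\<close> lies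
  off the regular points. A point of this set is an atom or has measure \<open>0\<close>, so the
  nonatomic part is \<open>\<nu>\<close> restricted to the regular points.\<close>

lemma nonatomic_part_eq: "nonatomic_part \<nu> = density lborel (\<lambda>y. ennreal (dens y))"
proof (rule measure_eqI)
  show "sets (nonatomic_part \<nu>) = sets (density lborel (\<lambda>y. ennreal (dens y)))"
    by (simp add: nonatomic_part_def)
  fix A assume "A \<in> sets (nonatomic_part \<nu>)"
  then have A: "A \<in> sets borel" by (simp add: nonatomic_part_def)
  have rb: "regular_points \<in> sets borel" using open_regular_points by simp
  have atoms_sub: "atoms \<nu> \<subseteq> insert 0 critical_points"
  proof
    fix y assume y: "y \<in> atoms \<nu>"
    have "y \<ge> 0"
    proof (rule ccontr)
      assume "\<not> y \<ge> 0"
      then have "AE s in \<nu>. s \<notin> {y}" using nu.AE_nonneg by auto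
      then have "emeasure \<nu> {y} = 0" using AE_iff_measurable[of "{y}" \<nu> "\<lambda>s. s \<notin> {y}"] by auto
      then show False using y by (simp add: atoms_def measure_def)
    qed
    then show "y \<in> insert 0 critical_points" using atoms_not_regular[OF y] by (auto simp: regular_points_def)
  qed
  have fin: "finite (insert 0 critical_points)" using finite_critical_points by simp
  have ab: "- atoms \<nu> \<in> sets borel"
    using finite_subset[OF atoms_sub fin] by (intro borel_open open_Compl finite_imp_closed)
  have null: "AE s in \<nu>. s \<in> insert 0 critical_points \<longrightarrow> s \<in> atoms \<nu>"
  proof -
    let ?N = "insert 0 critical_points - atoms \<nu>"
    have fN: "finite ?N" using fin by simp
    have "measure \<nu> ?N = (\<Sum>a\<in>?N. measure \<nu> {a})"
      using fN by (intro nu.finite_measure_eq_sum_singleton) auto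
    also have "\<dots> = 0"
      by (intro sum.neutral ballI) (metis DiffD2 atoms_def linorder_not_less measure_le_0_iff mem_Collect_eq)
    finally have "emeasure \<nu> ?N = 0" by (simp add: nu.emeasure_eq_measure)
    then show ?thesis
      using fN by (intro AE_I[of _ _ ?N]) (auto intro: borel_closed finite_imp_closed)
  qed
  have "AE s in \<nu>. s \<in> - atoms \<nu> \<longleftrightarrow> s \<in> regular_points"
    using null nu.AE_nonneg
  proof eventually_elim
    case (elim s)
    then show ?case using atoms_not_regular[of s] by (cases "s = 0") (auto simp: regular_points_def)
  qed
  then have ae: "AE s in \<nu>. (indicator (- atoms \<nu>) s * indicator A s :: ennreal) = indicator (A \<inter> regular_points) s"
    by eventually_elim (auto simp: indicator_def)
  have "emeasure (nonatomic_part \<nu>) A = (\<integral>\<^sup>+s. indicator (- atoms \<nu>) s * indicator A s \<partial>\<nu>)"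
    unfolding nonatomic_part_def using A ab by (intro emeasure_density) auto
  also have "\<dots> = (\<integral>\<^sup>+s. indicator (A \<inter> regular_points) s \<partial>\<nu>)"
    using ae by (rule nn_integral_cong_AE)
  also have "\<dots> = emeasure \<nu> (A \<inter> regular_points)" using A rb by simp
  also have "\<dots> = emeasure (density lborel (\<lambda>y. ennreal (dens y))) (A \<inter> regular_points)"
    using A rb by (intro emeasure_regular) auto
  also have "\<dots> = emeasure (density lborel (\<lambda>y. ennreal (dens y))) A"
    using A rb dens_measurable
    by (simp add: emeasure_density) (intro nn_integral_cong, auto simp: indicator_def dens_def)
  finally show "emeasure (nonatomic_part \<nu>) A = emeasure (density lborel (\<lambda>y. ennreal (dens y))) A" .
qed

text \<open>A nonzero density makes the imaginary part of the boundary value of eta positive, so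
  this value continues to a holomorphic \<open>h\<close> with positive imaginary part. Hence
  \<open>1 - h\<close> has no zero, and nearby points are again regular, where \<open>dens\<close>
  is given by the same formula.\<close>

lemma dens_analytic:
  assumes "dens y \<noteq> 0"
  shows "real_analytic_at dens y"
proof -
  have yr: "y \<in> regular_points" using assms by (auto simp: dens_def split: if_splits)
  have y: "y > 0" by (rule regular_pointsD(1)[OF yr])
  have "Im (eta_boundary \<nu> (1 / y)) \<noteq> 0"
  proof
    assume "Im (eta_boundary \<nu> (1 / y)) = 0"
    then have "P y 0 = 0" using y by (simp add: P_0 Im_divide)
    then show False using assms by (simp add: dens_def split: if_splits)
  qed
  then have "Im (om_bd (1 / y)) > 0" using boundary_cases[of "1 / y"] y by simp
  then obtain r h where r: "r > 0" "r < 1 / y" and h: "h holomorphic_on ball (of_real (1 / y)) r"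
      "\<forall>z\<in>ball (of_real (1 / y)) r. Im (h z) > 0"
      "\<forall>u. \<bar>u - 1 / y\<bar> < r \<longrightarrow> h (of_real u) = eta_boundary \<nu> u"
    using eta_boundary_analytic[of "1 / y"] y by (metis divide_pos_pos zero_less_one)
  have "isCont (\<lambda>z. 1 / z) (complex_of_real y)" using y by (intro continuous_intros) auto
  then have "\<forall>e>0. \<exists>d>0. \<forall>z. dist z (complex_of_real y) < d \<longrightarrow> dist (1 / z) (1 / complex_of_real y) < e"
    unfolding continuous_at_eps_delta .
  from this[rule_format, OF r(1)]
  obtain d where d: "d > 0" "\<forall>z. dist z (complex_of_real y) < d \<longrightarrow> dist (1 / z) (1 / complex_of_real y) < r"
    by (elim exE conjE)
  define e where "e = min d y"
  have e: "e > 0" "e \<le> d" "e \<le> y" using d y by (auto simp: e_def)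
  have inr: "1 / z \<in> ball (of_real (1 / y)) r" if "z \<in> ball (complex_of_real y) e" for z
    using that d(2) e by (simp add: dist_commute)
  have nz: "z \<noteq> 0" if "z \<in> ball (complex_of_real y) e" for z
    using that e y by auto
  define K where "K z = 1 / z / (1 - h (1 / z)) / of_real pi" for z
  have ne1: "1 - h (1 / z) \<noteq> 0" if "z \<in> ball (of_real y) e" for z
    using h(2) inr[OF that] by (force simp: complex_eq_iff)
  have "(h \<circ> (\<lambda>z. 1 / z)) holomorphic_on ball (of_real y) e"
  proof (rule holomorphic_on_compose_gen[OF _ h(1)])
    show "(\<lambda>z. 1 / z) holomorphic_on ball (complex_of_real y) e" by (intro holomorphic_intros nz)
  qed (use inr in blast)
  then have holh: "(\<lambda>z. h (1 / z)) holomorphic_on ball (of_real y) e" by (simp add: o_def)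
  have "K holomorphic_on ball (of_real y) e"
    unfolding K_def[abs_def] by (intro holomorphic_intros holh nz ne1) auto
  then show ?thesis
  proof (rule real_analytic_at_Im[OF _ e(1)])
    fix u assume u: "\<bar>u - y\<bar> < e"
    then have u0: "u > 0" using e by (simp add: abs_less_iff)
    have ub: "complex_of_real u \<in> ball (of_real y) e"
      using u by (simp add: dist_real_def abs_minus_commute)
    have "dist (complex_of_real (1 / u)) (of_real (1 / y)) < r" using inr[OF ub] by (simp add: dist_commute)
    then have "\<bar>1 / u - 1 / y\<bar> < r" unfolding dist_of_real dist_real_def .
    then have hu: "h (of_real (1 / u)) = eta_boundary \<nu> (1 / u)" using h(3) by blast
    moreover have "Im (h (of_real (1 / u))) > 0" using h(2) inr[OF ub] by simp
    ultimately have "eta_boundary \<nu> (1 / u) \<noteq> 1" by auto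
    then have "u \<in> regular_points" using u0 by (auto simp: regular_points_def critical_points_def)
    then have "dens u = Im (of_real (1 / u) / (1 - eta_boundary \<nu> (1 / u)) / of_real pi)"
      using u0 by (simp only: dens_def P_0 Im_divide_of_real if_True)
    then show "dens u = Im (K (of_real u))" using hu by (simp add: K_def)
  qed
qed

end

theorem theorem2p18:
  fixes \<mu> \<nu> :: "real measure" and t :: real
  assumes "prob_on_nonneg \<mu>" and "\<mu> \<noteq> return borel 0" and "t > 1"
    and "is_free_mult_power \<mu> t \<nu>"
  shows
    "(\<forall>x>0. eta_boundary \<nu> x = 1 \<longleftrightarrow>
         x powr (-1/t) \<in> atoms \<mu> \<and> measure \<mu> {x powr (-1/t)} \<ge> (t - 1) / t) \<and>
     (\<forall>x>0. measure \<mu> {x powr (-1/t)} > (t - 1) / t \<longrightarrow>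
         1/x \<in> atoms \<nu> \<and> measure \<nu> {1/x} = t * measure \<mu> {x powr (-1/t)} - (t - 1)) \<and>
     absolutely_continuous lborel (nonatomic_part \<nu>) \<and>
     finite {1/x | x. x > 0 \<and> eta_boundary \<nu> x = 1} \<and>
     (\<exists>f :: real \<Rightarrow> real. f \<in> borel_measurable borel \<and> (\<forall>y. f y \<ge> 0) \<and>
         nonatomic_part \<nu> = density lborel (\<lambda>y. ennreal (f y)) \<and>
         continuous_on ({0<..} - {1/x | x. x > 0 \<and> eta_boundary \<nu> x = 1}) f \<and>
         (\<forall>y. f y \<noteq> 0 \<longrightarrow> real_analytic_at f y))"
proof -
  interpret free_power \<mu> \<nu> t
    using assms unfolding prob_on_nonneg_def is_free_mult_power_def
    by (intro free_power.intro nonneg_law.intro free_power_axioms.intro nonneg_law_axioms.intro) auto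
  have c_eq: "(t - 1) / t = c" using t by (simp add: c_def field_simps)
  have "eta_boundary \<nu> x = 1 \<longleftrightarrow>
      x powr (-1/t) \<in> atoms \<mu> \<and> measure \<mu> {x powr (-1/t)} \<ge> (t - 1) / t" if "x > 0" for x
    unfolding c_eq eta_boundary_eq_1_iff_mass[OF that] using c(1) by (auto simp: atoms_def)
  moreover have "1/x \<in> atoms \<nu> \<and> measure \<nu> {1/x} = t * measure \<mu> {x powr (-1/t)} - (t - 1)"
    if x: "x > 0" "measure \<mu> {x powr (-1/t)} > (t - 1) / t" for x
  proof -
    have "measure \<nu> {1/x} = t * measure \<mu> {x powr (-1/t)} - (t - 1)"
      using atom_mass[OF x(1)] x(2) unfolding c_eq .
    moreover have "t * measure \<mu> {x powr (-1/t)} > t - 1"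
      using x(2) t by (simp add: pos_divide_less_eq mult.commute)
    ultimately show ?thesis by (simp add: atoms_def)
  qed
  moreover have "absolutely_continuous lborel (nonatomic_part \<nu>)"
    unfolding nonatomic_part_eq using dens_measurable by (intro absolutely_continuousI_density) simp
  moreover have "finite {1/x | x. x > 0 \<and> eta_boundary \<nu> x = 1}"
    using finite_critical_points unfolding critical_points_def .
  ultimately show ?thesis
    using dens_measurable dens_nonneg nonatomic_part_eq dens_continuous dens_analytic
    unfolding regular_points_def critical_points_def by blast
qed

end
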